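(* For all $p\in[0,1]$, the biased Brownian separable permuton $\mu^S_p$ has the same distribution as the skew Brownian permuton $\mu_{1,1-p}$ of parameters $\rho=1$ and $q=1-p$.
   Context: Let $(e(t))_{t\in[0,1]}$ be a one-dimensional Brownian excursion on $[0,1]$. Biased Brownian separable permuton. Let $p\in[0,1]$. Conditionally on $e$, let $(s(\ell))_\ell$ be i.i.d. signs indexed by the (countably many) local minima of $e$ with $\mathbb P(s(\ell)=+1)=p=1-\mathbb P(s(\ell)=-1)$. Define a random relation $\vartriangleleft_{\widetilde e,p}$: if $x,y\in[0,1]$, $x<y$, and $\min_{[x,y]}e$ is reached at a unique point which is a strict local minimum $\ell\in[x,y]$, then $x\vartriangleleft_{\widetilde e,p}y$ if $s(\ell)=+1$ and $y\vartriangleleft_{\widetilde e,p}x$ if $s(\ell)=-1$. Set $\psi_{\widetilde e,p}(t)=\mathrm{Leb}(\{x\in[0,1]:x\vartriangleleft_{\widetilde e,p}t\})$. Then $\mu^S_p$ is the push-forward of Lebesgue measure on $[0,1]$ by $(\mathrm{Id},\psi_{\widetilde e,p})$. Skew Brownian permuton for $\rho=1$. Let $q\in[0,1]$. Conditionally on $e$, let $(s(\ell))_\ell$ be i.i.d. signs indexed by the local minima of $e$ with $\mathbb P(s(\ell)=+1)=q=1-\mathbb P(s(\ell)=-1)$. For $0\le u\le t\le1$ set $m^{(u)}(t)=\inf_{[u,t]}e$ and $$Z^{(u)}_{1,q}(t)=(e(t)-m^{(u)}(t))\,s\big(\sup\{r\in[u,t]:e(r)=m^{(u)}(t)\}\big)$$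 (signs at times that are not local minima being fixed arbitrarily; this only affects negligible sets), and $Z^{(u)}_{1,q}(t)=0$ for $t\le u$. These processes solve $dZ^{(u)}(t)=\mathrm{sgn}(Z^{(u)}(t))\,de(t)+(2q-1)\,dL^{Z^{(u)}}(t)$ on $[u,1)$, with $\mathrm{sgn}(x)=\mathbf 1_{\{x>0\}}-\mathbf 1_{\{x\le0\}}$ and $L^{Z^{(u)}}$ the symmetric local time at zero. Set $$\varphi_{Z_{1,q}}(t)=\mathrm{Leb}\big(\{x\in[0,t):Z^{(x)}_{1,q}(t)<0\}\cup\{x\in[t,1]:Z^{(t)}_{1,q}(x)\ge0\}\big),\quad t\in[0,1].$$ Then $\mu_{1,q}$ is the push-forward of Lebesgue measure on $[0,1]$ by $(\mathrm{Id},\varphi_{Z_{1,q}})$. *)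

theory Defs
  imports "HOL-Probability.Probability"
begin

section \<open>The Brownian excursion\<close>

text \<open>Entrance density and transition density of Brownian motion killed at zero.\<close>

definition entrance_density :: "real \<Rightarrow> real \<Rightarrow> real" where
  "entrance_density t x = x / sqrt (2 * pi * t ^ 3) * exp (- (x\<^sup>2 / (2 * t)))"

definition killed_density :: "real \<Rightarrow> real \<Rightarrow> real \<Rightarrow> real" where
  "killed_density t x y =
     (exp (- ((x - y)\<^sup>2 / (2 * t))) - exp (- ((x + y)\<^sup>2 / (2 * t)))) / sqrt (2 * pi * t)"

text \<open>The classical joint density of the normalised excursion at times
  \<open>0 < t 0 < \<dots> < t n < 1\<close>.  The last factor \<open>entrance_density (1 - t n)\<close> is the density of
  the hitting time of zero; \<open>2 * sqrt (2 * pi)\<close> is the constant coming from conditioning the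
  length to be 1.\<close>

definition excursion_density :: "nat \<Rightarrow> (nat \<Rightarrow> real) \<Rightarrow> (nat \<Rightarrow> real) \<Rightarrow> real" where
  "excursion_density n t x =
     (if \<forall>i\<le>n. 0 < x i
      then 2 * sqrt (2 * pi) * entrance_density (t 0) (x 0)
             * (\<Prod>i<n. killed_density (t (Suc i) - t i) (x i) (x (Suc i)))
             * entrance_density (1 - t n) (x n)
      else 0)"

definition brownian_excursion :: "'w measure \<Rightarrow> (real \<Rightarrow> 'w \<Rightarrow> real) \<Rightarrow> bool" where
  "brownian_excursion M e \<longleftrightarrow>
     prob_space M \<and>
     (\<forall>t\<in>{0..1}. e t \<in> borel_measurable M) \<and>
     (AE \<omega> in M. continuous_on {0..1} (\<lambda>t. e t \<omega>) \<and> e 0 \<omega> = 0 \<and> e 1 \<omega> = 0) \<and>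
     (\<forall>n t. strict_mono_on {..n} t \<and> t ` {..n} \<subseteq> {0<..<1} \<longrightarrow>
        distributed M (\<Pi>\<^sub>M i\<in>{..n}. lborel) (\<lambda>\<omega>. \<lambda>i\<in>{..n}. e (t i) \<omega>)
          (\<lambda>x. ennreal (excursion_density n t x)))"

section \<open>Independent signs on the local minima\<close>

definition local_minima :: "(real \<Rightarrow> real) \<Rightarrow> real set" where
  "local_minima f = {l\<in>{0..1}. eventually (\<lambda>r. f l \<le> f r) (at l within {0..1})}"

definition strict_local_minima :: "(real \<Rightarrow> real) \<Rightarrow> real set" where
  "strict_local_minima f = {l\<in>{0..1}. eventually (\<lambda>r. f l < f r) (at l within {0..1})}"

abbreviation path_space :: "(real \<Rightarrow> real) measure" where
  "path_space \<equiv> (\<Pi>\<^sub>M t\<in>{0..1}. borel)"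

abbreviation sample_path :: "(real \<Rightarrow> 'w \<Rightarrow> real) \<Rightarrow> 'w \<Rightarrow> real \<Rightarrow> real" where
  "sample_path e \<omega> \<equiv> (\<lambda>t\<in>{0..1}. e t \<omega>)"

definition sign_pmf :: "real \<Rightarrow> int pmf" where
  "sign_pmf p = map_pmf (\<lambda>b. if b then 1 else - 1) (bernoulli_pmf p)"

text \<open>Conditionally on \<open>e\<close>, the signs \<open>s l\<close> of the local minima \<open>l\<close> of \<open>e\<close> are i.i.d. with
  \<open>P (s l = 1) = p\<close> and \<open>P (s l = - 1) = 1 - p\<close>.  As the index set is random, this is expressed
  through an enumeration \<open>L\<close> of the local minima that is a measurable function of the path: the
  sequence of signs read along \<open>L\<close> is i.i.d. and independent of \<open>e\<close>, that is,
  its joint law with \<open>e\<close> is a product.  The law of the pair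
  \<open>(e, s)\<close> so described does not depend on the choice of \<open>L\<close>.  Nothing is required of \<open>s\<close> at
  times that are not local minima.\<close>

definition iid_signs_on_local_minima ::
    "'w measure \<Rightarrow> (real \<Rightarrow> 'w \<Rightarrow> real) \<Rightarrow> real \<Rightarrow> (real \<Rightarrow> 'w \<Rightarrow> int) \<Rightarrow> bool" where
  "iid_signs_on_local_minima M e p s \<longleftrightarrow>
     (\<exists>(L :: nat \<Rightarrow> (real \<Rightarrow> real) \<Rightarrow> real) (\<sigma> :: nat \<Rightarrow> 'w \<Rightarrow> int).
        (\<forall>n. L n \<in> borel_measurable path_space) \<and>
        (AE \<omega> in M. bij_betw (\<lambda>n. L n (sample_path e \<omega>)) UNIV (local_minima (\<lambda>t. e t \<omega>))) \<and>
        (AE \<omega> in M. \<forall>n. s (L n (sample_path e \<omega>)) \<omega> = \<sigma> n \<omega>) \<and>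
        (\<forall>n. \<sigma> n \<in> M \<rightarrow>\<^sub>M count_space UNIV) \<and>
        distr M (path_space \<Otimes>\<^sub>M (\<Pi>\<^sub>M n\<in>UNIV. count_space UNIV)) (\<lambda>\<omega>. (sample_path e \<omega>, \<lambda>n. \<sigma> n \<omega>)) =
          distr M path_space (sample_path e) \<Otimes>\<^sub>M (\<Pi>\<^sub>M n\<in>UNIV. measure_pmf (sign_pmf p)))"

section \<open>The two permutons driven by a signed path\<close>

abbreviation unit_square :: "(real \<times> real) measure" where
  "unit_square \<equiv> restrict_space borel ({0..1} \<times> {0..1})"

subsection \<open>Biased Brownian separable permuton\<close>

definition unique_strict_min :: "(real \<Rightarrow> real) \<Rightarrow> real \<Rightarrow> real \<Rightarrow> real \<Rightarrow> bool" where
  "unique_strict_min f x y l \<longleftrightarrow>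
     l \<in> {x..y} \<and> (\<forall>r\<in>{x..y} - {l}. f l < f r) \<and> l \<in> strict_local_minima f"

definition signed_less :: "(real \<Rightarrow> real) \<Rightarrow> (real \<Rightarrow> int) \<Rightarrow> real \<Rightarrow> real \<Rightarrow> bool" where
  "signed_less f s x y \<longleftrightarrow>
     (x < y \<and> (\<exists>l. unique_strict_min f x y l \<and> s l = 1)) \<or>
     (y < x \<and> (\<exists>l. unique_strict_min f y x l \<and> s l = - 1))"

definition psi :: "(real \<Rightarrow> real) \<Rightarrow> (real \<Rightarrow> int) \<Rightarrow> real \<Rightarrow> real" where
  "psi f s t = measure lebesgue {x\<in>{0..1}. signed_less f s x t}"

definition separable_permuton ::
    "(real \<Rightarrow> real) \<Rightarrow> (real \<Rightarrow> int) \<Rightarrow> (real \<times> real) measure" where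
  "separable_permuton f s = distr (lebesgue_on {0..1}) unit_square (\<lambda>t. (t, psi f s t))"

subsection \<open>Skew Brownian permuton with correlation parameter 1\<close>

definition running_min :: "(real \<Rightarrow> real) \<Rightarrow> real \<Rightarrow> real \<Rightarrow> real" where
  "running_min f u t = (INF r\<in>{u..t}. f r)"

definition skew_process :: "(real \<Rightarrow> real) \<Rightarrow> (real \<Rightarrow> int) \<Rightarrow> real \<Rightarrow> real \<Rightarrow> real" where
  "skew_process f s u t =
     (if t \<le> u then 0
      else (f t - running_min f u t)
             * real_of_int (s (Sup {r\<in>{u..t}. f r = running_min f u t})))"

definition phi :: "(real \<Rightarrow> real) \<Rightarrow> (real \<Rightarrow> int) \<Rightarrow> real \<Rightarrow> real" where
  "phi f s t = measure lebesgue
     ({x\<in>{0..<t}. skew_process f s x t < 0} \<union> {x\<in>{t..1}. 0 \<le> skew_process f s t x})"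

definition skew_permuton ::
    "(real \<Rightarrow> real) \<Rightarrow> (real \<Rightarrow> int) \<Rightarrow> (real \<times> real) measure" where
  "skew_permuton f s = distr (lebesgue_on {0..1}) unit_square (\<lambda>t. (t, phi f s t))"

section \<open>Equality in distribution\<close>

text \<open>Random elements are taken up to almost sure equality: outside an event of probability one
  a path may be irregular, and the signs off the local minima are arbitrary, so the permutons
  above need only agree almost surely with measurable maps.\<close>

definition equal_in_distribution ::
    "'c measure \<Rightarrow> 'a measure \<Rightarrow> ('a \<Rightarrow> 'c) \<Rightarrow> 'b measure \<Rightarrow> ('b \<Rightarrow> 'c) \<Rightarrow> bool" where
  "equal_in_distribution N M X M' Y \<longleftrightarrow>
     (\<exists>X' Y'. X' \<in> M \<rightarrow>\<^sub>M N \<and> (AE \<omega> in M. X \<omega> = X' \<omega>) \<and>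
              Y' \<in> M' \<rightarrow>\<^sub>M N \<and> (AE \<omega> in M'. Y \<omega> = Y' \<omega>) \<and>
              distr M N X' = distr M' N Y')"

end

theory Submission
  imports Defs
begin

text \<open>
  Both permutons are built from the same two relations. For a typical path \<open>f\<close> and typical times
  \<open>x < t\<close> the minimum of \<open>f\<close> over \<open>[x, t]\<close> is reached at a single interior point \<open>l\<close>, which is then
  a strict local minimum. In the separable permuton, \<open>x\<close> counts for the rank of \<open>t\<close> iff
  \<open>s l = 1\<close>, and \<open>t\<close> for the rank of \<open>x\<close> iff \<open>s l = - 1\<close>. In the skew permuton the excess of \<open>f\<close>
  over its running minimum is positive at \<open>t\<close>, so only the sign matters: \<open>x\<close> counts for \<open>t\<close> iff
  \<open>s l = - 1\<close>, and \<open>t\<close> for \<open>x\<close> iff \<open>s l = 1\<close>. Hence the skew permuton of \<open>s\<close> is the separable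
  permuton of \<open>- s\<close>, and flipping i.i.d. signs of parameter \<open>1 - p\<close> gives i.i.d. signs of
  parameter \<open>p\<close>. Three things remain to be shown.

  \<^bold>\<open>The excursion is typical.\<close> Its finite dimensional densities are at most a constant times those of
  a Gaussian random walk (\<open>excursion_density_le\<close>). For such a walk the difference between the minima of
  two separated blocks of times has a bounded density, because the increment in between is Gaussian
  and independent of the rest (\<open>nn_integral_chain_gap_le\<close>). Applied to fine grids this shows
  that minima over disjoint rational intervals are different (\<open>AE_distinct_minima\<close>); applied to two
  times it shows that increments over time \<open>h\<close> are rarely smaller than \<open>h\<close> to the power \<open>3/4\<close>
  (\<open>AE_rough\<close>). A continuous function with the second property is monotone on no compact set of
  positive measure (\<open>rough_mono_on_null\<close>), so almost no time is a minimum of the path to its right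
  or to its left (\<open>AE_generic_time\<close>). Both properties together yield the unique
  interior minimum (\<open>sole_interior_min_generic\<close>).

  \<^bold>\<open>The law of path and signs does not depend on the enumeration.\<close> Every local minimum that matters
  is the minimum of some rational interval, so the signs can be indexed by rational intervals. Given the
  path, the signs so indexed are i.i.d. up to repetitions, and the pattern of
  repetitions is a function of the path alone
  (\<open>joint_law_of_path_and_signs\<close>). The law of the path is determined by its finite dimensional
  distributions (\<open>distr_sample_path_eq\<close>).

  \<^bold>\<open>The permutons are measurable.\<close> Almost surely each of them is the value, at the path and the signs of
  the rational intervals, of one measurable map \<open>permuton_of\<close>
  (\<open>separable_permuton_eq\<close>, \<open>skew_permuton_eq\<close>, \<open>measurable_permuton_of\<close>).
\<close>

section \<open>Comparing the excursion with a Gaussian random walk\<close>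

text \<open>The factor \<open>x\<close> of the entrance density is absorbed by doubling the variance, which leaves an
integrable Gaussian for the first coordinate of a finite dimensional density.\<close>

lemma entrance_density_le_normal_density:
  assumes "0 < t" "0 < x"
  shows "entrance_density t x \<le> sqrt (2 / t) * normal_density 0 (sqrt (2 * t)) x"
proof -
  define z where "z = x / sqrt t"
  have z: "0 < z" "x = z * sqrt t" using assms by (auto simp: z_def)
  \<comment> \<open>half of the Gaussian exponent suffices to bound the linear factor \<open>z\<close>\<close>
  have "z \<le> 1 + z\<^sup>2 / 4" using zero_le_power2[of "z/2 - 1"] by (simp add: power2_eq_square algebra_simps)
  also have "\<dots> \<le> exp (z\<^sup>2 / 4)" by (rule exp_ge_add_one_self)
  finally have "z * exp (- (z\<^sup>2 / 2)) \<le> exp (z\<^sup>2 / 4) * exp (- (z\<^sup>2 / 2))" by simp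
  also have "\<dots> = exp (- (z\<^sup>2 / 4))" by (simp flip: exp_add)
  finally have *: "z * exp (- (z\<^sup>2 / 2)) \<le> exp (- (z\<^sup>2 / 4))" .
  have c: "sqrt (t ^ 3) = t * sqrt t" using assms by (simp add: power3_eq_cube real_sqrt_mult)
  have "entrance_density t x = (z * exp (- (z\<^sup>2 / 2))) / (sqrt (2 * pi) * t)"
    using assms unfolding entrance_density_def z(2) by (simp add: real_sqrt_mult c power_mult_distrib field_simps)
  also have "\<dots> \<le> exp (- (z\<^sup>2 / 4)) / (sqrt (2 * pi) * t)"
    using * assms by (intro divide_right_mono) auto
  also have "\<dots> = sqrt (2 / t) * normal_density 0 (sqrt (2 * t)) x"
    using assms unfolding normal_density_def z(2)
    by (simp add: real_sqrt_mult real_sqrt_divide power_mult_distrib field_simps)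
  finally show ?thesis .
qed

text \<open>A bound free of \<open>x\<close>, for the last factor of the finite dimensional densities.\<close>

lemma entrance_density_le:
  assumes "0 < t" "0 < x"
  shows "entrance_density t x \<le> 1 / t"
proof -
  have "sqrt (2 / t) * normal_density 0 (sqrt (2 * t)) x \<le> sqrt (2 / t) * (1 / sqrt (2 * pi * (sqrt (2 * t))\<^sup>2))"
    unfolding normal_density_def using assms by (intro mult_left_mono) (auto simp: divide_le_cancel field_simps not_less)
  also have "\<dots> = 1 / t * (1 / sqrt (2 * pi))"
    using assms by (simp add: real_sqrt_mult real_sqrt_divide field_simps)
  also have "\<dots> \<le> 1 / t * 1"
    using assms pi_ge_two by (intro mult_left_mono) (auto simp: field_simps)
  finally show ?thesis using entrance_density_le_normal_density[OF assms] by simp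
qed

lemma killed_density_le_normal_density:
  assumes "0 < t" shows "killed_density t x y \<le> normal_density x (sqrt t) y"
  unfolding killed_density_def normal_density_def using assms
  by (simp add: divide_le_cancel field_simps power2_commute not_less)

text \<open>The total mass of a chain with substochastic kernels, by integrating out the last coordinate again and
again. The kernels need not be Gaussian: below, one of them is replaced by a kernel that forgets
its starting point.\<close>

lemma nn_integral_chain_le:
  fixes g :: "real \<Rightarrow> ennreal" and \<kappa> :: "nat \<Rightarrow> real \<Rightarrow> real \<Rightarrow> ennreal"
  assumes [measurable]: "g \<in> borel_measurable borel" "\<And>i. case_prod (\<kappa> i) \<in> borel_measurable (borel \<Otimes>\<^sub>M borel)"
    and le: "\<And>i x. (\<integral>\<^sup>+y. \<kappa> i x y \<partial>lborel) \<le> 1"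
  shows "(\<integral>\<^sup>+x. g (x 0) * (\<Prod>i<n. \<kappa> i (x i) (x (Suc i))) \<partial>PiM {..n} (\<lambda>_. lborel)) \<le> (\<integral>\<^sup>+x. g x \<partial>lborel)"
proof (induction n)
  case 0
  interpret product_sigma_finite "\<lambda>_::nat. lborel :: real measure" ..
  show ?case by (simp add: product_nn_integral_singleton)
next
  case (Suc n)
  interpret product_sigma_finite "\<lambda>_::nat. lborel :: real measure" ..
  let ?w = "\<lambda>x. g (x 0) * (\<Prod>i<n. \<kappa> i (x i) (x (Suc i)))"
  have "(\<integral>\<^sup>+x. g (x 0) * (\<Prod>i<Suc n. \<kappa> i (x i) (x (Suc i))) \<partial>PiM {..Suc n} (\<lambda>_. lborel)) =
     (\<integral>\<^sup>+x. (\<integral>\<^sup>+y. ?w x * \<kappa> n (x n) y \<partial>lborel) \<partial>PiM {..n} (\<lambda>_. lborel))"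
    unfolding atMost_Suc
    by (subst product_nn_integral_insert) (auto simp: mult.assoc intro!: nn_integral_cong)
  also have "\<dots> = (\<integral>\<^sup>+x. ?w x * (\<integral>\<^sup>+y. \<kappa> n (x n) y \<partial>lborel) \<partial>PiM {..n} (\<lambda>_. lborel))"
    by (intro nn_integral_cong nn_integral_cmult) measurable
  also have "\<dots> \<le> (\<integral>\<^sup>+x. ?w x * 1 \<partial>PiM {..n} (\<lambda>_. lborel))"
    by (intro nn_integral_mono mult_left_mono le) auto
  finally show ?case using Suc by simp
qed

text \<open>Translation of all coordinates after the \<open>k\<close>-th. It moves the minimum of the later block and nothing
else, and it preserves Lebesgue measure.\<close>

definition shift_after :: "nat \<Rightarrow> nat \<Rightarrow> real \<Rightarrow> (nat \<Rightarrow> real) \<Rightarrow> nat \<Rightarrow> real" where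
  "shift_after n k c x = (\<lambda>i\<in>{..n}. if k < i then x i + c else x i)"

lemma measurable_shift_after [measurable]:
  "shift_after n k c \<in> PiM {..n} (\<lambda>_. lborel) \<rightarrow>\<^sub>M PiM {..n} (\<lambda>_. lborel)"
  unfolding shift_after_def by measurable

lemma distr_shift_after:
  "distr (PiM {..n} (\<lambda>_. lborel)) (PiM {..n} (\<lambda>_. lborel)) (shift_after n k c) = PiM {..n} (\<lambda>_. lborel)"
proof -
  interpret product_sigma_finite "\<lambda>_::nat. lborel :: real measure" ..
  show ?thesis
  proof (rule PiM_eqI)
    fix A :: "nat \<Rightarrow> real set" assume A: "\<And>i. i \<in> {..n} \<Longrightarrow> A i \<in> sets lborel"
    let ?B = "\<lambda>i. (\<lambda>y. if k < i then y + c else y) -` A i"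
    have B: "?B i \<in> sets lborel" "emeasure lborel (?B i) = emeasure lborel (A i)" if "i \<le> n" for i
    proof -
      have [measurable]: "A i \<in> sets borel" using A that by auto
      show "?B i \<in> sets lborel" 
        using measurable_sets_borel[of "\<lambda>y. if k < i then y + c else y" borel "A i"] by auto
      show "emeasure lborel (?B i) = emeasure lborel (A i)"
      proof (cases "k < i")
        case True
        have "emeasure lborel (A i) = emeasure (distr lborel borel ((+) c)) (A i)" 
          by (simp add: lborel_distr_plus)
        also have "\<dots> = emeasure lborel (?B i)" using True
          by (subst emeasure_distr) (auto intro!: arg_cong[where f="emeasure lborel"] simp: add.commute)
        finally show ?thesis ..
      qed auto
    qed
    have "shift_after n k c -` (Pi\<^sub>E {..n} A) \<inter> space (PiM {..n} (\<lambda>_. lborel)) = Pi\<^sub>E {..n} ?B"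
      by (auto simp: shift_after_def space_PiM PiE_iff)
    moreover have "emeasure (PiM {..n} (\<lambda>_. lborel)) (Pi\<^sub>E {..n} ?B) = (\<Prod>i\<in>{..n}. emeasure lborel (A i))"
      using B by (subst emeasure_PiM) (auto intro!: prod.cong)
    ultimately show "emeasure (distr (PiM {..n} (\<lambda>_. lborel)) (PiM {..n} (\<lambda>_. lborel)) (shift_after n k c)) (Pi\<^sub>E {..n} A) = (\<Prod>i\<in>{..n}. emeasure lborel (A i))"
      using A by (subst emeasure_distr) (auto intro!: sets_PiM_I_finite)
  qed auto
qed

text \<open>A Gaussian-like chain is cut between the times \<open>k\<close> and \<open>Suc k\<close>. Bounding the kernel across the cut by the
constant \<open>G\<close> makes the rest of the integrand invariant under a common translation of the later
coordinates. This translation moves \<open>B\<close> relative to \<open>A\<close>, so the event that they are within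
\<open>\<epsilon>\<close> of each other receives its share \<open>2 * \<epsilon>\<close> of the translations. The resulting bound is
uniform in the number of times.\<close>

lemma nn_integral_chain_gap_le:
  fixes g :: "real \<Rightarrow> ennreal" and \<kappa> :: "nat \<Rightarrow> real \<Rightarrow> real \<Rightarrow> ennreal" and A B :: "(nat \<Rightarrow> real) \<Rightarrow> real"
  assumes [measurable]: "g \<in> borel_measurable borel" "\<And>i. case_prod (\<kappa> i) \<in> borel_measurable (borel \<Otimes>\<^sub>M borel)"
    and le: "\<And>i x. (\<integral>\<^sup>+y. \<kappa> i x y \<partial>lborel) \<le> 1"
    and trans: "\<And>i x y c. \<kappa> i (x + c) (y + c) = \<kappa> i x y"
    and G: "\<And>x y. \<kappa> k x y \<le> G" and k: "k < n"
    and [measurable]: "A \<in> borel_measurable (PiM {..n} (\<lambda>_. lborel))" "B \<in> borel_measurable (PiM {..n} (\<lambda>_. lborel))"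
    and A: "\<And>x c. A (shift_after n k c x) = A x" and B: "\<And>x c. B (shift_after n k c x) = B x + c"
    and "0 \<le> \<epsilon>"
  shows "(\<integral>\<^sup>+x. g (x 0) * (\<Prod>i<n. \<kappa> i (x i) (x (Suc i))) * indicator {x. \<bar>A x - B x\<bar> \<le> \<epsilon>} x \<partial>PiM {..n} (\<lambda>_. lborel))
    \<le> G * ennreal (2 * \<epsilon>) * (\<integral>\<^sup>+x. g x \<partial>lborel)"
proof -
  interpret product_sigma_finite "\<lambda>_::nat. lborel :: real measure" ..
  interpret sigma_finite_measure "PiM {..n} (\<lambda>_. lborel :: real measure)" by (rule sigma_finite) simp
  let ?M = "PiM {..n} (\<lambda>_. lborel :: real measure)"
  interpret pair_sigma_finite ?M "lborel :: real measure" ..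
  define w where "w x = g (x 0) * (\<Prod>i\<in>{..<n}-{k}. \<kappa> i (x i) (x (Suc i)))" for x
  \<comment> \<open>Lebesgue measure of translations is infinite; \<open>\<psi>\<close> normalises the first coordinate after the cut\<close>
  define \<psi> :: "real \<Rightarrow> ennreal" where "\<psi> = indicator {0..1}"
  have [measurable]: "w \<in> borel_measurable ?M" "\<psi> \<in> borel_measurable borel"
    unfolding w_def \<psi>_def by measurable
  have prod: "(\<Prod>i<n. f i) = f k * (\<Prod>i\<in>{..<n}-{k}. f i)" for f :: "nat \<Rightarrow> ennreal"
    using k by (subst prod.remove[of _ k]) auto
  have w_shift: "w (shift_after n k c x) = w x" for c x
  proof -
    have "\<kappa> i (shift_after n k c x i) (shift_after n k c x (Suc i)) = \<kappa> i (x i) (x (Suc i))" if "i < n" "i \<noteq> k" for i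
      using that trans by (auto simp: shift_after_def not_less_less_Suc_eq)
    then show ?thesis unfolding w_def by (auto simp: shift_after_def intro!: arg_cong2[where f="(*)"] prod.cong)
  qed
  have psi1: "(\<integral>\<^sup>+c. \<psi> (y + c) \<partial>lborel) = 1" for y
  proof -
    have "(\<integral>\<^sup>+c. \<psi> (y + c) \<partial>lborel) = (\<integral>\<^sup>+c. \<psi> c \<partial>distr lborel borel ((+) y))" 
      by (subst nn_integral_distr) auto
    then show ?thesis by (simp add: lborel_distr_plus \<psi>_def)
  qed
  have ind: "(\<integral>\<^sup>+c. indicator {x. \<bar>A x - B x + c\<bar> \<le> \<epsilon>} x \<partial>lborel) = ennreal (2 * \<epsilon>)" for x
  proof -
    have "(\<integral>\<^sup>+c. indicator {x. \<bar>A x - B x + c\<bar> \<le> \<epsilon>} x \<partial>lborel) = (\<integral>\<^sup>+c. indicator {B x - A x - \<epsilon> .. B x - A x + \<epsilon>} c \<partial>lborel)"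
      by (intro nn_integral_cong) (auto simp: indicator_def)
    also have "\<dots> = ennreal (2 * \<epsilon>)" using \<open>0 \<le> \<epsilon>\<close> by simp
    finally show ?thesis .
  qed
  let ?E = "\<lambda>c x. indicator {x. \<bar>A x - B x + c\<bar> \<le> \<epsilon>} x :: ennreal"
  have "(\<integral>\<^sup>+x. g (x 0) * (\<Prod>i<n. \<kappa> i (x i) (x (Suc i))) * indicator {x. \<bar>A x - B x\<bar> \<le> \<epsilon>} x \<partial>?M)
      \<le> (\<integral>\<^sup>+x. G * (w x * ?E 0 x) \<partial>?M)"
    unfolding prod w_def using G
    by (intro nn_integral_mono) (auto simp: indicator_def mult.left_commute[of "g _"] intro!: mult_right_mono)
  also have "\<dots> = G * (\<integral>\<^sup>+x. w x * ?E 0 x \<partial>?M)"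
    by (rule nn_integral_cmult) measurable
  also have "(\<integral>\<^sup>+x. w x * ?E 0 x \<partial>?M) = (\<integral>\<^sup>+x. w x * ?E 0 x * (\<integral>\<^sup>+c. \<psi> (x (Suc k) + c) \<partial>lborel) \<partial>?M)"
    by (simp add: psi1)
  also have "\<dots> = (\<integral>\<^sup>+x. (\<integral>\<^sup>+c. w x * ?E 0 x * \<psi> (x (Suc k) + c) \<partial>lborel) \<partial>?M)"
    by (intro nn_integral_cong nn_integral_cmult[symmetric]) measurable
  also have "\<dots> = (\<integral>\<^sup>+c. (\<integral>\<^sup>+x. w x * ?E 0 x * \<psi> (x (Suc k) + c) \<partial>?M) \<partial>lborel)"
    using k by (intro Fubini'[symmetric]) (auto simp: split_beta')
  also have "\<dots> = (\<integral>\<^sup>+c. (\<integral>\<^sup>+x. w x * ?E c x * \<psi> (x (Suc k)) \<partial>?M) \<partial>lborel)"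
  proof (rule nn_integral_cong)
    fix c :: real
    have "(\<integral>\<^sup>+x. w x * ?E c x * \<psi> (x (Suc k)) \<partial>?M) = (\<integral>\<^sup>+x. w x * ?E c x * \<psi> (x (Suc k)) \<partial>distr ?M ?M (shift_after n k c))"
      by (simp add: distr_shift_after)
    also have "\<dots> = (\<integral>\<^sup>+x. w (shift_after n k c x) * ?E c (shift_after n k c x) * \<psi> (shift_after n k c x (Suc k)) \<partial>?M)"
      using k by (intro nn_integral_distr) auto
    also have "\<dots> = (\<integral>\<^sup>+x. w x * ?E 0 x * \<psi> (x (Suc k) + c) \<partial>?M)"
    proof (intro nn_integral_cong)
      fix x :: "nat \<Rightarrow> real"
      have "shift_after n k c x (Suc k) = x (Suc k) + c" using k by (simp add: shift_after_def)
      then show "w (shift_after n k c x) * ?E c (shift_after n k c x) * \<psi> (shift_after n k c x (Suc k)) = w x * ?E 0 x * \<psi> (x (Suc k) + c)"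
        by (simp add: w_shift A B indicator_def)
    qed
    finally show "(\<integral>\<^sup>+x. w x * ?E 0 x * \<psi> (x (Suc k) + c) \<partial>?M) = (\<integral>\<^sup>+x. w x * ?E c x * \<psi> (x (Suc k)) \<partial>?M)" ..
  qed
  also have "\<dots> = (\<integral>\<^sup>+x. (\<integral>\<^sup>+c. w x * \<psi> (x (Suc k)) * ?E c x \<partial>lborel) \<partial>?M)"
    using k by (subst Fubini') (auto simp: split_beta' mult_ac)
  also have "\<dots> = (\<integral>\<^sup>+x. w x * \<psi> (x (Suc k)) * (\<integral>\<^sup>+c. ?E c x \<partial>lborel) \<partial>?M)"
    by (intro nn_integral_cong nn_integral_cmult) measurable
  also have "\<dots> = (\<integral>\<^sup>+x. ennreal (2 * \<epsilon>) * (w x * \<psi> (x (Suc k))) \<partial>?M)"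
    by (intro nn_integral_cong) (subst ind, simp add: mult_ac)
  also have "\<dots> = ennreal (2 * \<epsilon>) * (\<integral>\<^sup>+x. w x * \<psi> (x (Suc k)) \<partial>?M)"
    using k by (intro nn_integral_cmult) auto
  \<comment> \<open>what is left is again a chain, restarted afresh from \<open>\<psi>\<close> after the cut\<close>
  also have "(\<integral>\<^sup>+x. w x * \<psi> (x (Suc k)) \<partial>?M) =
     (\<integral>\<^sup>+x. g (x 0) * (\<Prod>i<n. (if i = k then (\<lambda>x y. \<psi> y) else \<kappa> i) (x i) (x (Suc i))) \<partial>?M)"
    unfolding prod w_def
    by (intro nn_integral_cong) (auto simp: mult_ac intro!: arg_cong2[where f="(*)"] prod.cong)
  also have "\<dots> \<le> (\<integral>\<^sup>+x. g x \<partial>lborel)"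
    by (intro nn_integral_chain_le) (auto simp: le \<psi>_def)
  finally show ?thesis by (simp add: mult.assoc mult_left_mono)
qed

lemma borel_measurable_Min_image:
  assumes "finite I" "I \<noteq> {}" "\<And>i. i \<in> I \<Longrightarrow> f i \<in> borel_measurable M"
  shows "(\<lambda>x. Min ((\<lambda>i. f i x) ` I) :: real) \<in> borel_measurable M"
  using assms
proof (induction I rule: finite_ne_induct)
  case (insert i I)
  then have "(\<lambda>x. min (f i x) (Min ((\<lambda>i. f i x) ` I))) \<in> borel_measurable M" by simp
  with insert show ?case by simp
qed simp

lemma nn_integral_normal_density: "0 < \<sigma> \<Longrightarrow> (\<integral>\<^sup>+y. ennreal (normal_density \<mu> \<sigma> y) \<partial>lborel) = 1"
  using prob_space.emeasure_space_1[OF prob_space_normal_density[of \<sigma> \<mu>]] by (simp add: emeasure_density)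

lemma normal_density_le: "normal_density \<mu> \<sigma> x \<le> 1 / sqrt (2 * pi * \<sigma>\<^sup>2)"
  unfolding normal_density_def
  by (intro mult_left_le) auto

text \<open>Killing at zero only lowers the transition densities, and the first and the last factor are bounded by
a multiple of a Gaussian and by a constant.\<close>

lemma excursion_density_le:
  assumes t: "strict_mono_on {..n} t" "t ` {..n} \<subseteq> {0<..<1}"
  shows "excursion_density n t x \<le> 2 * sqrt (2 * pi) * sqrt (2 / t 0) / (1 - t n) * normal_density 0 (sqrt (2 * t 0)) (x 0)
    * (\<Prod>i<n. normal_density (x i) (sqrt (t (Suc i) - t i)) (x (Suc i)))"
proof (cases "\<forall>i\<le>n. 0 < x i")
  case False
  have "0 < t 0" "t n < 1" using t by auto
  with False show ?thesis unfolding excursion_density_def if_not_P[OF False]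
    by (intro mult_nonneg_nonneg prod_nonneg) auto
next
  case True
  have t01: "0 < t 0" "t n < 1" using t by auto
  have inc: "0 < t (Suc i) - t i" if "i < n" for i
    using strict_mono_onD[OF t(1), of i "Suc i"] that by auto
  have K: "0 \<le> killed_density (t (Suc i) - t i) (x i) (x (Suc i))"
      "killed_density (t (Suc i) - t i) (x i) (x (Suc i)) \<le> normal_density (x i) (sqrt (t (Suc i) - t i)) (x (Suc i))" if "i < n" for i
  proof -
    have "(x i - x (Suc i))\<^sup>2 \<le> (x i + x (Suc i))\<^sup>2"
      using True that by (simp add: power2_eq_square algebra_simps mult_nonneg_nonneg less_imp_le)
    then have "(x i - x (Suc i))\<^sup>2 / (2 * (t (Suc i) - t i)) \<le> (x i + x (Suc i))\<^sup>2 / (2 * (t (Suc i) - t i))"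
      using inc[OF that] by (intro divide_right_mono) auto
    then show "0 \<le> killed_density (t (Suc i) - t i) (x i) (x (Suc i))"
      using inc[OF that] unfolding killed_density_def by (intro divide_nonneg_nonneg) auto
    show "killed_density (t (Suc i) - t i) (x i) (x (Suc i)) \<le> normal_density (x i) (sqrt (t (Suc i) - t i)) (x (Suc i))"
      by (rule killed_density_le_normal_density[OF inc[OF that]])
  qed
  have e0: "0 \<le> entrance_density a y" if "0 < a" "0 < y" for a y
    using that by (simp add: entrance_density_def)
  have "excursion_density n t x = 2 * sqrt (2 * pi) * (entrance_density (t 0) (x 0)
             * (\<Prod>i<n. killed_density (t (Suc i) - t i) (x i) (x (Suc i)))
             * entrance_density (1 - t n) (x n))"
    using True by (simp add: excursion_density_def)
  also have "\<dots> \<le> 2 * sqrt (2 * pi) * ((sqrt (2 / t 0) * normal_density 0 (sqrt (2 * t 0)) (x 0)) * 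
      (\<Prod>i<n. normal_density (x i) (sqrt (t (Suc i) - t i)) (x (Suc i))) * (1 / (1 - t n)))"
    using True t01 K
    by (intro mult_left_mono mult_mono entrance_density_le entrance_density_le_normal_density prod_mono
        mult_nonneg_nonneg e0 prod_nonneg) (auto intro: order.trans)
  finally show ?thesis by (simp add: mult_ac)
qed

text \<open>The one probabilistic estimate on which all regularity of the excursion rests. It is uniform in the
number of times and depends only on the outermost times and on the gap between the two blocks.\<close>

lemma brownian_excursion_minima_gap:
  assumes exc: "brownian_excursion M e"
    and t: "strict_mono_on {..n} t" "t ` {..n} \<subseteq> {0<..<1}" and k: "k < n" and \<epsilon>: "0 \<le> \<epsilon>"
  shows "emeasure M {\<omega>\<in>space M. \<bar>Min ((\<lambda>i. e (t i) \<omega>) ` {..k}) - Min ((\<lambda>i. e (t i) \<omega>) ` {k<..n})\<bar> \<le> \<epsilon>}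
    \<le> ennreal (6 * \<epsilon> / (t 0 * (1 - t n) * sqrt (t (Suc k) - t k)))"
proof -
  let ?N = "PiM {..n} (\<lambda>_. lborel :: real measure)"
  define A :: "(nat \<Rightarrow> real) \<Rightarrow> real" where "A x = Min ((\<lambda>i. x i) ` {..k})" for x
  define B :: "(nat \<Rightarrow> real) \<Rightarrow> real" where "B x = Min ((\<lambda>i. x i) ` {k<..n})" for x
  have [measurable]: "A \<in> borel_measurable ?N" "B \<in> borel_measurable ?N"
    unfolding A_def B_def using k by (auto intro!: borel_measurable_Min_image)
  define E where "E = {x\<in>space ?N. \<bar>A x - B x\<bar> \<le> \<epsilon>}"
  have [measurable]: "E \<in> sets ?N" unfolding E_def by measurable
  have t01: "0 < t 0" "t 0 < 1" "t n < 1" using t by auto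
  have inc: "0 < t (Suc i) - t i" if "i < n" for i
    using strict_mono_onD[OF t(1), of i "Suc i"] that by auto
  define \<sigma> where "\<sigma> i = (if i < n then sqrt (t (Suc i) - t i) else 1)" for i
  have \<sigma>: "0 < \<sigma> i" for i using inc by (auto simp: \<sigma>_def)
  define C where "C = 2 * sqrt (2 * pi) * sqrt (2 / t 0) / (1 - t n)"
  have "0 \<le> C" using t01 by (simp add: C_def)
  have dist: "distributed M ?N (\<lambda>\<omega>. \<lambda>i\<in>{..n}. e (t i) \<omega>) (\<lambda>x. ennreal (excursion_density n t x))"
    using exc t unfolding brownian_excursion_def by blast
  have "{\<omega>\<in>space M. \<bar>Min ((\<lambda>i. e (t i) \<omega>) ` {..k}) - Min ((\<lambda>i. e (t i) \<omega>) ` {k<..n})\<bar> \<le> \<epsilon>}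
     = (\<lambda>\<omega>. \<lambda>i\<in>{..n}. e (t i) \<omega>) -` E \<inter> space M"
  proof -
    have "(\<lambda>i. restrict f {..n} i) ` {..k} = f ` {..k}" "(\<lambda>i. restrict f {..n} i) ` {k<..n} = f ` {k<..n}" for f :: "nat \<Rightarrow> real"
      using k by (auto intro!: image_cong)
    then show ?thesis by (auto simp: E_def A_def B_def space_PiM)
  qed
  then have "emeasure M {\<omega>\<in>space M. \<bar>Min ((\<lambda>i. e (t i) \<omega>) ` {..k}) - Min ((\<lambda>i. e (t i) \<omega>) ` {k<..n})\<bar> \<le> \<epsilon>}
      = (\<integral>\<^sup>+x. ennreal (excursion_density n t x) * indicator E x \<partial>?N)"
    using distributed_emeasure[OF dist, of E] by simp
  also have "\<dots> \<le> (\<integral>\<^sup>+x. (ennreal C * ennreal (normal_density 0 (sqrt (2 * t 0)) (x 0))) *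
      (\<Prod>i<n. ennreal (normal_density (x i) (\<sigma> i) (x (Suc i)))) * indicator {x. \<bar>A x - B x\<bar> \<le> \<epsilon>} x \<partial>?N)"
  proof (intro nn_integral_mono mult_mono)
    fix x
    have "excursion_density n t x \<le> C * normal_density 0 (sqrt (2 * t 0)) (x 0)
    * (\<Prod>i<n. normal_density (x i) (\<sigma> i) (x (Suc i)))"
      using excursion_density_le[OF t, of x] by (simp add: C_def \<sigma>_def)
    then show "ennreal (excursion_density n t x) \<le> ennreal C * ennreal (normal_density 0 (sqrt (2 * t 0)) (x 0)) *
      (\<Prod>i<n. ennreal (normal_density (x i) (\<sigma> i) (x (Suc i))))"
      using \<open>0 \<le> C\<close> by (simp add: prod_ennreal ennreal_mult'[symmetric] prod_nonneg ennreal_leI flip: ennreal_mult)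
  qed (auto simp: E_def indicator_def)
  also have "\<dots> \<le> ennreal (1 / sqrt (2 * pi * (\<sigma> k)\<^sup>2)) * ennreal (2 * \<epsilon>) * (\<integral>\<^sup>+x. ennreal C * ennreal (normal_density 0 (sqrt (2 * t 0)) x) \<partial>lborel)"
  proof (rule nn_integral_chain_gap_le[where A=A and B=B and \<kappa>="\<lambda>i x y. ennreal (normal_density x (\<sigma> i) y)"])
    fix x :: "nat \<Rightarrow> real" and c
    show "A (shift_after n k c x) = A x"
      unfolding A_def using k by (intro arg_cong[where f=Min] image_cong) (auto simp: shift_after_def)
    have "(\<lambda>i. shift_after n k c x i) ` {k<..n} = (\<lambda>y. y + c) ` (x ` {k<..n})"
      unfolding image_image by (intro image_cong) (auto simp: shift_after_def)
    then show "B (shift_after n k c x) = B x + c"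
      unfolding B_def using k mono_Min_commute[of "\<lambda>y. y + c" "x ` {k<..n}"] by (auto simp: mono_def)
  next
    show "(\<lambda>(x, y). ennreal (normal_density x (\<sigma> i) y)) \<in> borel_measurable (borel \<Otimes>\<^sub>M borel)" for i
      unfolding normal_density_def by measurable
  next
    fix x y c :: real
    show "ennreal (normal_density (x + c) (\<sigma> i) (y + c)) = ennreal (normal_density x (\<sigma> i) y)" for i
      by (simp add: normal_density_def)
  qed (use k \<epsilon> \<sigma> in \<open>auto simp: nn_integral_normal_density intro!: ennreal_leI normal_density_le\<close>)
  also have "(\<integral>\<^sup>+x. ennreal C * ennreal (normal_density 0 (sqrt (2 * t 0)) x) \<partial>lborel) = ennreal C"
    using t01 by (subst nn_integral_cmult) (auto simp: nn_integral_normal_density)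
  also have "ennreal (1 / sqrt (2 * pi * (\<sigma> k)\<^sup>2)) * ennreal (2 * \<epsilon>) * ennreal C = ennreal (1 / sqrt (2 * pi * (\<sigma> k)\<^sup>2) * (2 * \<epsilon>) * C)"
    using \<epsilon> \<open>0 \<le> C\<close> by (subst ennreal_mult''[of C], simp, subst ennreal_mult''[of "2 * \<epsilon>"], simp_all)
  also have "\<dots> \<le> ennreal (6 * \<epsilon> / (t 0 * (1 - t n) * sqrt (t (Suc k) - t k)))"
  proof (intro ennreal_leI)
    have s: "(\<sigma> k)\<^sup>2 = t (Suc k) - t k" using k inc[OF k] by (simp add: \<sigma>_def)
    have "sqrt 2 \<le> 3 / 2" by (rule real_le_lsqrt) (auto simp: power2_eq_square)
    moreover have "t 0 \<le> sqrt (t 0)"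
      using t01 by (intro real_le_rsqrt) (simp add: power2_eq_square)
    ultimately have "sqrt 2 / sqrt (t 0) \<le> (3 / 2) / t 0"
      using t01 by (intro frac_le) auto
    then have "4 * \<epsilon> / ((1 - t n) * sqrt (t (Suc k) - t k)) * (sqrt 2 / sqrt (t 0)) \<le>
        4 * \<epsilon> / ((1 - t n) * sqrt (t (Suc k) - t k)) * ((3 / 2) / t 0)"
      using \<epsilon> t01 inc[OF k] by (intro mult_left_mono) auto
    moreover have "1 / sqrt (2 * pi * (\<sigma> k)\<^sup>2) * (2 * \<epsilon>) * C = 4 * \<epsilon> / ((1 - t n) * sqrt (t (Suc k) - t k)) * (sqrt 2 / sqrt (t 0))"
    proof -
      have "1 / sqrt (2 * pi * u) * (2 * \<epsilon>) * (2 * sqrt (2 * pi) * sqrt (2 / t 0) / v) = 4 * \<epsilon> / (v * sqrt u) * (sqrt 2 / sqrt (t 0))" for u v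
        using t01 by (cases "u = 0 \<or> v = 0") (auto simp: real_sqrt_mult real_sqrt_divide field_simps)
      then show ?thesis unfolding s C_def .
    qed
    moreover have "4 * \<epsilon> / ((1 - t n) * sqrt (t (Suc k) - t k)) * ((3 / 2) / t 0) = 6 * \<epsilon> / (t 0 * (1 - t n) * sqrt (t (Suc k) - t k))"
      by (simp add: field_simps)
    ultimately show "1 / sqrt (2 * pi * (\<sigma> k)\<^sup>2) * (2 * \<epsilon>) * C \<le> 6 * \<epsilon> / (t 0 * (1 - t n) * sqrt (t (Suc k) - t k))" by simp
  qed
  finally show ?thesis .
qed

section \<open>Rough functions and their one-sided minima\<close>

text \<open>With \<open>h = (1/16) ^ n\<close> the threshold \<open>(1/8) ^ n\<close> is \<open>h\<close> to the power \<open>3/4\<close>. Any exponent strictly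
between \<open>1/2\<close> and \<open>1\<close> would do: Brownian increments are of order \<open>h\<close> to the power \<open>1/2\<close>, hence
mostly larger than the threshold, and increments of monotone functions are on average of order \<open>h\<close>,
hence mostly smaller. Times near the endpoints are left out because the densities of the
excursion blow up there.\<close>

definition small_increments :: "(real \<Rightarrow> real) \<Rightarrow> nat \<Rightarrow> nat \<Rightarrow> real set" where
  "small_increments f m n = {x. 1 / Suc m \<le> x \<and> x + (1/16) ^ n \<le> 1 - 1 / Suc m \<and> \<bar>f (x + (1/16) ^ n) - f x\<bar> \<le> (1/8) ^ n}"

definition rough :: "(real \<Rightarrow> real) \<Rightarrow> bool" where
  "rough f \<longleftrightarrow> (\<forall>m. (\<lambda>n. emeasure lborel (small_increments f m n)) \<longlonglongrightarrow> 0)"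

lemma small_increments_uminus: "small_increments (\<lambda>x. - f x) m n = small_increments f m n"
proof -
  have "\<bar>- f (x + (1/16) ^ n) - (- f x)\<bar> = \<bar>f (x + (1/16) ^ n) - f x\<bar>" for x by linarith
  then show ?thesis unfolding small_increments_def by simp
qed

lemma rough_uminus: "rough f \<Longrightarrow> rough (\<lambda>x. - f x)"
  by (simp add: rough_def small_increments_uminus)

lemma closed_small_increments:
  assumes "continuous_on {0..1} f" shows "closed (small_increments f m n)"
proof -
  define h :: real where "h = (1/16) ^ n"
  define p where "p = 1 / real (Suc m)"
  have h: "0 \<le> h" "0 < p" by (auto simp: h_def p_def)
  let ?I = "{p .. 1 - p - h}"
  have "continuous_on ?I (\<lambda>x. f (x + h) - f x)"
    using h by (intro continuous_intros continuous_on_compose2[OF assms]) auto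
  then have "closed {x\<in>?I. \<bar>f (x + h) - f x\<bar> \<le> (1/8) ^ n}"
    by (intro continuous_on_closed_Collect_le continuous_on_rabs continuous_on_const) auto
  moreover have "small_increments f m n = {x\<in>?I. \<bar>f (x + h) - f x\<bar> \<le> (1/8) ^ n}"
    unfolding small_increments_def h_def[symmetric] p_def[symmetric] by auto
  ultimately show ?thesis by simp
qed

lemma nn_integral_lborel_shift:
  fixes F :: "real \<Rightarrow> ennreal"
  assumes [measurable]: "F \<in> borel_measurable borel"
  shows "(\<integral>\<^sup>+x. F (x + h) \<partial>lborel) = (\<integral>\<^sup>+x. F x \<partial>lborel)"
proof -
  have "(\<integral>\<^sup>+x. F x \<partial>lborel) = (\<integral>\<^sup>+x. F x \<partial>distr lborel borel ((+) h))" by (simp add: lborel_distr_plus)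
  also have "\<dots> = (\<integral>\<^sup>+x. F (x + h) \<partial>lborel)" by (subst nn_integral_distr) (auto simp: add.commute)
  finally show ?thesis ..
qed

text \<open>Markov's inequality for \<open>g (x + h) - g x\<close>, whose integral telescopes to at most \<open>h * (u - l)\<close>.\<close>

lemma emeasure_large_increments_mono_le:
  fixes g :: "real \<Rightarrow> real"
  assumes "mono g" and g: "\<And>x. l \<le> g x" "\<And>x. g x \<le> u" and "0 < h" "0 < c"
  shows "emeasure lborel {x\<in>{a..b}. c \<le> g (x + h) - g x} \<le> ennreal (h * (u - l) / c)"
proof -
  have [measurable]: "g \<in> borel_measurable borel" using \<open>mono g\<close> by (rule borel_measurable_mono)
  define D where "D = {x\<in>{a..b}. c \<le> g (x + h) - g x}"
  have [measurable]: "D \<in> sets borel" unfolding D_def by measurable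
  define G where "G x = ennreal (g x - l)" for x
  have [measurable]: "G \<in> borel_measurable borel" unfolding G_def by measurable
  let ?I = "\<integral>\<^sup>+x. indicator {a..b} x * G x \<partial>lborel"
  have "G x \<le> ennreal (u - l)" for x unfolding G_def using g[of x] by (intro ennreal_leI) simp
  then have "?I \<le> (\<integral>\<^sup>+x. indicator {a..b} x * ennreal (u - l) \<partial>lborel)"
    by (intro nn_integral_mono mult_left_mono) simp_all
  also have "\<dots> < \<infinity>" by (cases "a \<le> b") (auto simp: nn_integral_multc ennreal_mult_less_top)
  finally have fin: "?I \<noteq> \<infinity>" by simp
  have "ennreal c * emeasure lborel D + ?I = (\<integral>\<^sup>+x. ennreal c * indicator D x + indicator {a..b} x * G x \<partial>lborel)"
    by (subst nn_integral_add) (auto simp: nn_integral_cmult)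
  also have "\<dots> \<le> (\<integral>\<^sup>+x. indicator {a..b} x * G (x + h) \<partial>lborel)"
  proof (intro nn_integral_mono)
    fix x
    have "g x \<le> g (x + h)" using \<open>mono g\<close> \<open>0 < h\<close> by (auto simp: mono_def)
    moreover have "ennreal c + G x = ennreal (c + (g x - l))" using g \<open>0 < c\<close> by (simp add: G_def ennreal_plus)
    ultimately show "ennreal c * indicator D x + indicator {a..b} x * G x \<le> indicator {a..b} x * G (x + h)"
      by (auto simp: D_def indicator_def G_def intro!: ennreal_leI)
  qed
  also have "\<dots> = (\<integral>\<^sup>+x. (\<lambda>y. indicator {a+h..b+h} y * G y) (x + h) \<partial>lborel)"
    by (intro nn_integral_cong) (auto simp: indicator_def)
  also have "\<dots> = (\<integral>\<^sup>+y. indicator {a+h..b+h} y * G y \<partial>lborel)"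
    by (rule nn_integral_lborel_shift) measurable
  also have "\<dots> \<le> (\<integral>\<^sup>+x. indicator {a..b} x * G x + ennreal (u - l) * indicator {b<..b+h} x \<partial>lborel)"
  proof (intro nn_integral_mono)
    fix x
    have "G x \<le> ennreal (u - l)" unfolding G_def using g by (auto intro!: ennreal_leI)
    then show "indicator {a+h..b+h} x * G x \<le> indicator {a..b} x * G x + ennreal (u - l) * indicator {b<..b+h} x"
      using \<open>0 < h\<close> by (auto simp: indicator_def)
  qed
  also have "\<dots> = ?I + ennreal (u - l) * ennreal h"
    using \<open>0 < h\<close> by (subst nn_integral_add) (auto simp: nn_integral_cmult)
  finally have "ennreal c * emeasure lborel D \<le> ennreal (u - l) * ennreal h"
    using fin by (simp add: add.commute[of ?I] ennreal_add_left_cancel_le)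
  then have "ennreal (1 / c) * (ennreal c * emeasure lborel D) \<le> ennreal (1 / c) * (ennreal (u - l) * ennreal h)"
    by (rule mult_left_mono) simp
  moreover have "ennreal (1 / c) * (ennreal c * emeasure lborel D) = emeasure lborel D"
    using \<open>0 < c\<close> by (simp add: mult.assoc[symmetric] ennreal_mult'[symmetric])
  moreover have "ennreal (1 / c) * (ennreal (u - l) * ennreal h) = ennreal (h * (u - l) / c)"
    using \<open>0 < c\<close> \<open>0 < h\<close> by (simp add: ennreal_mult''[symmetric] ennreal_mult'[symmetric] mult_ac divide_inverse)
  ultimately show ?thesis by (simp add: D_def)
qed

text \<open>Suppose that the compact set \<open>K\<close> has positive measure. For small \<open>h\<close> most points \<open>x\<close> of \<open>K\<close> have
\<open>x + h\<close> in \<open>K\<close> as well, since a translate of \<open>K\<close> stays in a slightly larger open set. At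
such points \<open>f\<close> has the increment of a bounded monotone function, which is mostly of order
\<open>h\<close>, whereas roughness says that small increments are rare.\<close>

lemma rough_mono_on_null:
  fixes f :: "real \<Rightarrow> real"
  assumes cont: "continuous_on {0..1} f" and "rough f" and K: "compact K" "K \<subseteq> {a..b}" "0 < a" "b < 1"
    and mono: "mono_on K f"
  shows "emeasure lborel K = 0"
proof (rule ccontr)
  assume "emeasure lborel K \<noteq> 0"
  have Kfin: "emeasure lborel K < \<infinity>" using emeasure_lborel_cbox_finite emeasure_compact_finite[OF K(1)] by blast
  have [measurable]: "K \<in> sets borel" using K(1) by (simp add: borel_compact)
  define \<mu> where "\<mu> = measure lborel K"
  have \<mu>: "emeasure lborel K = ennreal \<mu>" "0 < \<mu>"
    using Kfin \<open>emeasure lborel K \<noteq> 0\<close> unfolding \<mu>_def by (auto simp: emeasure_eq_ennreal_measure zero_less_measure_iff)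
  have "K \<noteq> {}" using \<open>emeasure lborel K \<noteq> 0\<close> by auto
  have bdd: "bdd_below K" "bdd_above K" using K(1) by (auto simp: bounded_imp_bdd_below bounded_imp_bdd_above compact_imp_bounded)
  define k0 k1 where "k0 = Inf K" "k1 = Sup K"
  have k: "k0 \<in> K" "k1 \<in> K" unfolding k0_k1_def
    using \<open>K \<noteq> {}\<close> bdd K(1) by (auto intro: closed_contains_Inf closed_contains_Sup compact_imp_closed)
  have k_le: "k0 \<le> x" "x \<le> k1" if "x \<in> K" for x
    using that bdd by (auto simp: k0_k1_def cInf_lower cSup_upper)
  have f_le: "f k0 \<le> f x" "f x \<le> f k1" if "x \<in> K" for x
    using mono_onD[OF mono] k k_le that by auto
  \<comment> \<open>a bounded monotone extension of \<open>f\<close> from \<open>K\<close> to the line\<close>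
  define g where "g x = Sup (f ` {y\<in>K. y \<le> max x k0})" for x
  have ne: "f ` {y\<in>K. y \<le> max x k0} \<noteq> {}" for x using k by auto
  have bddg: "bdd_above (f ` {y\<in>K. y \<le> max x k0})" for x using f_le by (auto intro!: bdd_aboveI[of _ "f k1"])
  have "mono g" unfolding g_def
    by (intro monoI cSup_subset_mono ne bddg) auto
  have g_bounds: "f k0 \<le> g x" "g x \<le> f k1" for x
    unfolding g_def using f_le k by (auto intro!: cSup_upper2[OF _ _ bddg] cSup_least[OF ne])
  have g_eq: "g x = f x" if "x \<in> K" for x
    unfolding g_def max_absorb1[OF k_le(1)[OF that]] using that mono_onD[OF mono]
    by (intro cSup_eq_maximum) auto
  obtain U where U: "open U" "K \<subseteq> U" "emeasure lborel (U - K) < ennreal (\<mu> / 2)"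
    using outer_regular_lborel[of K "\<mu> / 2"] \<mu> by auto
  have [measurable]: "U \<in> sets borel" using U by auto
  obtain r where r: "0 < r" "(\<Union>x\<in>K. cball x r) \<subseteq> U"
    using compact_subset_open_imp_cball_epsilon_subset[OF K(1) U(1,2)] by blast
  obtain m :: nat where m: "1 / Suc m < min a (1 - b)"
    using reals_Archimedean[of "min a (1 - b)"] K by (auto simp: inverse_eq_divide)
  let ?h = "\<lambda>n. (1/16) ^ n :: real"
  define D where "D n = {x\<in>{a..b}. (1/8) ^ n \<le> g (x + ?h n) - g x}" for n
  have [measurable]: "g \<in> borel_measurable borel" using \<open>mono g\<close> by (rule borel_measurable_mono)
  have [measurable]: "D n \<in> sets borel" for n unfolding D_def by measurable
  have [measurable]: "small_increments f m n \<in> sets borel" for n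
    using closed_small_increments[OF cont] by auto
  have D: "emeasure lborel (D n) \<le> ennreal ((1/2) ^ n * (f k1 - f k0))" for n
  proof -
    have "?h n * (f k1 - f k0) / (1/8) ^ n = (1/2) ^ n * (f k1 - f k0)"
      by (simp add: field_simps flip: power_mult_distrib)
    then show ?thesis using emeasure_large_increments_mono_le[OF \<open>mono g\<close> g_bounds, of "?h n" "(1/8) ^ n" a b]
      by (simp add: D_def)
  qed
  have "eventually (\<lambda>n. ?h n < r) sequentially"
    using r by (intro order_tendstoD(2)[OF LIMSEQ_power_zero]) auto
  then have "eventually (\<lambda>n. ennreal \<mu> \<le> ennreal (\<mu> / 2) + (emeasure lborel (small_increments f m n) + ennreal ((1/2) ^ n * (f k1 - f k0)))) sequentially"
  proof eventually_elim
    fix n assume h: "?h n < r"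
    let ?V = "(\<lambda>x. x + ?h n) -` (U - K)"
    have [measurable]: "?V \<in> sets borel" using measurable_sets_borel[of "\<lambda>x. x + ?h n" borel "U - K"] by simp
    have V: "emeasure lborel ?V = emeasure lborel (U - K)"
    proof -
      have "(\<integral>\<^sup>+x. indicator ?V x \<partial>lborel) = (\<integral>\<^sup>+x. indicator (U - K) (x + ?h n) \<partial>lborel)"
        by (intro nn_integral_cong) (simp add: indicator_def)
      also have "\<dots> = (\<integral>\<^sup>+x. indicator (U - K) x \<partial>lborel)"
        by (rule nn_integral_lborel_shift) measurable
      finally show ?thesis by simp
    qed
    \<comment> \<open>either \<open>x + h\<close> leaves \<open>K\<close>, or the increment of \<open>f\<close> is small, or the increment of \<open>g\<close> is large\<close>
    have "K \<subseteq> ?V \<union> (small_increments f m n \<union> D n)"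
    proof
      fix x assume x: "x \<in> K"
      show "x \<in> ?V \<union> (small_increments f m n \<union> D n)"
      proof (cases "x + ?h n \<in> K")
        case False
        moreover have "x + ?h n \<in> cball x r" using h by (simp add: dist_real_def)
        then have "x + ?h n \<in> U" using r(2) x by blast
        ultimately show ?thesis by auto
      next
        case True
        have xx: "x \<in> {a..b}" "x + ?h n \<in> {a..b}" using x True K by auto
        have "f x \<le> f (x + ?h n)" by (intro mono_onD[OF mono]) (use x True in auto)
        then show ?thesis using m xx x True
          by (auto simp: small_increments_def D_def g_eq)
      qed
    qed
    then have "emeasure lborel K \<le> emeasure lborel (?V \<union> (small_increments f m n \<union> D n))"
      by (intro emeasure_mono) auto
    also have "\<dots> \<le> emeasure lborel ?V + (emeasure lborel (small_increments f m n) + emeasure lborel (D n))"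
      by (intro order.trans[OF emeasure_subadditive] add_left_mono emeasure_subadditive) auto
    also have "\<dots> \<le> ennreal (\<mu> / 2) + (emeasure lborel (small_increments f m n) + ennreal ((1/2) ^ n * (f k1 - f k0)))"
      using U(3) V D by (intro add_mono) auto
    finally show "ennreal \<mu> \<le> \<dots>" by (simp add: \<mu>)
  qed
  moreover have "(\<lambda>n. ennreal (\<mu> / 2) + (emeasure lborel (small_increments f m n) + ennreal ((1/2) ^ n * (f k1 - f k0)))) \<longlonglongrightarrow> ennreal (\<mu> / 2) + (0 + ennreal (0 * (f k1 - f k0)))"
    using \<open>rough f\<close> unfolding rough_def
    by (intro tendsto_intros tendsto_ennrealI LIMSEQ_power_zero) auto
  ultimately have "ennreal \<mu> \<le> ennreal (\<mu> / 2) + (0 + ennreal (0 * (f k1 - f k0)))"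
    by (intro tendsto_lowerbound) auto
  then show False using \<mu>(2) by simp
qed

text \<open>A time that is a minimum of the path over no interval ending or starting there. Rational other
endpoints suffice, as every nondegenerate interval contains one of them.\<close>

definition generic_time :: "(real \<Rightarrow> real) \<Rightarrow> real \<Rightarrow> bool" where
  "generic_time f t \<longleftrightarrow> 0 < t \<and> t < 1 \<and>
     (\<forall>q::rat. 0 < q \<and> q < 1 \<longrightarrow>
        (t < of_rat q \<longrightarrow> (\<exists>r\<in>{t..of_rat q}. f r < f t)) \<and> (of_rat q < t \<longrightarrow> (\<exists>r\<in>{of_rat q..t}. f r < f t)))"

text \<open>Along the times that are minima of \<open>f\<close> up to \<open>b\<close> the function \<open>f\<close> increases.\<close>

lemma right_minima_null:
  assumes cont: "continuous_on {0..1} f" and "rough f" and ab: "0 < a" "b < 1"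
  shows "emeasure lborel {t\<in>{a..b}. \<forall>r\<in>{t..b}. f t \<le> f r} = 0" and "closed {t\<in>{a..b}. \<forall>r\<in>{t..b}. f t \<le> f r}"
proof -
  let ?K = "{t\<in>{a..b}. \<forall>r\<in>{t..b}. f t \<le> f r}"
  have "?K = {a..b} \<inter> (\<Inter>r\<in>{a..b}. {t\<in>{a..b}. f t \<le> f (max t r)})"
    by (auto simp: max_def)
  also have "closed \<dots>"
    using ab by (intro closed_Int closed_INT ballI continuous_on_closed_Collect_le
        continuous_on_compose2[OF cont] continuous_intros) auto
  finally show cl: "closed ?K" .
  have "bounded ?K" by (rule bounded_subset[OF compact_imp_bounded[OF compact_Icc[of a b]]]) auto
  with cl have "compact ?K" by (simp add: compact_eq_bounded_closed)
  then show "emeasure lborel ?K = 0"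
    by (rule rough_mono_on_null[OF cont \<open>rough f\<close>, of _ a b]) (use ab in \<open>auto intro!: mono_onI\<close>)
qed

text \<open>The mirror image: here \<open>- f\<close> increases.\<close>

lemma left_minima_null:
  assumes cont: "continuous_on {0..1} f" and "rough f" and ab: "0 < a" "b < 1"
  shows "emeasure lborel {t\<in>{a..b}. \<forall>r\<in>{a..t}. f t \<le> f r} = 0" and "closed {t\<in>{a..b}. \<forall>r\<in>{a..t}. f t \<le> f r}"
proof -
  let ?K = "{t\<in>{a..b}. \<forall>r\<in>{a..t}. f t \<le> f r}"
  have "?K = {a..b} \<inter> (\<Inter>r\<in>{a..b}. {t\<in>{a..b}. f t \<le> f (min t r)})"
    by (auto simp: min_def)
  also have "closed \<dots>"
    using ab by (intro closed_Int closed_INT ballI continuous_on_closed_Collect_le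
        continuous_on_compose2[OF cont] continuous_intros) auto
  finally show cl: "closed ?K" .
  have "bounded ?K" by (rule bounded_subset[OF compact_imp_bounded[OF compact_Icc[of a b]]]) auto
  with cl have "compact ?K" by (simp add: compact_eq_bounded_closed)
  then show "emeasure lborel ?K = 0"
    by (rule rough_mono_on_null[OF continuous_on_minus[OF cont] rough_uminus[OF \<open>rough f\<close>], of _ a b])
      (use ab in \<open>auto intro!: mono_onI\<close>)
qed

lemma AE_generic_time:
  assumes cont: "continuous_on {0..1} f" and "rough f"
  shows "AE t in lborel. t \<in> {0..1} \<longrightarrow> generic_time f t"
proof -
  let ?A = "\<lambda>q m. {t\<in>{1 / Suc m..of_rat q}. \<forall>r\<in>{t..of_rat q}. f t \<le> f r}"
  let ?B = "\<lambda>q m. {t\<in>{of_rat q..1 - 1 / Suc m}. \<forall>r\<in>{of_rat q..t}. f t \<le> f r}"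
  have A: "AE t in lborel. t \<notin> ?A q m" if "0 < q" "q < 1" for q :: rat and m
    using right_minima_null[OF assms, of "1 / Suc m" "of_rat q"] that
    by (intro AE_not_in null_setsI) auto
  have B: "AE t in lborel. t \<notin> ?B q m" if "0 < q" "q < 1" for q :: rat and m
    using left_minima_null[OF assms, of "of_rat q" "1 - 1 / Suc m"] that
    by (intro AE_not_in null_setsI) auto
  have "AE t in lborel. \<forall>q::rat. \<forall>m. 0 < q \<and> q < 1 \<longrightarrow> t \<notin> ?A q m \<and> t \<notin> ?B q m"
    unfolding AE_all_countable using A B by auto
  moreover have "AE t in lborel. t \<noteq> 0 \<and> t \<noteq> (1::real)"
    by (intro AE_conjI AE_lborel_singleton)
  ultimately show ?thesis
  proof eventually_elim
    fix t :: real
    assume null: "\<forall>q::rat. \<forall>m. 0 < q \<and> q < 1 \<longrightarrow> t \<notin> ?A q m \<and> t \<notin> ?B q m" and t: "t \<noteq> 0 \<and> t \<noteq> 1"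
    show "t \<in> {0..1} \<longrightarrow> generic_time f t"
    proof
      assume "t \<in> {0..1}"
      with t have t: "0 < t" "t < 1" by auto
      obtain m where m: "1 / Suc m < min t (1 - t)"
        using reals_Archimedean[of "min t (1 - t)"] t by (auto simp: inverse_eq_divide)
      { fix q :: rat assume q: "0 < q" "q < 1"
        then have "t \<notin> ?A q m" "t \<notin> ?B q m" using null by blast+
        then have "t < of_rat q \<longrightarrow> (\<exists>r\<in>{t..of_rat q}. f r < f t)" "of_rat q < t \<longrightarrow> (\<exists>r\<in>{of_rat q..t}. f r < f t)"
          using m t by (auto simp: not_le) }
      then show "generic_time f t" using t unfolding generic_time_def by blast
    qed
  qed
qed

section \<open>Minima over intervals\<close>

definition minimizer :: "(real \<Rightarrow> real) \<Rightarrow> real \<Rightarrow> real \<Rightarrow> real \<Rightarrow> bool" where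
  "minimizer f a b u \<longleftrightarrow> u \<in> {a..b} \<and> (\<forall>r\<in>{a..b}. f u \<le> f r)"

definition distinct_minima :: "(real \<Rightarrow> real) \<Rightarrow> bool" where
  "distinct_minima f \<longleftrightarrow> (\<forall>a b c d :: rat. 0 < a \<and> a < b \<and> b < c \<and> c < d \<and> d < 1 \<longrightarrow>
     (\<forall>u v. minimizer f (of_rat a) (of_rat b) u \<and> minimizer f (of_rat c) (of_rat d) v \<longrightarrow> f u \<noteq> f v))"

definition sole_interior_min :: "(real \<Rightarrow> real) \<Rightarrow> real \<Rightarrow> real \<Rightarrow> real \<Rightarrow> bool" where
  "sole_interior_min f x y l \<longleftrightarrow> x < l \<and> l < y \<and> (\<forall>r\<in>{x..y} - {l}. f l < f r)"

text \<open>Two minimizers of the same interval can be separated by two disjoint rational intervals with equal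
minima. The outer endpoints \<open>a\<close> and \<open>d\<close> may coincide with the minimizers, so that the lemma
applies to interior minimizers of real intervals as well as to all minimizers of rational intervals.\<close>

lemma distinct_minima_no_two:
  assumes "distinct_minima f" "minimizer f x y u" "minimizer f x y v" "u < v"
    and a: "x \<le> of_rat a" "of_rat a \<le> u" "0 < a" and d: "v \<le> of_rat d" "of_rat d \<le> y" "d < 1"
  shows False
proof -
  obtain b where b: "u < of_rat b" "of_rat b < v" using of_rat_dense[OF \<open>u < v\<close>] by blast
  obtain c where c: "of_rat b < (of_rat c :: real)" "of_rat c < v" using of_rat_dense[OF b(2)] by blast
  have "of_rat a < (of_rat b :: real)" "of_rat c < (of_rat d :: real)" using a b c d by linarith+
  then have lt: "a < b" "b < c" "c < d" using c by (simp_all add: of_rat_less)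
  have "minimizer f (of_rat a) (of_rat b) u" "minimizer f (of_rat c) (of_rat d) v"
    using assms b c unfolding minimizer_def by auto
  moreover have "f u = f v" using assms unfolding minimizer_def by (auto intro!: antisym)
  ultimately show False using assms lt unfolding distinct_minima_def by blast
qed

lemma minimizer_exists: "continuous_on {a..b} f \<Longrightarrow> a \<le> b \<Longrightarrow> \<exists>u. minimizer f a b u"
  using continuous_attains_inf[of "{a..b}" f] by (auto simp: minimizer_def)

lemma sole_interior_minI:
  assumes "minimizer f x y l" "x < l" "l < y" "\<And>u. minimizer f x y u \<Longrightarrow> u = l"
  shows "sole_interior_min f x y l"
  unfolding sole_interior_min_def
proof (intro conjI ballI assms)
  fix r assume r: "r \<in> {x..y} - {l}"
  then have "f l \<le> f r" using assms(1) by (auto simp: minimizer_def)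
  moreover have "f l \<noteq> f r" using assms(1) assms(4)[of r] r by (auto simp: minimizer_def)
  ultimately show "f l < f r" by simp
qed

text \<open>Generic times are not minima of the intervals that they bound, so all minimizers are interior;
distinct minima leave only one.\<close>

lemma sole_interior_min_generic:
  assumes cont: "continuous_on {0..1} f" and dm: "distinct_minima f"
    and x: "generic_time f x" and y: "generic_time f y" and "x < y"
  shows "\<exists>l. sole_interior_min f x y l"
proof -
  have xy: "0 < x" "x < 1" "0 < y" "y < 1" using x y by (auto simp: generic_time_def)
  obtain q :: rat where q: "x < of_rat q" "of_rat q < y" using of_rat_dense[OF \<open>x < y\<close>] by blast
  then have "0 < (of_rat q :: real)" "of_rat q < (1 :: real)" using xy by linarith+
  then have q01: "0 < q" "q < 1" by simp_all
  have inner: "x < u" "u < y" if "minimizer f x y u" for u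
  proof -
    have "\<exists>r\<in>{x..of_rat q}. f r < f x" "\<exists>r\<in>{of_rat q..y}. f r < f y"
      using x y q q01 unfolding generic_time_def by blast+
    then obtain r r' where "r \<in> {x..of_rat q}" and r2: "f r < f x" and "r' \<in> {of_rat q..y}" and r2': "f r' < f y"
      by blast
    then have r: "r \<in> {x..y}" and r': "r' \<in> {x..y}" using q by auto
    from that have u: "u \<in> {x..y}" "\<And>r. r \<in> {x..y} \<Longrightarrow> f u \<le> f r" by (auto simp: minimizer_def)
    from u(2)[OF r] u(2)[OF r'] r2 r2' have "u \<noteq> x" "u \<noteq> y" by auto
    with u(1) show "x < u" "u < y" by auto
  qed
  have no_two: False if uv: "minimizer f x y u" "minimizer f x y v" "u < v" for u v
  proof -
    obtain a d where a: "x < of_rat a" "of_rat a < u" and d: "v < of_rat d" "of_rat d < y"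
      using of_rat_dense[OF inner(1)[OF uv(1)]] of_rat_dense[OF inner(2)[OF uv(2)]] by blast
    then have "0 < (of_rat a :: real)" "of_rat d < (1 :: real)" using xy by linarith+
    then show False using distinct_minima_no_two[OF dm uv, of a d] a d by simp
  qed
  obtain l where l: "minimizer f x y l"
    using minimizer_exists[of x y f] \<open>x < y\<close> xy continuous_on_subset[OF cont, of "{x..y}"] by auto
  have "u = l" if "minimizer f x y u" for u
    using no_two[OF that l] no_two[OF l that] by (cases u l rule: linorder_cases) auto
  then show ?thesis using sole_interior_minI[OF l inner[OF l]] by blast
qed

lemma sole_interior_min_rational:
  assumes dm: "distinct_minima f" and ab: "0 < a" "b < 1"
    and l: "minimizer f (of_rat a) (of_rat b) l" "of_rat a < l" "l < of_rat b"
  shows "sole_interior_min f (of_rat a) (of_rat b) l"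
proof (rule sole_interior_minI[OF l])
  fix u assume u: "minimizer f (of_rat a) (of_rat b) u"
  then have "u \<in> {of_rat a..of_rat b}" by (simp add: minimizer_def)
  then show "u = l"
    using distinct_minima_no_two[OF dm u l(1), of a b] distinct_minima_no_two[OF dm l(1) u, of a b] ab l
    by (cases u l rule: linorder_cases) auto
qed

lemma continuous_ge_on_interval:
  fixes f :: "real \<Rightarrow> real"
  assumes "continuous_on {x..y} f" "x < y" and ge: "\<And>r::rat. of_rat r \<in> {x..y} \<Longrightarrow> c \<le> f (of_rat r)"
    and "s \<in> {x..y}"
  shows "c \<le> f s"
proof (rule ccontr)
  assume "\<not> c \<le> f s"
  then obtain d where d: "0 < d" "\<And>r. r \<in> {x..y} \<Longrightarrow> dist r s < d \<Longrightarrow> dist (f r) (f s) < c - f s"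
    using assms(1,4) unfolding continuous_on_iff by (metis diff_gt_0_iff_gt not_le)
  have "max x (s - d) < min y (s + d)" using assms d by auto
  then obtain r :: rat where "max x (s - d) < of_rat r" "of_rat r < min y (s + d)" using of_rat_dense by blast
  then have r: "of_rat r \<in> {x..y}" "dist (of_rat r) s < d" by (auto simp: dist_real_def abs_if)
  show False using d(2)[OF r] ge[OF r(1)] by (simp add: dist_real_def)
qed

text \<open>For a continuous \<open>f\<close> with a sole minimum over \<open>[x, y]\<close> this says that the minimum lies in the open interval
\<open>(a, b)\<close>, see \<open>inside_min_iff\<close>. Only rational arguments are inspected, which makes the predicate
measurable in \<open>f\<close> for the product \<open>\<sigma>\<close>-algebra. The comparison is strict so that the
minimum cannot sit at \<open>a\<close> or \<open>b\<close>.\<close>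

definition inside_min :: "(real \<Rightarrow> real) \<Rightarrow> real \<Rightarrow> real \<Rightarrow> real \<Rightarrow> real \<Rightarrow> bool" where
  "inside_min f x y a b \<longleftrightarrow> x < a \<and> a < b \<and> b < y \<and>
     (\<exists>q::rat. of_rat q \<in> {a..b} \<and> (\<forall>r::rat. of_rat r \<in> {x..a} \<union> {b..y} \<longrightarrow> f (of_rat q) < f (of_rat r)))"

lemma inside_min_outer:
  assumes cont: "continuous_on {x..y} f" and i: "inside_min f x y a b"
  obtains q :: rat where "of_rat q \<in> {a..b}" "\<And>r. r \<in> {x..a} \<union> {b..y} \<Longrightarrow> f (of_rat q) \<le> f r"
    "of_rat q \<notin> {x..a} \<union> {b..y}"
proof -
  obtain q :: rat where q: "x < a" "a < b" "b < y" "of_rat q \<in> {a..b}"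
    and less': "\<forall>r::rat. of_rat r \<in> {x..a} \<union> {b..y} \<longrightarrow> f (of_rat q) < f (of_rat r)"
    using i unfolding inside_min_def by (elim conjE exE) (rule that)
  note less = less'[THEN spec, THEN mp]
  have "f (of_rat q) \<le> f r" if "r \<in> {x..a} \<union> {b..y}" for r
    using that
  proof
    assume "r \<in> {x..a}"
    then show ?thesis using q less
      by (rule_tac continuous_ge_on_interval[of x a f, OF continuous_on_subset[OF cont]]) (auto intro: less_imp_le)
  next
    assume "r \<in> {b..y}"
    then show ?thesis using q less
      by (rule_tac continuous_ge_on_interval[of b y f, OF continuous_on_subset[OF cont]]) (auto intro: less_imp_le)
  qed
  moreover have "of_rat q \<notin> {x..a} \<union> {b..y}" using less[of q] by blast
  ultimately show thesis using that q(4) by blast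
qed

text \<open>By continuity the rational values decide: if the minimum is inside, a rational point close to it lies
below everything outside \<open>(a, b)\<close>.\<close>

lemma inside_min_iff:
  assumes cont: "continuous_on {x..y} f" and l: "sole_interior_min f x y l"
  shows "inside_min f x y a b \<longleftrightarrow> x < a \<and> a < l \<and> l < b \<and> b < y"
proof
  assume i: "inside_min f x y a b"
  then have ab: "x < a" "a < b" "b < y" by (auto simp: inside_min_def)
  obtain q :: rat where q: "of_rat q \<in> {a..b}" "\<And>r. r \<in> {x..a} \<union> {b..y} \<Longrightarrow> f (of_rat q) \<le> f r"
    "of_rat q \<notin> {x..a} \<union> {b..y}"
    using inside_min_outer[OF cont i] by metis
  have "l \<notin> {x..a} \<union> {b..y}"
  proof
    assume *: "l \<in> {x..a} \<union> {b..y}"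
    then have "f (of_rat q) \<le> f l" using q by blast
    moreover have "of_rat q \<in> {x..y}" using q ab by auto
    moreover have "\<forall>r\<in>{x..y} - {l}. f l < f r" using l by (simp add: sole_interior_min_def)
    ultimately have "of_rat q = l" by (metis DiffI singletonD not_le)
    with q(3) * show False by metis
  qed
  then show "x < a \<and> a < l \<and> l < b \<and> b < y" using ab l unfolding sole_interior_min_def by auto
next
  assume ab: "x < a \<and> a < l \<and> l < b \<and> b < y"
  obtain u where u: "minimizer f x a u"
    using minimizer_exists[of x a f] continuous_on_subset[OF cont, of "{x..a}"] ab by auto
  obtain v where v: "minimizer f b y v"
    using minimizer_exists[of b y f] continuous_on_subset[OF cont, of "{b..y}"] ab by auto
  have "f l < f u" "f l < f v" using l u v ab unfolding sole_interior_min_def minimizer_def by auto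
  then have pos: "0 < min (f u) (f v) - f l" by simp
  have "\<exists>d>0. \<forall>r\<in>{x..y}. dist r l < d \<longrightarrow> dist (f r) (f l) < min (f u) (f v) - f l"
    using cont pos ab unfolding continuous_on_iff by auto
  then obtain d where d: "0 < d" "\<And>r. r \<in> {x..y} \<Longrightarrow> dist r l < d \<Longrightarrow> dist (f r) (f l) < min (f u) (f v) - f l"
    by blast
  have "l < min b (l + d)" using ab d by auto
  then obtain q :: rat where q: "l < of_rat q" "of_rat q < min b (l + d)" using of_rat_dense by blast
  have "dist (f (of_rat q)) (f l) < min (f u) (f v) - f l" using q ab by (intro d(2)) (auto simp: dist_real_def abs_if)
  then have fq: "f (of_rat q) < f u" "f (of_rat q) < f v" by (auto simp: dist_real_def abs_less_iff)
  have "f (of_rat q) < f (of_rat r)" if "of_rat r \<in> {x..a} \<union> {b..y}" for r :: rat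
    using that
  proof
    assume "of_rat r \<in> {x..a}"
    then have "f u \<le> f (of_rat r)" using u by (simp add: minimizer_def)
    with fq show ?thesis by simp
  next
    assume "of_rat r \<in> {b..y}"
    then have "f v \<le> f (of_rat r)" using v by (simp add: minimizer_def)
    with fq show ?thesis by simp
  qed
  then show "inside_min f x y a b"
    unfolding inside_min_def using q ab by (intro conjI exI[of _ q] allI impI) auto
qed

text \<open>The position of the minimum as a countable infimum of measurable functions of the path, namely of the
right ends of the rational intervals that contain it. The value \<open>b\<close> signals that there is no interior
minimum.\<close>

definition argmin_loc :: "(real \<Rightarrow> real) \<Rightarrow> real \<Rightarrow> real \<Rightarrow> real" where
  "argmin_loc f a b = (INF k::rat \<times> rat. if inside_min f a b (of_rat (fst k)) (of_rat (snd k)) then of_rat (snd k) else b)"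

lemma bdd_below_argmin_loc:
  "bdd_below (range (\<lambda>k::rat \<times> rat. if inside_min f a b (of_rat (fst k)) (of_rat (snd k)) then of_rat (snd k) else b))"
  by (rule bdd_belowI[of _ "min a b"]) (auto simp: inside_min_def)

lemma argmin_loc_eq:
  assumes cont: "continuous_on {a..b} f" and l: "sole_interior_min f a b l"
  shows "argmin_loc f a b = l"
proof -
  have ab: "a < l" "l < b" using l by (auto simp: sole_interior_min_def)
  note i = inside_min_iff[OF cont l]
  show ?thesis unfolding argmin_loc_def
  proof (rule antisym)
    show "l \<le> (INF k::rat \<times> rat. if inside_min f a b (of_rat (fst k)) (of_rat (snd k)) then of_rat (snd k) else b)"
      using ab by (intro cINF_greatest) (auto simp: i)
    show "(INF k::rat \<times> rat. if inside_min f a b (of_rat (fst k)) (of_rat (snd k)) then of_rat (snd k) else b) \<le> l"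
    proof (rule dense_ge)
      fix z assume "l < z"
      then have "l < min z b" using ab by simp
      then obtain d :: rat where d: "l < of_rat d" "of_rat d < min z b" using of_rat_dense by blast
      obtain c :: rat where c: "a < of_rat c" "of_rat c < l" using of_rat_dense[OF ab(1)] by blast
      show "(INF k::rat \<times> rat. if inside_min f a b (of_rat (fst k)) (of_rat (snd k)) then of_rat (snd k) else b) \<le> z"
        using c d by (intro cINF_lower2[OF bdd_below_argmin_loc, of "(c, d)"]) (auto simp: i)
    qed
  qed
qed

lemma argmin_loc_less_imp_inside_min:
  assumes "argmin_loc f a b < b"
  shows "\<exists>c d. inside_min f a b c d"
proof (rule ccontr)
  assume "\<not> ?thesis"
  then have "argmin_loc f a b = (INF k::rat \<times> rat. b)" unfolding argmin_loc_def by simp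
  with assms show False by simp
qed

lemma inside_min_imp_minimizer:
  assumes cont: "continuous_on {x..y} f" and i: "inside_min f x y a b"
  shows "\<exists>l. minimizer f x y l \<and> x < l \<and> l < y"
proof -
  from i have ab: "x < a" "a < b" "b < y" by (auto simp: inside_min_def)
  obtain q :: rat where q: "of_rat q \<in> {a..b}" "\<And>r. r \<in> {x..a} \<union> {b..y} \<Longrightarrow> f (of_rat q) \<le> f r"
    using inside_min_outer[OF cont i] by metis
  obtain l where l: "minimizer f a b l"
    using minimizer_exists[of a b f] continuous_on_subset[OF cont, of "{a..b}"] ab by auto
  have "f l \<le> f r" if "r \<in> {x..y}" for r
  proof (cases "r \<in> {a..b}")
    case False
    then have "f (of_rat q) \<le> f r" using that by (intro q) auto
    moreover have "f l \<le> f (of_rat q)" using l q by (auto simp: minimizer_def)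
    ultimately show ?thesis by simp
  qed (use l in \<open>auto simp: minimizer_def\<close>)
  then show ?thesis using l ab by (intro exI[of _ l]) (auto simp: minimizer_def)
qed

text \<open>The natural numbers enumerate the pairs of rationals, and \<open>lo j\<close>, \<open>hi j\<close> are the endpoints of the
\<open>j\<close>-th interval. Signs will be read off along this fixed enumeration, which, unlike an
enumeration of the local minima, does not depend on the path.\<close>

definition lo :: "nat \<Rightarrow> real" where "lo j = of_rat (fst (from_nat j :: rat \<times> rat))"
definition hi :: "nat \<Rightarrow> real" where "hi j = of_rat (snd (from_nat j :: rat \<times> rat))"

definition has_min :: "(real \<Rightarrow> real) \<Rightarrow> nat \<Rightarrow> bool" where
  "has_min f j \<longleftrightarrow> 0 < lo j \<and> lo j < hi j \<and> hi j < 1 \<and> argmin_loc f (lo j) (hi j) < hi j"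

definition min_at :: "(real \<Rightarrow> real) \<Rightarrow> nat \<Rightarrow> real" where
  "min_at f j = argmin_loc f (lo j) (hi j)"

text \<open>At rational endpoints the measurable notions coincide with the intended ones, because distinct minima
exclude a second minimizer even at the endpoints.\<close>

lemma has_min_iff:
  assumes cont: "continuous_on {0..1} f" and dm: "distinct_minima f" and j: "0 < lo j" "lo j < hi j" "hi j < 1"
  shows "has_min f j \<longleftrightarrow> (\<exists>l. sole_interior_min f (lo j) (hi j) l)"
    and "sole_interior_min f (lo j) (hi j) l \<Longrightarrow> min_at f j = l"
proof -
  have cont': "continuous_on {lo j..hi j} f" using j by (intro continuous_on_subset[OF cont]) auto
  show eq: "min_at f j = l" if "sole_interior_min f (lo j) (hi j) l" for l
    using argmin_loc_eq[OF cont' that] by (simp add: min_at_def)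
  show "has_min f j \<longleftrightarrow> (\<exists>l. sole_interior_min f (lo j) (hi j) l)"
  proof
    assume "has_min f j"
    then obtain c d where "inside_min f (lo j) (hi j) c d"
      using argmin_loc_less_imp_inside_min unfolding has_min_def by blast
    then obtain l where "minimizer f (lo j) (hi j) l" "lo j < l" "l < hi j"
      using inside_min_imp_minimizer[OF cont'] by blast
    then show "\<exists>l. sole_interior_min f (lo j) (hi j) l"
      using sole_interior_min_rational[OF dm, of "fst (from_nat j)" "snd (from_nat j)" l] j by (auto simp: lo_def hi_def)
  next
    assume "\<exists>l. sole_interior_min f (lo j) (hi j) l"
    then obtain l where l: "sole_interior_min f (lo j) (hi j) l" ..
    then show "has_min f j" using eq[OF l] j unfolding has_min_def min_at_def sole_interior_min_def by simp
  qed
qed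

lemma sole_interior_min_min_at:
  assumes "continuous_on {0..1} f" "distinct_minima f" "has_min f j"
  shows "sole_interior_min f (lo j) (hi j) (min_at f j)"
  using has_min_iff[OF assms(1,2), of j] assms(3) by (auto simp: has_min_def)

lemma sole_interior_min_subset:
  "sole_interior_min f x y l \<Longrightarrow> x \<le> a \<Longrightarrow> a < l \<Longrightarrow> l < b \<Longrightarrow> b \<le> y \<Longrightarrow> sole_interior_min f a b l"
  unfolding sole_interior_min_def by auto

lemma sole_interior_min_local:
  assumes "sole_interior_min f x y l" "0 \<le> x" "y \<le> 1"
  shows "l \<in> strict_local_minima f" "l \<in> local_minima f"
proof -
  have *: "eventually (\<lambda>r. f l < f r) (at l within {0..1})"
    unfolding eventually_at_filter
    using assms unfolding sole_interior_min_def
    by (intro eventually_mono[OF eventually_nhds_in_open[of "{x<..<y}" l]]) auto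
  then show "l \<in> strict_local_minima f" using assms by (simp add: strict_local_minima_def sole_interior_min_def)
  have "eventually (\<lambda>r. f l \<le> f r) (at l within {0..1})"
    using * by eventually_elim simp
  then show "l \<in> local_minima f"
    using assms by (simp add: local_minima_def sole_interior_min_def)
qed

text \<open>
  Given signs \<open>\<tau>\<close> indexed by rational intervals, the sign at the minimum of \<open>[x, y]\<close> is \<open>\<tau> j\<close> for
  any \<open>j\<close> whose interval lies in \<open>[x, y]\<close> and contains this minimum.
\<close>

definition sign_between :: "(real \<Rightarrow> real) \<Rightarrow> (nat \<Rightarrow> int) \<Rightarrow> real \<Rightarrow> real \<Rightarrow> int \<Rightarrow> bool" where
  "sign_between f \<tau> x y v \<longleftrightarrow> (\<exists>j. inside_min f x y (lo j) (hi j) \<and> \<tau> j = v)"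

lemma sign_between_iff:
  assumes cont: "continuous_on {0..1} f" and dm: "distinct_minima f"
    and l: "sole_interior_min f x y l" and xy: "0 \<le> x" "y \<le> 1"
    and \<tau>: "\<And>j. has_min f j \<Longrightarrow> \<tau> j = s (min_at f j)"
  shows "sign_between f \<tau> x y v \<longleftrightarrow> s l = v"
proof -
  have cont': "continuous_on {x..y} f" using xy by (intro continuous_on_subset[OF cont]) auto
  have val: "\<tau> j = s l" if "inside_min f x y (lo j) (hi j)" for j
  proof -
    have i: "x < lo j \<and> lo j < l \<and> l < hi j \<and> hi j < y" using that by (simp add: inside_min_iff[OF cont' l])
    then have "sole_interior_min f (lo j) (hi j) l" using l by (auto intro: sole_interior_min_subset)
    then show ?thesis using has_min_iff[OF cont dm, of j] \<tau>[of j] i xy by auto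
  qed
  obtain a :: rat where a: "x < of_rat a" "of_rat a < l" using l of_rat_dense unfolding sole_interior_min_def by blast
  obtain b :: rat where b: "l < of_rat b" "of_rat b < y" using l of_rat_dense unfolding sole_interior_min_def by blast
  have i: "inside_min f x y (lo (to_nat (a, b))) (hi (to_nat (a, b)))"
    using a b by (simp add: inside_min_iff[OF cont' l] lo_def hi_def)
  show ?thesis
  proof
    assume "sign_between f \<tau> x y v"
    then obtain j where "inside_min f x y (lo j) (hi j)" "\<tau> j = v" unfolding sign_between_def by (elim exE conjE)
    with val[of j] show "s l = v" by simp
  next
    assume "s l = v"
    with i val[OF i] show "sign_between f \<tau> x y v"
      unfolding sign_between_def by (intro exI[of _ "to_nat (a, b)"] conjI) simp_all
  qed
qed

section \<open>Almost sure regularity of the excursion\<close>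

lemma eventually_grid_close_to_min:
  fixes f :: "real \<Rightarrow> real"
  assumes cont: "continuous_on {a..b} f" and ab: "a < b" and u: "u \<in> {a..b}" and "0 < \<epsilon>"
  shows "eventually (\<lambda>m. \<exists>i\<le>m. f (a + real i * ((b - a) / real m)) \<le> f u + \<epsilon>) sequentially"
proof -
  obtain d where d: "0 < d" "\<And>r. r \<in> {a..b} \<Longrightarrow> dist r u < d \<Longrightarrow> dist (f r) (f u) < \<epsilon>"
    using cont u \<open>0 < \<epsilon>\<close> unfolding continuous_on_iff by metis
  have "(\<lambda>m. (b - a) / real m) \<longlonglongrightarrow> 0" by (rule lim_const_over_n)
  then have "eventually (\<lambda>m. (b - a) / real m < d) sequentially" using d(1) by (rule order_tendstoD(2))
  then show ?thesis using eventually_gt_at_top[of 0]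
  proof eventually_elim
    fix m :: nat assume m: "(b - a) / real m < d" "0 < m"
    define w where "w = (b - a) / real m"
    have w: "0 < w" "real m * w = b - a" "w < d" using ab m by (auto simp: w_def)
    define i where "i = nat \<lfloor>(u - a) / w\<rfloor>"
    have "0 \<le> (u - a) / w" using u w by auto
    then have "real i \<le> (u - a) / w" "(u - a) / w < real i + 1" unfolding i_def by linarith+
    then have i: "real i * w \<le> u - a" "u - a < (real i + 1) * w" using w by (auto simp: field_simps)
    have "real i * w \<le> real m * w" using i u w by auto
    then have "i \<le> m" using w(1) by simp
    moreover have "f (a + real i * w) \<le> f u + \<epsilon>"
    proof -
      have "dist (a + real i * w) u < d" using i w by (auto simp: dist_real_def abs_less_iff algebra_simps)
      moreover have "a + real i * w \<in> {a..b}" using i u w by auto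
      ultimately show ?thesis using d(2) by (fastforce simp: dist_real_def abs_less_iff)
    qed
    ultimately show "\<exists>i\<le>m. f (a + real i * ((b - a) / real m)) \<le> f u + \<epsilon>" unfolding w_def by blast
  qed
qed

text \<open>A grid of mesh \<open>(b - a) / m\<close> on \<open>[a, b]\<close> with the indices \<open>0, \<dots>, m\<close>, followed by one on \<open>[c, d]\<close>
with the indices \<open>m + 1, \<dots>, 2 * m + 1\<close>.\<close>

definition two_grids :: "real \<Rightarrow> real \<Rightarrow> real \<Rightarrow> real \<Rightarrow> nat \<Rightarrow> nat \<Rightarrow> real" where
  "two_grids a b c d m i = (if i \<le> m then a + real i * ((b - a) / real m) else c + real (i - Suc m) * ((d - c) / real m))"

lemma two_grids_strict_mono:
  assumes "a < b" "b < c" "c < d" "0 < m"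
  shows "strict_mono (two_grids a b c d m)"
  unfolding strict_mono_Suc_iff
proof
  fix i
  define w1 w2 where "w1 = (b - a) / real m" and "w2 = (d - c) / real m"
  have w: "0 < w1" "0 < w2" "a + real m * w1 = b" using assms by (auto simp: w1_def w2_def)
  note t_eq = two_grids_def[of a b c d m, folded w1_def w2_def]
  consider "i < m" | "i = m" | "m < i" by linarith
  then show "two_grids a b c d m i < two_grids a b c d m (Suc i)"
  proof cases
    case 1 then show ?thesis using w by (simp add: t_eq algebra_simps)
  next
    case 2 then show ?thesis using w assms by (simp add: t_eq)
  next
    case 3
    then obtain k where "i = Suc m + k" using less_imp_Suc_add by auto
    then show ?thesis using w by (simp add: t_eq Suc_diff_le algebra_simps)
  qed
qed

text \<open>If the two minima agree, the minima over the two grids are eventually within any \<open>\<epsilon>\<close> of each other.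
The gap estimate bounds the probability of this by a multiple of \<open>\<epsilon>\<close>, whatever the mesh.\<close>

lemma AE_minima_differ:
  fixes a b c d :: real
  assumes exc: "brownian_excursion M e" and abcd: "0 < a" "a < b" "b < c" "c < d" "d < 1"
  shows "AE \<omega> in M. \<forall>u v. minimizer (\<lambda>t. e t \<omega>) a b u \<and> minimizer (\<lambda>t. e t \<omega>) c d v \<longrightarrow> e u \<omega> \<noteq> e v \<omega>"
proof -
  interpret prob_space M using exc by (simp add: brownian_excursion_def)
  have meas: "e t \<in> borel_measurable M" if "t \<in> {0..1}" for t using exc that by (simp add: brownian_excursion_def)
  let ?t = "two_grids a b c d"
  define gap where "gap m \<omega> = \<bar>Min ((\<lambda>i. e (?t m i) \<omega>) ` {..m}) - Min ((\<lambda>i. e (?t m i) \<omega>) ` {m<..2*m+1})\<bar>" for m \<omega>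
  define E where "E N m = {\<omega>\<in>space M. gap m \<omega> \<le> 1 / Suc N}" for N m :: nat
  define C where "C = 6 / (a * (1 - d) * sqrt (c - b))"
  have range: "?t m i \<in> {a..d}" "?t m 0 = a" "?t m (2*m+1) = d" "?t m (Suc m) - ?t m m = c - b" if "0 < m" "i \<le> 2*m+1" for m i
  proof -
    show "?t m 0 = a" "?t m (2*m+1) = d" "?t m (Suc m) - ?t m m = c - b"
      using that by (auto simp: two_grids_def)
    then show "?t m i \<in> {a..d}"
      using strict_monoD[OF two_grids_strict_mono, of a b c d m] abcd that
      by (metis atLeastAtMost_iff le0 less_eq_real_def order_le_less)
  qed
  have t01: "?t m i \<in> {0..1}" if "0 < m" "i \<le> 2*m+1" for m i using range(1)[OF that] abcd by auto
  have gap_meas: "gap m \<in> borel_measurable M" if "0 < m" for m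
    unfolding gap_def using that
    by (auto intro!: borel_measurable_abs borel_measurable_diff borel_measurable_Min_image meas t01 simp del: atLeastAtMost_iff)
  have E_meas: "E N m \<in> sets M" if "0 < m" for N m
    unfolding E_def using gap_meas[OF that] by measurable
  have E_le: "emeasure M (E N m) \<le> ennreal (C / Suc N)" if "0 < m" for N m
  proof -
    have "strict_mono_on {..2*m+1} (?t m)" "?t m ` {..2*m+1} \<subseteq> {0<..<1}"
      using two_grids_strict_mono[OF abcd(2-4) that] range(1)[OF that] abcd
      by (auto simp: strict_mono_on_def strict_mono_def) force+
    from brownian_excursion_minima_gap[OF exc this, of m "1 / Suc N"] range[OF that, of 0]
    show ?thesis by (simp add: E_def gap_def C_def mult_ac)
  qed
  \<comment> \<open>the grid minima are eventually closer than any \<open>1 / Suc N\<close>; \<open>Suc k\<close> keeps the mesh well defined\<close>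
  define Z where "Z = (\<Inter>N. \<Union>k. \<Inter>m\<in>{Suc k..}. E N m)"
  have inter_meas: "(\<Inter>m\<in>{Suc k..}. E N m) \<in> sets M" for N k
    by (intro sets.countable_INT') (auto intro!: E_meas)
  have Z_meas: "Z \<in> sets M" unfolding Z_def using inter_meas by (intro sets.countable_INT') auto
  have "emeasure M Z \<le> ennreal (C / Suc N)" for N
  proof -
    have "emeasure M Z \<le> emeasure M (\<Union>k. \<Inter>m\<in>{Suc k..}. E N m)"
      using inter_meas by (intro emeasure_mono) (auto simp: Z_def)
    also have "\<dots> = (SUP k. emeasure M (\<Inter>m\<in>{Suc k..}. E N m))"
      using inter_meas by (intro SUP_emeasure_incseq[symmetric]) (auto simp: incseq_def intro!: INT_anti_mono)
    also have "\<dots> \<le> ennreal (C / Suc N)"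
    proof (intro SUP_least)
      fix k
      have "emeasure M (\<Inter>m\<in>{Suc k..}. E N m) \<le> emeasure M (E N (Suc k))"
        by (intro emeasure_mono) (auto intro!: E_meas)
      then show "emeasure M (\<Inter>m\<in>{Suc k..}. E N m) \<le> ennreal (C / Suc N)" using E_le[of "Suc k" N] by simp
    qed
    finally show ?thesis .
  qed
  moreover have "(\<lambda>N. ennreal (C / Suc N)) \<longlonglongrightarrow> ennreal 0"
    using LIMSEQ_Suc[OF lim_const_over_n[of C]] by (intro tendsto_ennrealI) simp
  ultimately have "emeasure M Z \<le> ennreal 0" by (intro LIMSEQ_le_const) auto
  then have "AE \<omega> in M. \<omega> \<notin> Z" using Z_meas by (intro AE_not_in null_setsI) auto
  moreover have "AE \<omega> in M. continuous_on {0..1} (\<lambda>t. e t \<omega>)"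
    using exc unfolding brownian_excursion_def by (auto elim: eventually_mono)
  moreover have "AE \<omega> in M. \<omega> \<in> space M" by (rule AE_space)
  ultimately show ?thesis
  proof eventually_elim
    fix \<omega> assume nZ: "\<omega> \<notin> Z" and cont: "continuous_on {0..1} (\<lambda>t. e t \<omega>)" and sp: "\<omega> \<in> space M"
    let ?f = "\<lambda>t. e t \<omega>"
    have cont1: "continuous_on {a..b} ?f" and cont2: "continuous_on {c..d} ?f"
      using abcd by (auto intro: continuous_on_subset[OF cont])
    show "\<forall>u v. minimizer ?f a b u \<and> minimizer ?f c d v \<longrightarrow> e u \<omega> \<noteq> e v \<omega>"
    proof (intro allI impI notI)
      fix u v assume uv: "minimizer ?f a b u \<and> minimizer ?f c d v" and eq: "e u \<omega> = e v \<omega>"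
      have u: "u \<in> {a..b}" and v: "v \<in> {c..d}" using uv by (auto simp: minimizer_def)
      have "eventually (\<lambda>m. gap m \<omega> \<le> \<epsilon>) sequentially" if "0 < \<epsilon>" for \<epsilon>
        using eventually_grid_close_to_min[OF cont1 abcd(2) u that]
          eventually_grid_close_to_min[OF cont2 abcd(4) v that] eventually_gt_at_top[of 0]
      proof eventually_elim
        fix m :: nat
        assume 1: "\<exists>i\<le>m. ?f (a + real i * ((b - a) / real m)) \<le> ?f u + \<epsilon>"
          and 2: "\<exists>i\<le>m. ?f (c + real i * ((d - c) / real m)) \<le> ?f v + \<epsilon>" and m: "0 < m"
        let ?A = "(\<lambda>i. e (?t m i) \<omega>) ` {..m}" and ?B = "(\<lambda>i. e (?t m i) \<omega>) ` {m<..2*m+1}"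
        have tA: "?t m i \<in> {a..b}" if "i \<le> m" for i
        proof -
          have "real i * ((b - a) / real m) \<le> real m * ((b - a) / real m)"
            using that abcd by (intro mult_right_mono) auto
          then show ?thesis using that m abcd by (simp add: two_grids_def)
        qed
        have tB: "?t m i \<in> {c..d}" if "m < i" "i \<le> 2*m+1" for i
        proof -
          have "real (i - Suc m) * ((d - c) / real m) \<le> real m * ((d - c) / real m)"
            using that abcd by (intro mult_right_mono) auto
          then show ?thesis using that m abcd by (simp add: two_grids_def)
        qed
        have A: "?f u \<le> Min ?A" "Min ?A \<le> ?f u + \<epsilon>"
        proof -
          show "?f u \<le> Min ?A" using uv tA by (auto simp: minimizer_def)
          obtain i where i: "i \<le> m" "?f (a + real i * ((b - a) / real m)) \<le> ?f u + \<epsilon>" using 1 by blast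
          have "Min ?A \<le> e (a + real i * ((b - a) / real m)) \<omega>"
            using i(1) by (intro Min_le image_eqI[of _ _ i]) (auto simp: two_grids_def)
          with i(2) show "Min ?A \<le> ?f u + \<epsilon>" by linarith
        qed
        have B: "?f v \<le> Min ?B" "Min ?B \<le> ?f v + \<epsilon>"
        proof -
          show "?f v \<le> Min ?B" using uv tB by (auto simp: minimizer_def)
          obtain i where i: "i \<le> m" "?f (c + real i * ((d - c) / real m)) \<le> ?f v + \<epsilon>" using 2 by blast
          have "Min ?B \<le> e (c + real i * ((d - c) / real m)) \<omega>"
            using i(1) by (intro Min_le image_eqI[of _ _ "Suc m + i"]) (auto simp: two_grids_def)
          with i(2) show "Min ?B \<le> ?f v + \<epsilon>" by linarith
        qed
        show "gap m \<omega> \<le> \<epsilon>" unfolding gap_def using A B eq by linarith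
      qed
      then have *: "\<exists>k. \<forall>m\<ge>k. gap m \<omega> \<le> 1 / Suc N" for N unfolding eventually_sequentially by simp
      have "\<exists>k. \<forall>m\<in>{Suc k..}. \<omega> \<in> E N m" for N
      proof -
        obtain k where "\<forall>m\<ge>k. gap m \<omega> \<le> 1 / Suc N" using * by blast
        then have "\<forall>m\<in>{Suc k..}. \<omega> \<in> E N m" using sp by (simp add: E_def)
        then show ?thesis ..
      qed
      then have "\<omega> \<in> Z" unfolding Z_def by (simp only: INT_iff UN_iff ball_UNIV bex_UNIV simp_thms)
      with nZ show False ..
    qed
  qed
qed

lemma AE_distinct_minima:
  assumes exc: "brownian_excursion M e"
  shows "AE \<omega> in M. distinct_minima (\<lambda>t. e t \<omega>)"
  unfolding distinct_minima_def AE_all_countable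
proof (intro allI)
  fix a b c d :: rat
  show "AE \<omega> in M. 0 < a \<and> a < b \<and> b < c \<and> c < d \<and> d < 1 \<longrightarrow>
     (\<forall>u v. minimizer (\<lambda>t. e t \<omega>) (of_rat a) (of_rat b) u \<and> minimizer (\<lambda>t. e t \<omega>) (of_rat c) (of_rat d) v \<longrightarrow> e u \<omega> \<noteq> e v \<omega>)"
  proof (cases "0 < a \<and> a < b \<and> b < c \<and> c < d \<and> d < 1")
    case True
    then have "AE \<omega> in M. \<forall>u v. minimizer (\<lambda>t. e t \<omega>) (of_rat a) (of_rat b) u \<and> minimizer (\<lambda>t. e t \<omega>) (of_rat c) (of_rat d) v \<longrightarrow> e u \<omega> \<noteq> e v \<omega>"
      by (intro AE_minima_differ[OF exc]) (auto simp: of_rat_less)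
    then show ?thesis by eventually_elim simp
  next
    case False
    then show ?thesis by (intro AE_I2 impI) (simp only: False)
  qed
qed

lemma brownian_excursion_increment:
  assumes exc: "brownian_excursion M e" and x: "0 < x" "0 < h" "x + h < 1" and "0 \<le> \<epsilon>"
  shows "emeasure M {\<omega>\<in>space M. \<bar>e (x + h) \<omega> - e x \<omega>\<bar> \<le> \<epsilon>} \<le> ennreal (6 * \<epsilon> / (x * (1 - (x + h)) * sqrt h))"
proof -
  define t where "t i = (if i = 0 then x else x + h)" for i :: nat
  have one: "{0<..Suc 0} = {Suc 0}" by (rule set_eqI) (simp, linarith)
  have t: "t i \<in> {0<..<1}" for i using x by (simp add: t_def)
  have "strict_mono_on {..1} t" using x by (intro strict_mono_onI) (simp add: t_def)
  moreover have "t ` {..1} \<subseteq> {0<..<1}" using t by (intro image_subsetI)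
  ultimately have "strict_mono_on {..1} t" "t ` {..1} \<subseteq> {0<..<1}" .
  from brownian_excursion_minima_gap[OF exc this, of 0 \<epsilon>] \<open>0 \<le> \<epsilon>\<close>
  show ?thesis by (simp add: t_def one abs_minus_commute)
qed

definition clamp01 :: "real \<Rightarrow> real" where "clamp01 x = max 0 (min 1 x)"

text \<open>A version of the process that is jointly measurable in time and \<open>\<omega>\<close>, as needed for Tonelli's theorem. It
agrees with the process on \<open>[0, 1]\<close> along continuous paths.\<close>

definition dyadic_limit :: "(real \<Rightarrow> 'a \<Rightarrow> real) \<Rightarrow> real \<Rightarrow> 'a \<Rightarrow> real" where
  "dyadic_limit e x \<omega> = lim (\<lambda>k. e (clamp01 (of_int \<lfloor>2 ^ k * clamp01 x\<rfloor> / 2 ^ k)) \<omega>)"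

lemma measurable_dyadic_limit:
  assumes "\<And>t. t \<in> {0..1} \<Longrightarrow> e t \<in> borel_measurable M"
  shows "(\<lambda>(x, \<omega>). dyadic_limit e x \<omega>) \<in> borel_measurable (borel \<Otimes>\<^sub>M M)"
proof -
  have "(\<lambda>z. e (clamp01 (of_int \<lfloor>2 ^ k * clamp01 (fst z)\<rfloor> / 2 ^ k)) (snd z)) \<in> borel_measurable (borel \<Otimes>\<^sub>M M)" for k
  proof (rule measurable_compose_countable[where f="\<lambda>i z. e (clamp01 (of_int i / 2 ^ k)) (snd z)"])
    show "(\<lambda>z. e (clamp01 (of_int i / 2 ^ k)) (snd z)) \<in> borel_measurable (borel \<Otimes>\<^sub>M M)" for i :: int
      using assms[of "clamp01 (of_int i / 2 ^ k)"] by (auto simp: clamp01_def intro!: measurable_compose[OF measurable_snd])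
    show "(\<lambda>z. \<lfloor>2 ^ k * clamp01 (fst z)\<rfloor>) \<in> measurable (borel \<Otimes>\<^sub>M M) (count_space UNIV)"
      unfolding clamp01_def by measurable
  qed
  then show ?thesis unfolding dyadic_limit_def split_beta by (rule borel_measurable_lim_metric)
qed

lemma dyadic_limit_eq:
  assumes cont: "continuous_on {0..1} (\<lambda>t. e t \<omega>)" and x: "x \<in> {0..1}"
  shows "dyadic_limit e x \<omega> = e x \<omega>"
proof -
  have c: "clamp01 x = x" using x by (simp add: clamp01_def)
  define z where "z k = of_int \<lfloor>2 ^ k * x\<rfloor> / (2::real) ^ k" for k
  have z: "z k \<in> {0..1}" "x - (1/2) ^ k \<le> z k" "z k \<le> x" for k
  proof -
    have *: "of_int \<lfloor>2 ^ k * x\<rfloor> \<le> 2 ^ k * x" "2 ^ k * x - 1 \<le> of_int \<lfloor>2 ^ k * x\<rfloor>" by linarith+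
    then show "z k \<le> x" unfolding z_def by (simp add: pos_divide_le_eq mult.commute)
    have "x - (1/2) ^ k = (2 ^ k * x - 1) / 2 ^ k" by (simp add: diff_divide_distrib power_divide)
    also have "\<dots> \<le> z k" unfolding z_def using * by (intro divide_right_mono) auto
    finally show "x - (1/2) ^ k \<le> z k" .
    have "0 \<le> \<lfloor>2 ^ k * x\<rfloor>" using x by simp
    then have "0 \<le> z k" unfolding z_def by simp
    with \<open>z k \<le> x\<close> x show "z k \<in> {0..1}" by auto
  qed
  have "(\<lambda>k. x - (1/2) ^ k) \<longlonglongrightarrow> x - 0" by (intro tendsto_intros LIMSEQ_power_zero) auto
  then have "z \<longlonglongrightarrow> x"
    using z by (intro tendsto_sandwich[of "\<lambda>k. x - (1/2) ^ k" z sequentially "\<lambda>_. x"]) auto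
  then have "(\<lambda>k. e (z k) \<omega>) \<longlonglongrightarrow> e x \<omega>"
    using z x by (intro continuous_on_tendsto_compose[OF cont]) auto
  moreover have "clamp01 (z k) = z k" for k using z[of k] by (simp add: clamp01_def)
  ultimately show ?thesis unfolding dyadic_limit_def c by (simp add: z_def limI)
qed

lemma ennreal_suminf_finite_tendsto_0:
  fixes F :: "nat \<Rightarrow> ennreal"
  assumes "(\<Sum>n. F n) \<noteq> \<infinity>"
  shows "F \<longlonglongrightarrow> 0"
proof -
  have "F n \<noteq> \<infinity>" for n using ennreal_suminf_lessD[of F \<infinity> n] assms by (simp add: less_top)
  then have F: "F n = ennreal (enn2real (F n))" for n by (simp add: less_top)
  have "summable (\<lambda>n. enn2real (F n))"
    using assms by (intro summable_suminf_not_top) (simp_all flip: F)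
  then have "(\<lambda>n. ennreal (enn2real (F n))) \<longlonglongrightarrow> ennreal 0"
    by (intro tendsto_ennrealI summable_LIMSEQ_zero)
  then show ?thesis by (simp flip: F)
qed

text \<open>An increment over time \<open>h\<close> has a density of order \<open>1 / sqrt h\<close>, so for \<open>h = (1/16) ^ n\<close> it is below
\<open>(1/8) ^ n\<close> with probability of order \<open>(1/2) ^ n\<close>. By Tonelli the expected measure of the small
increments is summable in \<open>n\<close>.\<close>

lemma AE_rough:
  assumes exc: "brownian_excursion M e"
  shows "AE \<omega> in M. rough (\<lambda>t. e t \<omega>)"
proof -
  interpret prob_space M using exc by (simp add: brownian_excursion_def)
  interpret pair_sigma_finite "lborel :: real measure" M ..
  have meas: "e t \<in> borel_measurable M" if "t \<in> {0..1}" for t using exc that by (simp add: brownian_excursion_def)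
  have cont: "AE \<omega> in M. continuous_on {0..1} (\<lambda>t. e t \<omega>)"
    using exc unfolding brownian_excursion_def by (auto elim: eventually_mono)
  let ?E = "dyadic_limit e"
  have Em [measurable]: "(\<lambda>(x, \<omega>). ?E x \<omega>) \<in> borel_measurable (borel \<Otimes>\<^sub>M M)"
    by (rule measurable_dyadic_limit[OF meas])
  have "AE \<omega> in M. (\<lambda>n. emeasure lborel (small_increments (\<lambda>t. e t \<omega>) m n)) \<longlonglongrightarrow> 0" for m
  proof -
    let ?p = "1 / real (Suc m)"
    let ?h = "\<lambda>n. (1/16) ^ n :: real"
    define P where "P n x \<omega> \<longleftrightarrow> ?p \<le> x \<and> x + ?h n \<le> 1 - ?p \<and> \<bar>?E (x + ?h n) \<omega> - ?E x \<omega>\<bar> \<le> (1/8) ^ n" for n x \<omega>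
    have E1 [measurable]: "(\<lambda>z. ?E (fst z) (snd z)) \<in> borel_measurable (lborel \<Otimes>\<^sub>M M)"
      using Em by (simp add: split_beta cong: measurable_cong_sets)
    have E2 [measurable]: "(\<lambda>z. ?E (fst z + ?h n) (snd z)) \<in> borel_measurable (lborel \<Otimes>\<^sub>M M)" for n
    proof -
      have "(\<lambda>z. (fst z + ?h n, snd z)) \<in> lborel \<Otimes>\<^sub>M M \<rightarrow>\<^sub>M borel \<Otimes>\<^sub>M M" by measurable
      from measurable_compose[OF this Em] show ?thesis by simp
    qed
    have P_meas: "{z\<in>space (lborel \<Otimes>\<^sub>M M). P n (fst z) (snd z)} \<in> sets (lborel \<Otimes>\<^sub>M M)" for n
      unfolding P_def by measurable
    define F where "F n \<omega> = (\<integral>\<^sup>+x. indicator {z\<in>space (lborel \<Otimes>\<^sub>M M). P n (fst z) (snd z)} (x, \<omega>) \<partial>lborel)" for n \<omega>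
    have F_meas: "F n \<in> borel_measurable M" for n
      unfolding F_def using P_meas by measurable
    have F_int: "(\<integral>\<^sup>+\<omega>. F n \<omega> \<partial>M) \<le> ennreal (6 * (real (Suc m))\<^sup>2 * (1/2) ^ n)" for n
    proof -
      have "(\<integral>\<^sup>+\<omega>. F n \<omega> \<partial>M) = (\<integral>\<^sup>+x. (\<integral>\<^sup>+\<omega>. indicator {z\<in>space (lborel \<Otimes>\<^sub>M M). P n (fst z) (snd z)} (x, \<omega>) \<partial>M) \<partial>lborel)"
        unfolding F_def using P_meas by (intro Fubini') (auto simp: split_beta')
      also have "\<dots> \<le> (\<integral>\<^sup>+x. ennreal (6 * (real (Suc m))\<^sup>2 * (1/2) ^ n) * indicator {0..1::real} x \<partial>lborel)"
      proof (intro nn_integral_mono)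
        fix x :: real
        show "(\<integral>\<^sup>+\<omega>. indicator {z\<in>space (lborel \<Otimes>\<^sub>M M). P n (fst z) (snd z)} (x, \<omega>) \<partial>M) \<le> ennreal (6 * (real (Suc m))\<^sup>2 * (1/2) ^ n) * indicator {0..1} x"
        proof (cases "?p \<le> x \<and> x + ?h n \<le> 1 - ?p")
          case False
          then have "(\<integral>\<^sup>+\<omega>. indicator {z\<in>space (lborel \<Otimes>\<^sub>M M). P n (fst z) (snd z)} (x, \<omega>) \<partial>M) = (\<integral>\<^sup>+\<omega>. 0 \<partial>M)"
            by (intro nn_integral_cong) (auto simp: P_def indicator_def)
          then show ?thesis by simp
        next
          case True
          have p: "0 < ?p" by simp
          have h: "0 < ?h n" by simp
          have x: "0 < x" "x + ?h n < 1" "x \<le> 1" using True p h by linarith+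
          have sq: "sqrt (?h n) = (1/4) ^ n"
          proof (rule real_sqrt_unique)
            show "((1/4) ^ n)\<^sup>2 = ?h n" by (simp add: power2_eq_square flip: power_mult_distrib)
          qed simp
          have x01: "x \<in> {0..1}" "x + ?h n \<in> {0..1}" using x h unfolding atLeastAtMost_iff by linarith+
          have [measurable]: "e x \<in> borel_measurable M" "e (x + ?h n) \<in> borel_measurable M" by (rule meas[OF x01(1)], rule meas[OF x01(2)])
          have "(\<integral>\<^sup>+\<omega>. indicator {z\<in>space (lborel \<Otimes>\<^sub>M M). P n (fst z) (snd z)} (x, \<omega>) \<partial>M)
            = (\<integral>\<^sup>+\<omega>. indicator {\<omega>\<in>space M. \<bar>e (x + ?h n) \<omega> - e x \<omega>\<bar> \<le> (1/8) ^ n} \<omega> \<partial>M)"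
          proof (rule nn_integral_cong_AE)
            show "AE \<omega> in M. (indicator {z\<in>space (lborel \<Otimes>\<^sub>M M). P n (fst z) (snd z)} (x, \<omega>) :: ennreal) =
               indicator {\<omega>\<in>space M. \<bar>e (x + ?h n) \<omega> - e x \<omega>\<bar> \<le> (1/8) ^ n} \<omega>"
              using cont
            proof eventually_elim
              fix \<omega> assume c: "continuous_on {0..1} (\<lambda>t. e t \<omega>)"
              have "?E x \<omega> = e x \<omega>" "?E (x + ?h n) \<omega> = e (x + ?h n) \<omega>"
                by (rule dyadic_limit_eq[where e=e and \<omega>=\<omega>, OF c x01(1)], rule dyadic_limit_eq[where e=e and \<omega>=\<omega>, OF c x01(2)])
              then show "(indicator {z\<in>space (lborel \<Otimes>\<^sub>M M). P n (fst z) (snd z)} (x, \<omega>) :: ennreal) =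
               indicator {\<omega>\<in>space M. \<bar>e (x + ?h n) \<omega> - e x \<omega>\<bar> \<le> (1/8) ^ n} \<omega>"
                using True by (simp add: P_def indicator_def space_pair_measure)
            qed
          qed
          also have "\<dots> = emeasure M {\<omega>\<in>space M. \<bar>e (x + ?h n) \<omega> - e x \<omega>\<bar> \<le> (1/8) ^ n}"
            by (rule nn_integral_indicator) measurable
          also have "\<dots> \<le> ennreal (6 * (1/8) ^ n / (x * (1 - (x + ?h n)) * sqrt (?h n)))"
            using x h by (intro brownian_excursion_increment[OF exc]) auto
          also have "\<dots> \<le> ennreal (6 * (real (Suc m))\<^sup>2 * (1/2) ^ n)"
          proof (intro ennreal_leI)
            have "?p * ?p \<le> x * (1 - (x + ?h n))" using True p by (intro mult_mono) linarith+
            then have "6 * (1/8) ^ n / (x * (1 - (x + ?h n)) * sqrt (?h n)) \<le> 6 * (1/8) ^ n / ((?p * ?p) * (1/4) ^ n)"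
              unfolding sq using x p by (intro divide_left_mono mult_right_mono mult_pos_pos) auto
            also have "\<dots> = 6 * (real (Suc m))\<^sup>2 * ((1/8) ^ n / (1/4) ^ n)"
              by (simp add: power2_eq_square)
            also have "(1/8) ^ n / (1/4) ^ n = ((1/2) ^ n :: real)" by (simp flip: power_divide)
            finally show "6 * (1/8) ^ n / (x * (1 - (x + ?h n)) * sqrt (?h n)) \<le> 6 * (real (Suc m))\<^sup>2 * (1/2) ^ n" .
          qed
          finally show ?thesis using x by simp
        qed
      qed
      also have "\<dots> = ennreal (6 * (real (Suc m))\<^sup>2 * (1/2) ^ n)"
        by (simp add: nn_integral_cmult)
      finally show ?thesis .
    qed
    have "(\<integral>\<^sup>+\<omega>. (\<Sum>n. F n \<omega>) \<partial>M) = (\<Sum>n. \<integral>\<^sup>+\<omega>. F n \<omega> \<partial>M)"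
      by (rule nn_integral_suminf[OF F_meas])
    also have "\<dots> \<le> (\<Sum>n. ennreal (6 * (real (Suc m))\<^sup>2 * (1/2) ^ n))"
      by (intro suminf_le F_int) auto
    also have "\<dots> = ennreal (\<Sum>n. 6 * (real (Suc m))\<^sup>2 * (1/2) ^ n)"
      by (intro suminf_ennreal2 summable_mult summable_geometric) auto
    finally have "(\<integral>\<^sup>+\<omega>. (\<Sum>n. F n \<omega>) \<partial>M) \<noteq> \<infinity>" by (auto simp: top_unique)
    then have "AE \<omega> in M. (\<Sum>n. F n \<omega>) \<noteq> \<infinity>"
      using F_meas by (intro nn_integral_noteq_infinite) auto
    with cont AE_space show ?thesis
    proof eventually_elim
      fix \<omega> assume c: "continuous_on {0..1} (\<lambda>t. e t \<omega>)" and fin: "(\<Sum>n. F n \<omega>) \<noteq> \<infinity>" and sp: "\<omega> \<in> space M"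
      have "F n \<omega> = emeasure lborel (small_increments (\<lambda>t. e t \<omega>) m n)" for n
      proof -
        have P_iff: "P n x \<omega> \<longleftrightarrow> x \<in> small_increments (\<lambda>t. e t \<omega>) m n" for x
        proof (cases "?p \<le> x \<and> x + ?h n \<le> 1 - ?p")
          case True
          have "0 < ?p" "0 < ?h n" by simp_all
          then have "x \<in> {0..1}" "x + ?h n \<in> {0..1}" using True unfolding atLeastAtMost_iff by linarith+
          then have "?E x \<omega> = e x \<omega>" "?E (x + ?h n) \<omega> = e (x + ?h n) \<omega>"
            by (auto intro!: dyadic_limit_eq[where e=e and \<omega>=\<omega>, OF c])
          then show ?thesis by (simp add: P_def small_increments_def)
        next
          case False
          then show ?thesis unfolding P_def small_increments_def by blast
        qed
        have [measurable]: "small_increments (\<lambda>t. e t \<omega>) m n \<in> sets borel"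
          using closed_small_increments[OF c] by auto
        have "F n \<omega> = (\<integral>\<^sup>+x. indicator (small_increments (\<lambda>t. e t \<omega>) m n) x \<partial>lborel)"
          unfolding F_def using sp by (intro nn_integral_cong) (simp add: indicator_def space_pair_measure P_iff)
        then show ?thesis by simp
      qed
      then show "(\<lambda>n. emeasure lborel (small_increments (\<lambda>t. e t \<omega>) m n)) \<longlonglongrightarrow> 0"
        using ennreal_suminf_finite_tendsto_0[OF fin] by simp
    qed
  qed
  then show ?thesis unfolding rough_def AE_all_countable by blast
qed

section \<open>The joint law of the path and the signs\<close>

abbreviation sign_space :: "(nat \<Rightarrow> int) measure" where
  "sign_space \<equiv> (\<Pi>\<^sub>M n\<in>UNIV. count_space UNIV)"

abbreviation iid_signs :: "real \<Rightarrow> (nat \<Rightarrow> int) measure" where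
  "iid_signs p \<equiv> (\<Pi>\<^sub>M n\<in>UNIV. measure_pmf (sign_pmf p))"

lemma sets_iid_signs [measurable_cong]: "sets (iid_signs p) = sets sign_space"
  by (intro sets_PiM_cong) auto

lemma prob_space_iid_signs: "prob_space (iid_signs p)"
  by (intro prob_space_PiM measure_pmf.prob_space_axioms)

text \<open>Outside \<open>[0, 1]\<close> the elements of the path space are undefined, hence constant there.\<close>

lemma measurable_eval_path: "(\<lambda>f. f r) \<in> borel_measurable path_space"
proof (cases "r \<in> {0..1::real}")
  case False
  then have u: "f r = undefined" if "f \<in> space path_space" for f :: "real \<Rightarrow> real"
    using that by (auto simp: space_PiM PiE_def extensional_def)
  have "(\<lambda>f. f r) \<in> borel_measurable path_space \<longleftrightarrow> (\<lambda>f. undefined :: real) \<in> borel_measurable path_space"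
    by (intro measurable_cong u)
  then show ?thesis by simp
qed simp

lemma measurable_inside_min:
  assumes F: "F \<in> N \<rightarrow>\<^sub>M path_space" and [measurable]: "X \<in> borel_measurable N" "Y \<in> borel_measurable N"
  shows "Measurable.pred N (\<lambda>z. inside_min (F z) (X z) (Y z) a b)"
proof -
  define G where "G r z = F z (of_rat r)" for r :: rat and z
  have [measurable]: "G r \<in> borel_measurable N" for r
    unfolding G_def by (rule measurable_compose[OF F measurable_eval_path[of "of_rat r"]])
  show ?thesis unfolding inside_min_def Un_iff atLeastAtMost_iff G_def[symmetric] by measurable
qed

lemma measurable_argmin_loc: "(\<lambda>f. argmin_loc f a b) \<in> borel_measurable path_space"
proof -
  have [measurable]: "Measurable.pred path_space (\<lambda>f. inside_min f a b c d)" for c d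
    by (rule measurable_inside_min) auto
  show ?thesis unfolding argmin_loc_def
    by (intro borel_measurable_cINF bdd_below_argmin_loc) measurable
qed

lemma measurable_min_at [measurable]: "(\<lambda>f. min_at f j) \<in> borel_measurable path_space"
  unfolding min_at_def by (rule measurable_argmin_loc)

lemma measurable_has_min [measurable]: "Measurable.pred path_space (\<lambda>f. has_min f j)"
proof -
  have [measurable]: "(\<lambda>f. argmin_loc f (lo j) (hi j)) \<in> borel_measurable path_space" by (rule measurable_argmin_loc)
  show ?thesis unfolding has_min_def by measurable
qed

lemma distr_iid_uminus:
  assumes "0 \<le> p" "p \<le> 1"
  shows "distr (iid_signs (1 - p)) sign_space (\<lambda>\<xi> n. - \<xi> n) = iid_signs p"
proof (rule measure_eqI_PiM_infinite[symmetric])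
  interpret prob_space "iid_signs p" by (rule prob_space_iid_signs)
  show "finite_measure (iid_signs p)" by unfold_locales
  have pmf: "map_pmf uminus (sign_pmf (1 - p)) = sign_pmf p"
  proof -
    have "bernoulli_pmf p = map_pmf Not (bernoulli_pmf (1 - p))"
    proof (rule pmf_eqI)
      fix b
      have "pmf (map_pmf Not (bernoulli_pmf (1 - p))) (\<not> (\<not> b)) = pmf (bernoulli_pmf (1 - p)) (\<not> b)"
        by (rule pmf_map_inj') (auto intro: injI)
      then show "pmf (bernoulli_pmf p) b = pmf (map_pmf Not (bernoulli_pmf (1 - p))) b"
        using assms by (cases b) auto
    qed
    then show ?thesis unfolding sign_pmf_def by (simp add: map_pmf_comp) (rule map_pmf_cong, auto)
  qed
  have [measurable]: "(\<lambda>\<xi> n. - \<xi> n) \<in> iid_signs (1 - p) \<rightarrow>\<^sub>M sign_space"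
    by (rule measurable_PiM_single') (auto simp: space_PiM)
  fix A :: "nat \<Rightarrow> int set" and J :: "nat set" assume J: "finite J"
  have "emeasure (distr (iid_signs (1 - p)) sign_space (\<lambda>\<xi> n. - \<xi> n)) (prod_emb UNIV (\<lambda>_. measure_pmf (sign_pmf p)) J (Pi\<^sub>E J A))
     = emeasure (iid_signs (1 - p)) (prod_emb UNIV (\<lambda>_. measure_pmf (sign_pmf (1 - p))) J (\<Pi>\<^sub>E j\<in>J. uminus -` A j))"
  proof (subst emeasure_distr)
    show "prod_emb UNIV (\<lambda>_. measure_pmf (sign_pmf p)) J (Pi\<^sub>E J A) \<in> sets sign_space"
      using J by (subst sets_iid_signs[symmetric, of p]) (intro sets_PiM_I, auto)
    show "emeasure (iid_signs (1 - p)) ((\<lambda>\<xi> n. - \<xi> n) -` prod_emb UNIV (\<lambda>_. measure_pmf (sign_pmf p)) J (Pi\<^sub>E J A) \<inter> space (iid_signs (1 - p)))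
       = emeasure (iid_signs (1 - p)) (prod_emb UNIV (\<lambda>_. measure_pmf (sign_pmf (1 - p))) J (\<Pi>\<^sub>E j\<in>J. uminus -` A j))"
      by (intro arg_cong[where f="emeasure (iid_signs (1 - p))"]) (auto simp: prod_emb_def space_PiM PiE_iff)
  qed simp
  also have "\<dots> = (\<Prod>j\<in>J. emeasure (measure_pmf (sign_pmf (1 - p))) (uminus -` A j))"
    using J by (intro emeasure_PiM_emb measure_pmf.prob_space_axioms) auto
  also have "\<dots> = (\<Prod>j\<in>J. emeasure (measure_pmf (sign_pmf p)) (A j))"
    by (subst pmf[symmetric]) (simp add: map_pmf_rep_eq emeasure_distr)
  also have "\<dots> = emeasure (iid_signs p) (prod_emb UNIV (\<lambda>_. measure_pmf (sign_pmf p)) J (Pi\<^sub>E J A))"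
    using J by (intro emeasure_PiM_emb[symmetric] measure_pmf.prob_space_axioms) auto
  finally show "emeasure (iid_signs p) (prod_emb UNIV (\<lambda>_. measure_pmf (sign_pmf p)) J (Pi\<^sub>E J A)) =
    emeasure (distr (iid_signs (1 - p)) sign_space (\<lambda>\<xi> n. - \<xi> n)) (prod_emb UNIV (\<lambda>_. measure_pmf (sign_pmf p)) J (Pi\<^sub>E J A))" ..
qed (auto simp: sets_iid_signs)

text \<open>Reading i.i.d. signs through an index map gives a law that depends only on which arguments the map
identifies. The values of the two maps correspond by an injection \<open>t\<close>, and relabelling
coordinates preserves a product measure.\<close>

lemma distr_iid_signs_reindex:
  fixes k k' :: "nat \<Rightarrow> nat" and D :: "nat set"
  assumes kk: "\<And>i j. i \<in> D \<Longrightarrow> j \<in> D \<Longrightarrow> k i = k j \<longleftrightarrow> k' i = k' j"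
  shows "distr (iid_signs p) sign_space (\<lambda>\<xi> j. if j \<in> D then \<xi> (k j) else 0) =
    distr (iid_signs p) sign_space (\<lambda>\<xi> j. if j \<in> D then \<xi> (k' j) else 0)"
proof -
  let ?q = "measure_pmf (sign_pmf p)"
  let ?K = "PiM (k' ` D) (\<lambda>_. ?q)"
  define t where "t m = k (SOME j. j \<in> D \<and> k' j = m)" for m
  have t: "t (k' j) = k j" if "j \<in> D" for j
  proof -
    have "(SOME i. i \<in> D \<and> k' i = k' j) \<in> D \<and> k' (SOME i. i \<in> D \<and> k' i = k' j) = k' j"
      by (rule someI[of _ j]) (use that in auto)
    then show ?thesis using kk that unfolding t_def by blast
  qed
  have inj: "inj_on t (k' ` D)" using kk t by (auto intro!: inj_onI)
  define spread where "spread y = (\<lambda>j. if j \<in> D then y (k' j) else (0::int))" for y :: "nat \<Rightarrow> int"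
  have [measurable]: "spread \<in> ?K \<rightarrow>\<^sub>M sign_space"
  proof (rule measurable_PiM_single')
    fix j
    show "(\<lambda>y. spread y j) \<in> ?K \<rightarrow>\<^sub>M count_space UNIV"
    proof (cases "j \<in> D")
      case True
      then have "(\<lambda>y. y (k' j)) \<in> ?K \<rightarrow>\<^sub>M ?q" by (intro measurable_component_singleton) auto
      then show ?thesis using True by (simp add: spread_def cong: measurable_cong_sets)
    qed (simp add: spread_def)
  qed (auto simp: space_PiM)
  have re: "distr (iid_signs p) sign_space (\<lambda>\<xi> j. if j \<in> D then \<xi> (u (k' j)) else 0) = distr ?K sign_space spread"
    if u: "inj_on u (k' ` D)" for u :: "nat \<Rightarrow> nat"
  proof -
    have [measurable]: "(\<lambda>\<xi>. \<lambda>n\<in>k' ` D. \<xi> (u n)) \<in> iid_signs p \<rightarrow>\<^sub>M ?K"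
      by (intro measurable_restrict measurable_component_singleton) auto
    have "distr ?K sign_space spread = distr (distr (iid_signs p) ?K (\<lambda>\<xi>. \<lambda>n\<in>k' ` D. \<xi> (u n))) sign_space spread"
      using u by (subst distr_PiM_reindex) (auto intro: measure_pmf.prob_space_axioms)
    also have "\<dots> = distr (iid_signs p) sign_space (spread \<circ> (\<lambda>\<xi>. \<lambda>n\<in>k' ` D. \<xi> (u n)))"
      by (rule distr_distr) measurable
    also have "spread \<circ> (\<lambda>\<xi>. \<lambda>n\<in>k' ` D. \<xi> (u n)) = (\<lambda>\<xi> j. if j \<in> D then \<xi> (u (k' j)) else 0)"
      by (auto simp: spread_def fun_eq_iff)
    finally show ?thesis ..
  qed
  have "(\<lambda>\<xi> j. if j \<in> D then \<xi> (k j) else (0::int)) = (\<lambda>\<xi> j. if j \<in> D then \<xi> (t (k' j)) else 0)"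
    by (auto simp: fun_eq_iff t)
  then show ?thesis using re[OF inj] re[of "\<lambda>n. n"] by simp
qed

text \<open>Signs of the rational intervals: interval \<open>j\<close> takes the sign that \<open>\<xi>\<close> has at the index
\<open>k f j\<close>. Intervals outside \<open>(0, 1)\<close> or without an interior minimum get the value \<open>0\<close>: a minimum at
an endpoint need not be a local minimum of the path, so it may carry no sign.\<close>

definition signs_via :: "((real \<Rightarrow> real) \<Rightarrow> nat \<Rightarrow> nat) \<Rightarrow> (real \<Rightarrow> real) \<Rightarrow> (nat \<Rightarrow> int) \<Rightarrow> nat \<Rightarrow> int" where
  "signs_via k f \<xi> = (\<lambda>j. if j \<in> {j. has_min f j} then \<xi> (k f j) else 0)"

text \<open>A labelling of the interior minima by the path alone: the first rational interval with the same
minimum.\<close>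

definition first_interval :: "(real \<Rightarrow> real) \<Rightarrow> nat \<Rightarrow> nat" where
  "first_interval f j = (LEAST i. has_min f i \<and> min_at f i = min_at f j)"

lemma first_interval_eq_iff:
  assumes "has_min f i" "has_min f j"
  shows "first_interval f i = first_interval f j \<longleftrightarrow> min_at f i = min_at f j"
proof
  have *: "min_at f (first_interval f j) = min_at f j" if "has_min f j" for j
    unfolding first_interval_def using LeastI[of "\<lambda>i. has_min f i \<and> min_at f i = min_at f j" j] that by auto
  assume "first_interval f i = first_interval f j"
  with *[OF assms(1)] *[OF assms(2)] show "min_at f i = min_at f j" by simp
qed (simp add: first_interval_def)

lemma measurable_first_interval: "(\<lambda>f. first_interval f j) \<in> path_space \<rightarrow>\<^sub>M count_space UNIV"
proof -
  have [measurable]: "Measurable.pred path_space (\<lambda>f. min_at f i = min_at f j)" for i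
    unfolding pred_def by (rule borel_measurable_eq[OF measurable_min_at measurable_min_at])
  show ?thesis unfolding first_interval_def by measurable
qed

lemma measurable_signs_via:
  assumes k: "\<And>j. (\<lambda>f. k f j) \<in> path_space \<rightarrow>\<^sub>M count_space UNIV"
  shows "(\<lambda>z. signs_via k (fst z) (snd z)) \<in> path_space \<Otimes>\<^sub>M sign_space \<rightarrow>\<^sub>M sign_space"
proof (rule measurable_PiM_single')
  fix j
  have "(\<lambda>z. snd z (k (fst z) j)) \<in> path_space \<Otimes>\<^sub>M sign_space \<rightarrow>\<^sub>M count_space UNIV"
  proof (rule measurable_compose_countable[where f="\<lambda>n z. snd z n"])
    show "(\<lambda>z. k (fst z) j) \<in> path_space \<Otimes>\<^sub>M sign_space \<rightarrow>\<^sub>M count_space UNIV"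
      by (rule measurable_compose[OF measurable_fst k])
    show "(\<lambda>z. snd z n) \<in> path_space \<Otimes>\<^sub>M sign_space \<rightarrow>\<^sub>M count_space UNIV" for n by measurable
  qed
  moreover have "Measurable.pred (path_space \<Otimes>\<^sub>M sign_space) (\<lambda>z. has_min (fst z) j)"
    by (rule measurable_compose[OF measurable_fst measurable_has_min])
  ultimately show "(\<lambda>z. signs_via k (fst z) (snd z) j) \<in> path_space \<Otimes>\<^sub>M sign_space \<rightarrow>\<^sub>M count_space UNIV"
    unfolding signs_via_def mem_Collect_eq by (intro measurable_If measurable_const) (simp_all add: pred_def)
qed (auto simp: space_PiM)

text \<open>Fubini reduces the claim to a fixed path, where \<open>distr_iid_signs_reindex\<close> applies.\<close>

lemma distr_signs_via_cong:
  assumes P: "prob_space P" "sets P = sets path_space"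
    and k: "\<And>j. (\<lambda>f. k f j) \<in> path_space \<rightarrow>\<^sub>M count_space UNIV" and k': "\<And>j. (\<lambda>f. k' f j) \<in> path_space \<rightarrow>\<^sub>M count_space UNIV"
    and AE: "AE f in P. \<forall>i j. has_min f i \<and> has_min f j \<longrightarrow> (k f i = k f j \<longleftrightarrow> k' f i = k' f j)"
  shows "distr (P \<Otimes>\<^sub>M iid_signs p) (path_space \<Otimes>\<^sub>M sign_space) (\<lambda>(f, \<xi>). (f, signs_via k f \<xi>)) =
    distr (P \<Otimes>\<^sub>M iid_signs p) (path_space \<Otimes>\<^sub>M sign_space) (\<lambda>(f, \<xi>). (f, signs_via k' f \<xi>))"
proof (rule measure_eqI)
  interpret P: prob_space P by fact
  interpret S: prob_space "iid_signs p" by (rule prob_space_iid_signs)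
  note [measurable_cong] = P(2)
  let ?T = "path_space \<Otimes>\<^sub>M sign_space"
  fix B assume "B \<in> sets (distr (P \<Otimes>\<^sub>M iid_signs p) ?T (\<lambda>(f, \<xi>). (f, signs_via k f \<xi>)))"
  then have B [measurable]: "B \<in> sets ?T" by simp
  have sp: "space P = space path_space" using P(2) by (rule sets_eq_imp_space_eq)
  have eq: "emeasure (distr (P \<Otimes>\<^sub>M iid_signs p) ?T (\<lambda>(f, \<xi>). (f, signs_via k f \<xi>))) B =
      (\<integral>\<^sup>+f. emeasure (distr (iid_signs p) sign_space (signs_via k f)) (Pair f -` B) \<partial>P)"
    if k: "\<And>j. (\<lambda>f. k f j) \<in> path_space \<rightarrow>\<^sub>M count_space UNIV" for k
  proof -
    have [measurable]: "(\<lambda>(f, \<xi>). (f, signs_via k f \<xi>)) \<in> P \<Otimes>\<^sub>M iid_signs p \<rightarrow>\<^sub>M ?T"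
      using measurable_signs_via[OF k] by (simp add: split_beta' cong: measurable_cong_sets)
    have via: "signs_via k f \<in> iid_signs p \<rightarrow>\<^sub>M sign_space" if "f \<in> space path_space" for f
    proof -
      have "(\<lambda>\<xi>. (f, \<xi>)) \<in> sign_space \<rightarrow>\<^sub>M path_space \<Otimes>\<^sub>M sign_space" using that by measurable
      from measurable_compose[OF this measurable_signs_via[OF k]] show ?thesis
        by (simp cong: measurable_cong_sets)
    qed
    have "emeasure (distr (P \<Otimes>\<^sub>M iid_signs p) ?T (\<lambda>(f, \<xi>). (f, signs_via k f \<xi>))) B =
      emeasure (P \<Otimes>\<^sub>M iid_signs p) ((\<lambda>(f, \<xi>). (f, signs_via k f \<xi>)) -` B \<inter> space (P \<Otimes>\<^sub>M iid_signs p))"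
      by (rule emeasure_distr) measurable
    also have "\<dots> = (\<integral>\<^sup>+f. emeasure (iid_signs p) (Pair f -` ((\<lambda>(f, \<xi>). (f, signs_via k f \<xi>)) -` B \<inter> space (P \<Otimes>\<^sub>M iid_signs p))) \<partial>P)"
      by (rule S.emeasure_pair_measure_alt) measurable
    also have "\<dots> = (\<integral>\<^sup>+f. emeasure (distr (iid_signs p) sign_space (signs_via k f)) (Pair f -` B) \<partial>P)"
    proof (rule nn_integral_cong)
      fix f assume f: "f \<in> space P"
      have "Pair f -` B \<in> sets sign_space" using sets_Pair1[OF B] .
      then show "emeasure (iid_signs p) (Pair f -` ((\<lambda>(f, \<xi>). (f, signs_via k f \<xi>)) -` B \<inter> space (P \<Otimes>\<^sub>M iid_signs p))) =
        emeasure (distr (iid_signs p) sign_space (signs_via k f)) (Pair f -` B)"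
        using f via[of f] sp by (subst emeasure_distr) (auto simp: space_pair_measure intro!: arg_cong[where f="emeasure (iid_signs p)"])
    qed
    finally show ?thesis .
  qed
  show "emeasure (distr (P \<Otimes>\<^sub>M iid_signs p) ?T (\<lambda>(f, \<xi>). (f, signs_via k f \<xi>))) B =
    emeasure (distr (P \<Otimes>\<^sub>M iid_signs p) ?T (\<lambda>(f, \<xi>). (f, signs_via k' f \<xi>))) B"
    unfolding eq[OF k] eq[OF k']
  proof (rule nn_integral_cong_AE)
    show "AE f in P. emeasure (distr (iid_signs p) sign_space (signs_via k f)) (Pair f -` B) =
       emeasure (distr (iid_signs p) sign_space (signs_via k' f)) (Pair f -` B)"
      using AE
    proof eventually_elim
      fix f assume "\<forall>i j. has_min f i \<and> has_min f j \<longrightarrow> (k f i = k f j \<longleftrightarrow> k' f i = k' f j)"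
      then have "distr (iid_signs p) sign_space (signs_via k f) = distr (iid_signs p) sign_space (signs_via k' f)"
        unfolding signs_via_def by (intro distr_iid_signs_reindex) auto
      then show "emeasure (distr (iid_signs p) sign_space (signs_via k f)) (Pair f -` B) =
       emeasure (distr (iid_signs p) sign_space (signs_via k' f)) (Pair f -` B)" by simp
    qed
  qed
qed simp

lemma measurable_sample_path:
  "brownian_excursion M e \<Longrightarrow> sample_path e \<in> M \<rightarrow>\<^sub>M path_space"
  unfolding brownian_excursion_def by (intro measurable_restrict) auto

lemma AE_excursion:
  assumes "brownian_excursion M e"
  shows "AE \<omega> in M. continuous_on {0..1} (\<lambda>t. e t \<omega>) \<and> e 0 \<omega> = 0 \<and> e 1 \<omega> = 0"
  using assms unfolding brownian_excursion_def by blast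

lemma strict_mono_enumeration:
  fixes J :: "real set"
  assumes "finite J" "J \<noteq> {}"
  obtains n t where "strict_mono_on {..n::nat} t" "t ` {..n} = J"
proof -
  define xs where "xs = sorted_list_of_set J"
  have xs: "sorted_wrt (<) xs" "set xs = J" "xs \<noteq> []"
    using assms by (auto simp: xs_def)
  define n where "n = length xs - 1"
  have "length xs = Suc n" using xs(3) by (cases xs) (auto simp: n_def)
  then have n: "{..n} = {..<length xs}" by (simp add: lessThan_Suc_atMost)
  have "strict_mono_on {..n} ((!) xs)"
    unfolding n using sorted_wrt_nth_less[OF xs(1)] by (auto intro: strict_mono_onI)
  moreover have "(!) xs ` {..n} = J" unfolding n using xs(2) by (auto simp: set_conv_nth)
  ultimately show thesis by (rule that)
qed

text \<open>The densities cover the times in the open interval, and at the times 0 and 1 the path is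
almost surely zero; finite dimensional distributions generate the law on the product space.\<close>

lemma distr_sample_path_eq:
  assumes exc: "brownian_excursion M e" and exc': "brownian_excursion M' e'"
  shows "distr M path_space (sample_path e) = distr M' path_space (sample_path e')"
proof -
  define inner where "inner J = J \<inter> {0<..<1}" for J :: "real set"
  have ev: "emeasure (distr N path_space (sample_path d)) (prod_emb {0..1} (\<lambda>_. borel) J (Pi\<^sub>E J A)) =
      (if \<exists>i\<in>J - inner J. 0 \<notin> A i then 0 else emeasure N {\<omega>\<in>space N. \<forall>i\<in>inner J. d i \<omega> \<in> A i})"
    if d: "brownian_excursion N d" and J: "finite J" "J \<subseteq> {0..1}" and A: "\<And>i. i \<in> J \<Longrightarrow> A i \<in> sets borel"
    for N :: "'c measure" and d J and A :: "real \<Rightarrow> real set"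
  proof -
    have [measurable]: "d i \<in> borel_measurable N" if "i \<in> J" for i using d J that unfolding brownian_excursion_def by auto
    have "emeasure (distr N path_space (sample_path d)) (prod_emb {0..1} (\<lambda>_. borel) J (Pi\<^sub>E J A)) =
      emeasure N (sample_path d -` prod_emb {0..1} (\<lambda>_. borel) J (Pi\<^sub>E J A) \<inter> space N)"
      using J A by (intro emeasure_distr measurable_sample_path[OF d] sets_PiM_I) auto
    also have "sample_path d -` prod_emb {0..1} (\<lambda>_. borel) J (Pi\<^sub>E J A) \<inter> space N = {\<omega>\<in>space N. \<forall>i\<in>J. d i \<omega> \<in> A i}"
    proof (rule set_eqI)
      fix \<omega>
      have "restrict (sample_path d \<omega>) J = (\<lambda>i\<in>J. d i \<omega>)" using J by (auto simp: restrict_def fun_eq_iff)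
      then show "\<omega> \<in> sample_path d -` prod_emb {0..1} (\<lambda>_. borel) J (Pi\<^sub>E J A) \<inter> space N \<longleftrightarrow> \<omega> \<in> {\<omega>\<in>space N. \<forall>i\<in>J. d i \<omega> \<in> A i}"
        by (simp only: prod_emb_iff vimage_eq Int_iff mem_Collect_eq restrict_PiE_iff restrict_extensional space_borel UNIV_I ball_triv simp_thms) blast
    qed
    also have "emeasure N {\<omega>\<in>space N. \<forall>i\<in>J. d i \<omega> \<in> A i} = emeasure N (if \<exists>i\<in>J - inner J. 0 \<notin> A i then {} else {\<omega>\<in>space N. \<forall>i\<in>inner J. d i \<omega> \<in> A i})"
    proof (rule emeasure_eq_AE)
      show "AE \<omega> in N. (\<omega> \<in> {\<omega>\<in>space N. \<forall>i\<in>J. d i \<omega> \<in> A i}) = (\<omega> \<in> (if \<exists>i\<in>J - inner J. 0 \<notin> A i then {} else {\<omega>\<in>space N. \<forall>i\<in>inner J. d i \<omega> \<in> A i}))"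
        using AE_excursion[OF d]
      proof eventually_elim
        fix \<omega> assume *: "continuous_on {0..1} (\<lambda>t. d t \<omega>) \<and> d 0 \<omega> = 0 \<and> d 1 \<omega> = 0"
        have "i = 0 \<or> i = 1" if "i \<in> J - inner J" for i using that J by (auto simp: inner_def)
        then have z: "d i \<omega> = 0" if "i \<in> J - inner J" for i using * that by blast
        have "(\<forall>i\<in>J. d i \<omega> \<in> A i) \<longleftrightarrow> (\<forall>i\<in>inner J. d i \<omega> \<in> A i) \<and> (\<forall>i\<in>J - inner J. d i \<omega> \<in> A i)"
          unfolding inner_def by blast
        also have "(\<forall>i\<in>J - inner J. d i \<omega> \<in> A i) \<longleftrightarrow> (\<forall>i\<in>J - inner J. 0 \<in> A i)"
          by (intro ball_cong refl) (simp only: z)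
        finally show "(\<omega> \<in> {\<omega>\<in>space N. \<forall>i\<in>J. d i \<omega> \<in> A i}) = (\<omega> \<in> (if \<exists>i\<in>J - inner J. 0 \<notin> A i then {} else {\<omega>\<in>space N. \<forall>i\<in>inner J. d i \<omega> \<in> A i}))"
          by auto
      qed
      show "{\<omega>\<in>space N. \<forall>i\<in>J. d i \<omega> \<in> A i} \<in> sets N" using J A by measurable
      have "finite (inner J)" "inner J \<subseteq> J" using J by (auto simp: inner_def)
      then show "(if \<exists>i\<in>J - inner J. 0 \<notin> A i then {} else {\<omega>\<in>space N. \<forall>i\<in>inner J. d i \<omega> \<in> A i}) \<in> sets N"
        using A by (auto intro!: sets.sets_Collect_finite_All' measurable_sets_Collect[where P="\<lambda>x. x \<in> A _"] simp: subset_iff)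
    qed
    also have "\<dots> = (if \<exists>i\<in>J - inner J. 0 \<notin> A i then 0 else emeasure N {\<omega>\<in>space N. \<forall>i\<in>inner J. d i \<omega> \<in> A i})"
      by simp
    finally show ?thesis .
  qed
  have fdd: "emeasure N {\<omega>\<in>space N. \<forall>i\<in>t ` {..n}. d i \<omega> \<in> A i} = (\<integral>\<^sup>+x. ennreal (excursion_density n t x) * indicator (\<Pi>\<^sub>E i\<in>{..n}. A (t i)) x \<partial>PiM {..n} (\<lambda>_. lborel))"
    if d: "brownian_excursion N d" and t: "strict_mono_on {..n} t" "t ` {..n} \<subseteq> {0<..<1}" and A: "\<And>i. i \<in> t ` {..n} \<Longrightarrow> A i \<in> sets borel"
    for N :: "'c measure" and d n t and A :: "real \<Rightarrow> real set"
  proof -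
    have "distributed N (PiM {..n} (\<lambda>_. lborel)) (\<lambda>\<omega>. \<lambda>i\<in>{..n}. d (t i) \<omega>) (\<lambda>x. ennreal (excursion_density n t x))"
      using d t unfolding brownian_excursion_def by blast
    from distributed_emeasure[OF this, of "\<Pi>\<^sub>E i\<in>{..n}. A (t i)"] A
    have "emeasure N ((\<lambda>\<omega>. \<lambda>i\<in>{..n}. d (t i) \<omega>) -` (\<Pi>\<^sub>E i\<in>{..n}. A (t i)) \<inter> space N) =
      (\<integral>\<^sup>+x. ennreal (excursion_density n t x) * indicator (\<Pi>\<^sub>E i\<in>{..n}. A (t i)) x \<partial>PiM {..n} (\<lambda>_. lborel))"
      by (auto intro: sets_PiM_I_finite)
    moreover have "(\<lambda>\<omega>. \<lambda>i\<in>{..n}. d (t i) \<omega>) -` (\<Pi>\<^sub>E i\<in>{..n}. A (t i)) \<inter> space N = {\<omega>\<in>space N. \<forall>i\<in>t ` {..n}. d i \<omega> \<in> A i}"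
      by (auto simp: PiE_iff)
    ultimately show ?thesis by simp
  qed
  show ?thesis
  proof (rule measure_eqI_PiM_infinite[where I="{0..1}" and M="\<lambda>_. borel"])
    interpret prob_space M using exc by (simp add: brownian_excursion_def)
    interpret M': prob_space M' using exc' by (simp add: brownian_excursion_def)
    show "finite_measure (distr M path_space (sample_path e))"
      using prob_space_distr[OF measurable_sample_path[OF exc]] by (simp add: prob_space_def)
    fix A :: "real \<Rightarrow> real set" and J assume J: "finite J" "J \<subseteq> {0..1::real}" and A: "\<And>i. i \<in> J \<Longrightarrow> A i \<in> sets borel"
    have "emeasure M {\<omega>\<in>space M. \<forall>i\<in>inner J. e i \<omega> \<in> A i} = emeasure M' {\<omega>\<in>space M'. \<forall>i\<in>inner J. e' i \<omega> \<in> A i}"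
    proof (cases "inner J = {}")
      case True
      then show ?thesis by (simp add: emeasure_space_1 M'.emeasure_space_1)
    next
      case False
      obtain n t where t: "strict_mono_on {..n::nat} t" "t ` {..n} = inner J"
        using strict_mono_enumeration[of "inner J"] J False by (auto simp: inner_def)
      then have t': "t ` {..n} \<subseteq> {0<..<1}" by (auto simp: inner_def)
      have A': "A i \<in> sets borel" if "i \<in> t ` {..n}" for i using that t A by (auto simp: inner_def)
      show ?thesis unfolding t(2)[symmetric] 
        by (rule trans[OF fdd[OF exc t(1) t'] fdd[OF exc' t(1) t', symmetric]]) (rule A', assumption)+
    qed
    then show "emeasure (distr M path_space (sample_path e)) (prod_emb {0..1} (\<lambda>_. borel) J (Pi\<^sub>E J A)) =
      emeasure (distr M' path_space (sample_path e')) (prod_emb {0..1} (\<lambda>_. borel) J (Pi\<^sub>E J A))"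
      by (simp add: ev[OF exc J A] ev[OF exc' J A])
  qed simp_all
qed

text \<open>The measurable constructions see the path as an element of the path space, where it is restricted to
\<open>[0, 1]\<close>; the pathwise arguments do not restrict it.\<close>

lemma inside_min_restrict:
  assumes "0 \<le> x" "y \<le> 1"
  shows "inside_min (restrict f {0..1}) x y a b \<longleftrightarrow> inside_min f x y a b"
proof (cases "x < a \<and> a < b \<and> b < y")
  case True
  have eq: "restrict f {0..1} r = f r" if "r \<in> {a..b} \<or> r \<in> {x..a} \<union> {b..y}" for r
  proof -
    have "r \<in> {0..1}" using that True assms by auto
    then show ?thesis by simp
  qed
  show ?thesis unfolding inside_min_def
    by (intro conj_cong refl ex_cong1 all_cong1 imp_cong) (simp_all only: eq simp_thms)
next
  case False
  then show ?thesis unfolding inside_min_def by metis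
qed

lemma has_min_restrict:
  "has_min (restrict f {0..1}) j \<longleftrightarrow> has_min f j"
  "has_min f j \<Longrightarrow> min_at (restrict f {0..1}) j = min_at f j"
proof -
  have *: "argmin_loc (restrict f {0..1}) (lo j) (hi j) = argmin_loc f (lo j) (hi j)" if "0 < lo j" "hi j < 1"
    unfolding argmin_loc_def using that by (simp add: inside_min_restrict)
  show "has_min (restrict f {0..1}) j \<longleftrightarrow> has_min f j"
    unfolding has_min_def using * by (cases "0 < lo j \<and> hi j < 1") auto
  show "has_min f j \<Longrightarrow> min_at (restrict f {0..1}) j = min_at f j"
    unfolding has_min_def min_at_def using * by simp
qed

text \<open>An enumeration \<open>L\<close> of the local minima labels the rational intervals by the index of their minimum. Two
intervals get the same label iff they have the same minimum, exactly as for \<open>first_interval\<close>.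
So \<open>L\<close> can be replaced by \<open>first_interval\<close> without changing the joint law, and the right-hand
side depends only on the law of the path and on \<open>p\<close>.\<close>

lemma joint_law_of_path_and_signs:
  assumes exc: "brownian_excursion M e" and iid: "iid_signs_on_local_minima M e p s"
  obtains \<tau> where "\<tau> \<in> M \<rightarrow>\<^sub>M sign_space"
    and "AE \<omega> in M. \<forall>j. has_min (\<lambda>t. e t \<omega>) j \<longrightarrow> \<tau> \<omega> j = s (min_at (\<lambda>t. e t \<omega>) j) \<omega> \<and> \<tau> \<omega> j \<in> {-1, 1}"
    and "distr M (path_space \<Otimes>\<^sub>M sign_space) (\<lambda>\<omega>. (sample_path e \<omega>, \<tau> \<omega>)) =
      distr (distr M path_space (sample_path e) \<Otimes>\<^sub>M iid_signs p) (path_space \<Otimes>\<^sub>M sign_space)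
        (\<lambda>(f, \<xi>). (f, signs_via first_interval f \<xi>))"
proof -
  interpret prob_space M using exc by (simp add: brownian_excursion_def)
  let ?T = "path_space \<Otimes>\<^sub>M sign_space"
  let ?P = "distr M path_space (sample_path e)"
  obtain L \<sigma> where L: "\<And>n. L n \<in> borel_measurable path_space"
    and bij: "AE \<omega> in M. bij_betw (\<lambda>n. L n (sample_path e \<omega>)) UNIV (local_minima (\<lambda>t. e t \<omega>))"
    and s: "AE \<omega> in M. \<forall>n. s (L n (sample_path e \<omega>)) \<omega> = \<sigma> n \<omega>"
    and \<sigma>: "\<And>n::nat. \<sigma> n \<in> M \<rightarrow>\<^sub>M count_space UNIV"
    and law: "distr M ?T (\<lambda>\<omega>. (sample_path e \<omega>, \<lambda>n. \<sigma> n \<omega>)) = ?P \<Otimes>\<^sub>M iid_signs p"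
    using iid unfolding iid_signs_on_local_minima_def by blast
  note sp [measurable] = measurable_sample_path[OF exc]
  have \<sigma>_meas [measurable]: "(\<lambda>\<omega> n. \<sigma> n \<omega>) \<in> M \<rightarrow>\<^sub>M sign_space"
    by (rule measurable_PiM_single') (auto simp: \<sigma>)
  have P: "prob_space ?P" by (rule prob_space_distr[OF sp])
  interpret P: prob_space ?P by (rule P)
  interpret S: prob_space "iid_signs p" by (rule prob_space_iid_signs)
  interpret PS: pair_prob_space ?P "iid_signs p" ..
  define k where "k f j = (LEAST n. L n f = min_at f j)" for f j
  have k_meas: "(\<lambda>f. k f j) \<in> path_space \<rightarrow>\<^sub>M count_space UNIV" for j
  proof -
    have [measurable]: "Measurable.pred path_space (\<lambda>f. L n f = min_at f j)" for n
      unfolding pred_def by (rule borel_measurable_eq[OF L measurable_min_at])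
    show ?thesis unfolding k_def by measurable
  qed
  define \<tau> where "\<tau> \<omega> = signs_via k (sample_path e \<omega>) (\<lambda>n. \<sigma> n \<omega>)" for \<omega>
  have via: "(\<lambda>(f, \<xi>). (f, signs_via k f \<xi>)) \<in> ?T \<rightarrow>\<^sub>M ?T"
    using measurable_signs_via[OF k_meas] by (simp add: split_beta')
  have \<tau>_meas: "\<tau> \<in> M \<rightarrow>\<^sub>M sign_space"
  proof -
    have "(\<lambda>\<omega>. (sample_path e \<omega>, \<lambda>n. \<sigma> n \<omega>)) \<in> M \<rightarrow>\<^sub>M ?T" by measurable
    from measurable_compose[OF this measurable_signs_via[OF k_meas]] show ?thesis unfolding \<tau>_def by simp
  qed
  have ex: "AE \<omega> in M. \<forall>j. has_min (sample_path e \<omega>) j \<longrightarrow> (\<exists>n. L n (sample_path e \<omega>) = min_at (sample_path e \<omega>) j)"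
    using AE_excursion[OF exc] AE_distinct_minima[OF exc] bij
  proof eventually_elim
    fix \<omega> assume c: "continuous_on {0..1} (\<lambda>t. e t \<omega>) \<and> e 0 \<omega> = 0 \<and> e 1 \<omega> = 0"
      and dm: "distinct_minima (\<lambda>t. e t \<omega>)" and b: "bij_betw (\<lambda>n. L n (sample_path e \<omega>)) UNIV (local_minima (\<lambda>t. e t \<omega>))"
    show "\<forall>j. has_min (sample_path e \<omega>) j \<longrightarrow> (\<exists>n. L n (sample_path e \<omega>) = min_at (sample_path e \<omega>) j)"
    proof (intro allI impI)
      fix j assume "has_min (sample_path e \<omega>) j"
      then have j: "has_min (\<lambda>t. e t \<omega>) j" by (simp add: has_min_restrict(1))
      have "sole_interior_min (\<lambda>t. e t \<omega>) (lo j) (hi j) (min_at (\<lambda>t. e t \<omega>) j)"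
        using sole_interior_min_min_at[of "\<lambda>t. e t \<omega>", OF _ dm j] c by blast
      then have "min_at (\<lambda>t. e t \<omega>) j \<in> local_minima (\<lambda>t. e t \<omega>)"
        using j by (intro sole_interior_min_local(2)) (auto simp: has_min_def)
      also have "local_minima (\<lambda>t. e t \<omega>) = range (\<lambda>n. L n (sample_path e \<omega>))"
        using b by (simp add: bij_betw_def)
      finally show "\<exists>n. L n (sample_path e \<omega>) = min_at (sample_path e \<omega>) j"
        using j by (auto simp: has_min_restrict(2))
    qed
  qed
  have \<sigma>_sign: "AE \<omega> in M. \<forall>n. \<sigma> n \<omega> \<in> {-1, 1}"
    unfolding AE_all_countable
  proof
    fix n
    have "AE i in measure_pmf (sign_pmf p). i \<in> {-1, 1}"
      by (auto simp: AE_measure_pmf_iff sign_pmf_def)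
    then have "AE \<xi> in iid_signs p. \<xi> n \<in> {-1, 1}"
      by (intro AE_PiM_component measure_pmf.prob_space_axioms) auto
    have "(\<lambda>\<xi>. \<xi> n) \<in> iid_signs p \<rightarrow>\<^sub>M count_space UNIV"
      using measurable_component_singleton[of n UNIV "\<lambda>_. measure_pmf (sign_pmf p)"] by (simp cong: measurable_cong_sets)
    from measurable_compose[OF measurable_snd this]
    have "Measurable.pred (?P \<Otimes>\<^sub>M iid_signs p) (\<lambda>z. snd z n \<in> {-1, 1})"
      by (rule measurable_compose) simp
    then have "AE z in ?P \<Otimes>\<^sub>M iid_signs p. snd z n \<in> {-1, 1}"
      unfolding pred_def
    proof (rule PS.AE_pair_measure)
      show "AE f in ?P. AE \<xi> in iid_signs p. snd (f, \<xi>) n \<in> {-1, 1}"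
        unfolding snd_conv by (rule AE_I2) (rule \<open>AE \<xi> in iid_signs p. \<xi> n \<in> {-1, 1}\<close>)
    qed
    then have "AE z in distr M ?T (\<lambda>\<omega>. (sample_path e \<omega>, \<lambda>n. \<sigma> n \<omega>)). snd z n \<in> {-1, 1}"
      by (simp only: law)
    from AE_distrD[OF _ this] show "AE \<omega> in M. \<sigma> n \<omega> \<in> {-1, 1}" by simp
  qed
  show thesis
  proof (rule that[OF \<tau>_meas])
    show "AE \<omega> in M. \<forall>j. has_min (\<lambda>t. e t \<omega>) j \<longrightarrow> \<tau> \<omega> j = s (min_at (\<lambda>t. e t \<omega>) j) \<omega> \<and> \<tau> \<omega> j \<in> {-1, 1}"
      using ex s \<sigma>_sign
    proof eventually_elim
      fix \<omega> assume ex: "\<forall>j. has_min (sample_path e \<omega>) j \<longrightarrow> (\<exists>n. L n (sample_path e \<omega>) = min_at (sample_path e \<omega>) j)"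
        and s: "\<forall>n. s (L n (sample_path e \<omega>)) \<omega> = \<sigma> n \<omega>" and sg: "\<forall>n. \<sigma> n \<omega> \<in> {-1, 1}"
      show "\<forall>j. has_min (\<lambda>t. e t \<omega>) j \<longrightarrow> \<tau> \<omega> j = s (min_at (\<lambda>t. e t \<omega>) j) \<omega> \<and> \<tau> \<omega> j \<in> {-1, 1}"
      proof (intro allI impI)
        fix j assume j: "has_min (\<lambda>t. e t \<omega>) j"
        then have j': "has_min (sample_path e \<omega>) j" by (simp add: has_min_restrict(1))
        have "L (k (sample_path e \<omega>) j) (sample_path e \<omega>) = min_at (sample_path e \<omega>) j"
          unfolding k_def by (rule LeastI_ex[OF ex[rule_format, OF j']])
        then have L: "L (k (sample_path e \<omega>) j) (sample_path e \<omega>) = min_at (\<lambda>t. e t \<omega>) j"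
          using has_min_restrict(2)[OF j] by simp
        have "\<tau> \<omega> j = \<sigma> (k (sample_path e \<omega>) j) \<omega>"
          using j' by (simp add: \<tau>_def signs_via_def)
        also have "\<dots> = s (min_at (\<lambda>t. e t \<omega>) j) \<omega>" using s L by metis
        finally show "\<tau> \<omega> j = s (min_at (\<lambda>t. e t \<omega>) j) \<omega> \<and> \<tau> \<omega> j \<in> {-1, 1}"
          using sg \<open>\<tau> \<omega> j = \<sigma> (k (sample_path e \<omega>) j) \<omega>\<close> by metis
      qed
    qed
    have "distr M ?T (\<lambda>\<omega>. (sample_path e \<omega>, \<tau> \<omega>)) =
      distr (distr M ?T (\<lambda>\<omega>. (sample_path e \<omega>, \<lambda>n. \<sigma> n \<omega>))) ?T (\<lambda>(f, \<xi>). (f, signs_via k f \<xi>))"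
      by (subst distr_distr[OF via]) (auto simp: comp_def \<tau>_def)
    also have "\<dots> = distr (?P \<Otimes>\<^sub>M iid_signs p) ?T (\<lambda>(f, \<xi>). (f, signs_via k f \<xi>))"
      by (simp add: law)
    also have "\<dots> = distr (?P \<Otimes>\<^sub>M iid_signs p) ?T (\<lambda>(f, \<xi>). (f, signs_via first_interval f \<xi>))"
    proof (rule distr_signs_via_cong[OF P _ k_meas measurable_first_interval])
      have [measurable]: "Measurable.pred path_space (\<lambda>f. L n f = min_at f j)" for n j
        unfolding pred_def by (rule borel_measurable_eq[OF L measurable_min_at])
      have "AE f in ?P. \<forall>j. has_min f j \<longrightarrow> (\<exists>n. L n f = min_at f j)"
      proof (subst AE_distr_iff[OF sp])
        show "{f \<in> space path_space. \<forall>j. has_min f j \<longrightarrow> (\<exists>n. L n f = min_at f j)} \<in> sets path_space" by measurable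
      qed (rule ex)
      then show "AE f in ?P. \<forall>i j. has_min f i \<and> has_min f j \<longrightarrow> (k f i = k f j \<longleftrightarrow> first_interval f i = first_interval f j)"
      proof eventually_elim
        fix f assume ex: "\<forall>j. has_min f j \<longrightarrow> (\<exists>n. L n f = min_at f j)"
        have Lk: "L (k f j) f = min_at f j" if "has_min f j" for j
          unfolding k_def by (rule LeastI_ex[OF ex[rule_format, OF that]])
        show "\<forall>i j. has_min f i \<and> has_min f j \<longrightarrow> (k f i = k f j \<longleftrightarrow> first_interval f i = first_interval f j)"
        proof (intro allI impI)
          fix i j assume ij: "has_min f i \<and> has_min f j"
          have "k f i = k f j \<longleftrightarrow> min_at f i = min_at f j"
            using Lk[of i] Lk[of j] ij by (metis k_def)
          then show "k f i = k f j \<longleftrightarrow> first_interval f i = first_interval f j"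
            using first_interval_eq_iff ij by blast
        qed
      qed
    qed simp
    finally show "distr M ?T (\<lambda>\<omega>. (sample_path e \<omega>, \<tau> \<omega>)) =
      distr (?P \<Otimes>\<^sub>M iid_signs p) ?T (\<lambda>(f, \<xi>). (f, signs_via first_interval f \<xi>))" .
  qed
qed

lemma iid_signs_on_local_minima_uminus:
  assumes exc: "brownian_excursion M e" and iid: "iid_signs_on_local_minima M e (1 - p) s" and p: "0 \<le> p" "p \<le> 1"
  shows "iid_signs_on_local_minima M e p (\<lambda>r \<omega>. - s r \<omega>)"
proof -
  interpret prob_space M using exc by (simp add: brownian_excursion_def)
  let ?T = "path_space \<Otimes>\<^sub>M sign_space"
  let ?P = "distr M path_space (sample_path e)"
  obtain L \<sigma> where L: "\<And>n. L n \<in> borel_measurable path_space"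
    and bij: "AE \<omega> in M. bij_betw (\<lambda>n. L n (sample_path e \<omega>)) UNIV (local_minima (\<lambda>t. e t \<omega>))"
    and s: "AE \<omega> in M. \<forall>n. s (L n (sample_path e \<omega>)) \<omega> = \<sigma> n \<omega>"
    and \<sigma>: "\<And>n::nat. \<sigma> n \<in> M \<rightarrow>\<^sub>M count_space UNIV"
    and law: "distr M ?T (\<lambda>\<omega>. (sample_path e \<omega>, \<lambda>n. \<sigma> n \<omega>)) = ?P \<Otimes>\<^sub>M iid_signs (1 - p)"
    using iid unfolding iid_signs_on_local_minima_def by blast
  note sp [measurable] = measurable_sample_path[OF exc]
  have \<sigma>_meas [measurable]: "(\<lambda>\<omega> n. \<sigma> n \<omega>) \<in> M \<rightarrow>\<^sub>M sign_space"
    by (rule measurable_PiM_single') (auto simp: \<sigma>)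
  interpret P: prob_space ?P by (rule prob_space_distr[OF sp])
  interpret S: prob_space "iid_signs (1 - p)" by (rule prob_space_iid_signs)
  have neg [measurable]: "(\<lambda>\<xi> n. - \<xi> n) \<in> sign_space \<rightarrow>\<^sub>M sign_space"
    by (rule measurable_PiM_single') (auto simp: space_PiM)
  have neg' [measurable]: "(\<lambda>\<xi> n. - \<xi> n) \<in> iid_signs (1 - p) \<rightarrow>\<^sub>M sign_space"
    using neg by (simp cong: measurable_cong_sets)
  have "distr M ?T (\<lambda>\<omega>. (sample_path e \<omega>, \<lambda>n. - \<sigma> n \<omega>)) =
      distr (distr M ?T (\<lambda>\<omega>. (sample_path e \<omega>, \<lambda>n. \<sigma> n \<omega>))) ?T (\<lambda>(f, \<xi>). (f, \<lambda>n. - \<xi> n))"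
    by (subst distr_distr) (auto simp: comp_def split_beta')
  also have "\<dots> = distr (?P \<Otimes>\<^sub>M iid_signs (1 - p)) ?T (\<lambda>(f, \<xi>). (f, \<lambda>n. - \<xi> n))"
    by (simp add: law)
  also have "\<dots> = distr ?P path_space (\<lambda>f. f) \<Otimes>\<^sub>M distr (iid_signs (1 - p)) sign_space (\<lambda>\<xi> n. - \<xi> n)"
  proof (rule pair_measure_distr[symmetric])
    show "sigma_finite_measure (distr (iid_signs (1 - p)) sign_space (\<lambda>\<xi> n. - \<xi> n))"
      using S.prob_space_distr[OF neg'] by (simp add: prob_space_def finite_measure_def)
  qed measurable
  also have "\<dots> = ?P \<Otimes>\<^sub>M iid_signs p"
    by (simp add: distr_iid_uminus[OF p] distr_id2)
  finally have law': "distr M ?T (\<lambda>\<omega>. (sample_path e \<omega>, \<lambda>n. - \<sigma> n \<omega>)) = ?P \<Otimes>\<^sub>M iid_signs p" .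
  show ?thesis unfolding iid_signs_on_local_minima_def
  proof (intro exI conjI allI)
    show "AE \<omega> in M. \<forall>n. - s (L n (sample_path e \<omega>)) \<omega> = - \<sigma> n \<omega>" using s by eventually_elim simp
    show "(\<lambda>\<omega>. - \<sigma> n \<omega>) \<in> M \<rightarrow>\<^sub>M count_space UNIV" for n
      using \<sigma>[of n] by (rule measurable_compose) simp
  qed (fact L bij law')+
qed

section \<open>Permutons as measurable functions of path and signs\<close>

text \<open>The common form of \<open>psi\<close> and \<open>phi\<close>, written in terms of the signs of the rational intervals.\<close>

definition rank_of :: "(real \<Rightarrow> real) \<Rightarrow> (nat \<Rightarrow> int) \<Rightarrow> real \<Rightarrow> real" where
  "rank_of f \<tau> t = measure lborel {x\<in>{0..1}. (x < t \<and> sign_between f \<tau> x t 1) \<or> (t < x \<and> sign_between f \<tau> t x (- 1))}"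

definition permuton_of :: "(real \<Rightarrow> real) \<Rightarrow> (nat \<Rightarrow> int) \<Rightarrow> (real \<times> real) measure" where
  "permuton_of f \<tau> = distr (restrict_space lborel {0..1}) unit_square (\<lambda>t. (t, rank_of f \<tau> t))"

lemma measurable_sign_between:
  assumes F: "F \<in> N \<rightarrow>\<^sub>M path_space" and T: "T \<in> N \<rightarrow>\<^sub>M sign_space"
    and X: "X \<in> borel_measurable N" and Y: "Y \<in> borel_measurable N"
  shows "Measurable.pred N (\<lambda>z. sign_between (F z) (T z) (X z) (Y z) v)"
proof -
  have [measurable]: "Measurable.pred N (\<lambda>z. inside_min (F z) (X z) (Y z) (lo j) (hi j))" for j
    by (rule measurable_inside_min[OF F X Y])
  have "(\<lambda>z. T z j) \<in> N \<rightarrow>\<^sub>M count_space UNIV" for j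
    by (rule measurable_compose[OF T measurable_component_singleton]) simp
  then have [measurable]: "Measurable.pred N (\<lambda>z. T z j = v)" for j
    by (rule measurable_compose) simp
  show ?thesis unfolding sign_between_def by measurable
qed

lemma measurable_rank_set:
  "Measurable.pred (((path_space \<Otimes>\<^sub>M sign_space) \<Otimes>\<^sub>M borel) \<Otimes>\<^sub>M borel)
     (\<lambda>(((f, \<tau>), t), x). x \<in> {0..1} \<and> ((x < t \<and> sign_between f \<tau> x t 1) \<or> (t < x \<and> sign_between f \<tau> t x (- 1))))"
proof -
  let ?N = "((path_space \<Otimes>\<^sub>M sign_space) \<Otimes>\<^sub>M borel) \<Otimes>\<^sub>M (borel :: real measure)"
  have F: "(\<lambda>z. fst (fst (fst z))) \<in> ?N \<rightarrow>\<^sub>M path_space" and T: "(\<lambda>z. snd (fst (fst z))) \<in> ?N \<rightarrow>\<^sub>M sign_space"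
    by (intro measurable_compose[OF measurable_fst] measurable_fst measurable_snd)+
  have [measurable]: "(\<lambda>z. snd (fst z)) \<in> borel_measurable ?N" "(\<lambda>z. snd z) \<in> borel_measurable ?N"
    by (intro measurable_compose[OF measurable_fst] measurable_snd)+
  note [measurable] = measurable_sign_between[OF F T, of "\<lambda>z. snd z" "\<lambda>z. snd (fst z)"]
    measurable_sign_between[OF F T, of "\<lambda>z. snd (fst z)" "\<lambda>z. snd z"]
  show ?thesis unfolding split_beta atLeastAtMost_iff by measurable
qed

lemma rank_set_borel:
  assumes "f \<in> space path_space"
  shows "{x\<in>{0..1}. (x < t \<and> sign_between f \<tau> x t 1) \<or> (t < x \<and> sign_between f \<tau> t x (- 1))} \<in> sets borel"
proof -
  have "(\<lambda>x. (((f, \<tau>), t), x)) \<in> borel \<rightarrow>\<^sub>M ((path_space \<Otimes>\<^sub>M sign_space) \<Otimes>\<^sub>M borel) \<Otimes>\<^sub>M borel"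
    using assms by (intro measurable_Pair measurable_const measurable_ident) (auto simp: space_pair_measure space_PiM)
  from measurable_compose[OF this measurable_rank_set] show ?thesis
    by (simp add: pred_def)
qed

lemma measurable_rank_of:
  "(\<lambda>((f, \<tau>), t). rank_of f \<tau> t) \<in> borel_measurable ((path_space \<Otimes>\<^sub>M sign_space) \<Otimes>\<^sub>M borel)"
proof -
  let ?N = "(path_space \<Otimes>\<^sub>M sign_space) \<Otimes>\<^sub>M (borel :: real measure)"
  let ?Q = "\<lambda>(((f, \<tau>), t), x). x \<in> {0..1} \<and> ((x < t \<and> sign_between f \<tau> x t 1) \<or> (t < x \<and> sign_between f \<tau> t x (- 1)))"
  have "(\<lambda>z. indicator {z. ?Q z} z :: ennreal) \<in> borel_measurable (?N \<Otimes>\<^sub>M borel)"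
    using measurable_rank_set by (intro borel_measurable_indicator') (simp add: pred_def)
  also have "borel_measurable (?N \<Otimes>\<^sub>M borel) = borel_measurable (?N \<Otimes>\<^sub>M (lborel :: real measure))"
    by (intro measurable_cong_sets sets_pair_measure_cong) simp_all
  finally have "(\<lambda>z. indicator {z. ?Q z} z :: ennreal) \<in> borel_measurable (?N \<Otimes>\<^sub>M lborel)" .
  then have "(\<lambda>w. \<integral>\<^sup>+x. indicator {z. ?Q z} (w, x) \<partial>lborel) \<in> borel_measurable ?N"
    by (intro lborel.borel_measurable_nn_integral) (simp add: split_beta')
  then have "(\<lambda>w. enn2real (\<integral>\<^sup>+x. indicator {z. ?Q z} (w, x) \<partial>lborel)) \<in> borel_measurable ?N" by measurable
  also have "?this \<longleftrightarrow> (\<lambda>((f, \<tau>), t). rank_of f \<tau> t) \<in> borel_measurable ?N"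
  proof (rule measurable_cong)
    fix w assume w: "w \<in> space ?N"
    obtain f \<tau> t where [simp]: "w = ((f, \<tau>), t)" by (metis prod.exhaust)
    let ?S = "{x\<in>{0..1}. (x < t \<and> sign_between f \<tau> x t 1) \<or> (t < x \<and> sign_between f \<tau> t x (- 1))}"
    have S: "?S \<in> sets lborel" using w rank_set_borel[of f t \<tau>] by (simp add: space_pair_measure)
    have "(\<integral>\<^sup>+x. indicator {z. ?Q z} (w, x) \<partial>lborel) = (\<integral>\<^sup>+x. indicator ?S x \<partial>lborel)"
      by (intro nn_integral_cong) (simp add: indicator_def)
    also have "\<dots> = emeasure lborel ?S" by (rule nn_integral_indicator[OF S])
    finally show "enn2real (\<integral>\<^sup>+x. indicator {z. ?Q z} (w, x) \<partial>lborel) = (case w of (x, t) \<Rightarrow> (case x of (f, \<tau>) \<Rightarrow> \<lambda>t. rank_of f \<tau> t) t)"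
      by (simp add: rank_of_def measure_def)
  qed
  finally show ?thesis .
qed

lemma rank_of_bounds: 
  assumes "f \<in> space path_space" shows "rank_of f \<tau> t \<in> {0..1}"
proof -
  have "rank_of f \<tau> t \<le> measure lborel {0..1::real}"
    unfolding rank_of_def using rank_set_borel[OF assms] by (intro measure_mono_fmeasurable) (auto intro!: fmeasurableI)
  then show ?thesis by (simp add: rank_of_def)
qed

lemma measurable_permuton_of:
  "(\<lambda>(f, \<tau>). permuton_of f \<tau>) \<in> path_space \<Otimes>\<^sub>M sign_space \<rightarrow>\<^sub>M prob_algebra unit_square"
proof -
  let ?U = "restrict_space lborel {0..1::real}"
  let ?L = "path_space \<Otimes>\<^sub>M sign_space"
  have "prob_space ?U" by (intro prob_spaceI) (simp add: emeasure_restrict_space space_restrict_space)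
  then have U: "(\<lambda>_. ?U) \<in> ?L \<rightarrow>\<^sub>M prob_algebra ?U" by (intro measurable_const) (simp add: space_prob_algebra)
  have "(\<lambda>(z, t). (t, rank_of (fst z) (snd z) t)) \<in> ?L \<Otimes>\<^sub>M ?U \<rightarrow>\<^sub>M unit_square"
  proof (rule measurable_restrict_space2)
    show "(\<lambda>(z, t). (t, rank_of (fst z) (snd z) t)) \<in> space (?L \<Otimes>\<^sub>M ?U) \<rightarrow> {0..1} \<times> {0..1}"
      using rank_of_bounds by (auto simp: space_pair_measure space_restrict_space)
    have t: "snd \<in> ?L \<Otimes>\<^sub>M ?U \<rightarrow>\<^sub>M (borel :: real measure)"
      by (rule measurable_compose[OF measurable_snd]) (rule measurable_restrict_space1, simp)
    have "(\<lambda>z. (fst z, snd z)) \<in> ?L \<Otimes>\<^sub>M ?U \<rightarrow>\<^sub>M ?L \<Otimes>\<^sub>M (borel :: real measure)"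
      by (intro measurable_Pair measurable_fst t)
    from measurable_compose[OF this measurable_rank_of]
    have r: "(\<lambda>z. rank_of (fst (fst z)) (snd (fst z)) (snd z)) \<in> borel_measurable (?L \<Otimes>\<^sub>M ?U)"
      by (simp add: split_beta')
    have "(\<lambda>z. (snd z, rank_of (fst (fst z)) (snd (fst z)) (snd z))) \<in> ?L \<Otimes>\<^sub>M ?U \<rightarrow>\<^sub>M borel"
      by (rule borel_measurable_Pair[OF t r])
    then show "(\<lambda>(z, t). (t, rank_of (fst z) (snd z) t)) \<in> ?L \<Otimes>\<^sub>M ?U \<rightarrow>\<^sub>M borel"
      by (simp add: split_beta')
  qed
  from measurable_distr_prob_space2[OF U this] show ?thesis
    by (simp add: permuton_of_def split_beta')
qed

text \<open>The sets that define \<open>psi\<close> and \<open>phi\<close>, and the preimages of Borel sets under these functions, are only almost everywhere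
equal to Borel sets. Completeness of Lebesgue measure makes them measurable.\<close>

lemma AE_eq_lebesgue:
  assumes B: "B \<in> sets borel" and AE: "AE x in lborel. x \<in> A \<longleftrightarrow> x \<in> B"
  shows "A \<in> sets lebesgue" "emeasure lebesgue A = emeasure lborel B" "measure lebesgue A = measure lborel B"
proof -
  have AE': "AE x in lebesgue. x \<in> A \<longleftrightarrow> x \<in> B" using AE by (rule AE_completion)
  have B': "B \<in> sets lebesgue" using B by auto
  show A: "A \<in> sets lebesgue"
    by (rule completion.in_sets_AE[OF _ B']) (use AE' in \<open>auto elim: eventually_mono\<close>)
  show e: "emeasure lebesgue A = emeasure lborel B"
    using emeasure_eq_AE[OF AE' A B'] B by simp
  then show "measure lebesgue A = measure lborel B" by (simp add: measure_def)
qed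

lemma distr_lebesgue_eq_permuton_of:
  assumes f: "f \<in> space path_space" and r: "\<And>t. t \<in> {0..1} \<Longrightarrow> r t \<in> {0..1}"
    and AE: "AE t in lborel. t \<in> {0..1} \<longrightarrow> r t = rank_of f \<tau> t"
  shows "distr (lebesgue_on {0..1}) unit_square (\<lambda>t. (t, r t)) = permuton_of f \<tau>"
proof (rule measure_eqI)
  let ?U = "restrict_space lborel {0..1::real}"
  let ?g = "\<lambda>t. (t, rank_of f \<tau> t)" and ?h = "\<lambda>t. (t, r t)"
  have g: "?g \<in> ?U \<rightarrow>\<^sub>M unit_square"
  proof (rule measurable_restrict_space2)
    show "?g \<in> space ?U \<rightarrow> {0..1} \<times> {0..1}" using rank_of_bounds[OF f] by (auto simp: space_restrict_space)
    have t: "(\<lambda>t. t) \<in> ?U \<rightarrow>\<^sub>M (borel :: real measure)" by (rule measurable_restrict_space1) simp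
    have "(\<lambda>t. ((f, \<tau>), t)) \<in> ?U \<rightarrow>\<^sub>M (path_space \<Otimes>\<^sub>M sign_space) \<Otimes>\<^sub>M borel"
      using f by (intro measurable_Pair measurable_const t) (auto simp: space_pair_measure space_PiM)
    from measurable_compose[OF this measurable_rank_of] t
    show "?g \<in> borel_measurable ?U" by (intro borel_measurable_Pair) simp_all
  qed
  have sets_eq: "?h -` B \<inter> {0..1} \<in> sets lebesgue" "emeasure lebesgue (?h -` B \<inter> {0..1}) = emeasure (permuton_of f \<tau>) B"
    if B: "B \<in> sets unit_square" for B
  proof -
    have "?g -` B \<inter> space ?U \<in> sets ?U" using g B by (rule measurable_sets)
    then have gB: "?g -` B \<inter> {0..1} \<in> sets borel" "?g -` B \<inter> space ?U = ?g -` B \<inter> {0..1}"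
      by (auto simp: sets_restrict_space_iff space_restrict_space)
    have AE': "AE t in lborel. t \<in> ?h -` B \<inter> {0..1} \<longleftrightarrow> t \<in> ?g -` B \<inter> {0..1}"
      using AE by eventually_elim auto
    show "?h -` B \<inter> {0..1} \<in> sets lebesgue" by (rule AE_eq_lebesgue(1)[OF gB(1) AE'])
    have "emeasure (permuton_of f \<tau>) B = emeasure ?U (?g -` B \<inter> {0..1})"
      unfolding permuton_of_def by (subst emeasure_distr[OF g B]) (simp add: gB)
    also have "\<dots> = emeasure lborel (?g -` B \<inter> {0..1})" by (rule emeasure_restrict_space) auto
    finally show "emeasure lebesgue (?h -` B \<inter> {0..1}) = emeasure (permuton_of f \<tau>) B"
      using AE_eq_lebesgue(2)[OF gB(1) AE'] by simp
  qed
  have h: "?h \<in> lebesgue_on {0..1} \<rightarrow>\<^sub>M unit_square"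
  proof (rule measurableI)
    show "?h t \<in> space unit_square" if "t \<in> space (lebesgue_on {0..1})" for t
      using that r by (auto simp: space_restrict_space)
    show "?h -` B \<inter> space (lebesgue_on {0..1}) \<in> sets (lebesgue_on {0..1})" if "B \<in> sets unit_square" for B
      using sets_eq(1)[OF that] by (simp add: sets_restrict_space_iff space_restrict_space)
  qed
  show "sets (distr (lebesgue_on {0..1}) unit_square ?h) = sets (permuton_of f \<tau>)"
    by (simp add: permuton_of_def)
  fix B assume "B \<in> sets (distr (lebesgue_on {0..1}) unit_square ?h)"
  then have B: "B \<in> sets unit_square" by simp
  have "emeasure (distr (lebesgue_on {0..1}) unit_square ?h) B = emeasure (lebesgue_on {0..1}) (?h -` B \<inter> {0..1})"
    by (subst emeasure_distr[OF h B]) (simp add: space_restrict_space)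
  also have "\<dots> = emeasure lebesgue (?h -` B \<inter> {0..1})" by (rule emeasure_restrict_space) auto
  also have "\<dots> = emeasure (permuton_of f \<tau>) B" by (rule sets_eq(2)[OF B])
  finally show "emeasure (distr (lebesgue_on {0..1}) unit_square ?h) B = emeasure (permuton_of f \<tau>) B" .
qed

text \<open>Between two generic times the sign at the minimum is the one read off from the rational intervals, and
the minimum is the minimum of some rational interval, so that information about \<open>\<tau>\<close> is information about
its sign.\<close>

lemma sign_at_sole_interior_min:
  assumes cont: "continuous_on {0..1} f" and dm: "distinct_minima f"
    and x: "generic_time f x" and y: "generic_time f y" and "x < y"
    and \<tau>: "\<And>j. has_min f j \<Longrightarrow> \<tau> j = s (min_at f j)"
  shows "\<exists>l. sole_interior_min f x y l \<and> (\<forall>v. sign_between (restrict f {0..1}) \<tau> x y v \<longleftrightarrow> s l = v) \<and>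
    (\<exists>j. has_min f j \<and> min_at f j = l)"
proof -
  obtain l where l: "sole_interior_min f x y l" using sole_interior_min_generic[OF cont dm x y \<open>x < y\<close>] by blast
  have xy: "0 < x" "y < 1" using x y by (auto simp: generic_time_def)
  have "sign_between (restrict f {0..1}) \<tau> x y v \<longleftrightarrow> s l = v" for v
    using sign_between_iff[OF cont dm l, of \<tau> s v] \<tau> xy by (simp add: sign_between_def inside_min_restrict)
  moreover have "\<exists>j. has_min f j \<and> min_at f j = l"
  proof -
    have lxy: "x < l" "l < y" using l by (auto simp: sole_interior_min_def)
    obtain a :: rat where a: "x < of_rat a" "of_rat a < l" using of_rat_dense[OF lxy(1)] by blast
    obtain b :: rat where b: "l < of_rat b" "of_rat b < y" using of_rat_dense[OF lxy(2)] by blast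
    define j where "j = to_nat (a, b)"
    have j: "lo j = of_rat a" "hi j = of_rat b" by (simp_all add: j_def lo_def hi_def)
    have "sole_interior_min f (lo j) (hi j) l"
      unfolding j using a b by (intro sole_interior_min_subset[OF l]) auto
    moreover have "0 < lo j" "lo j < hi j" "hi j < 1" unfolding j using a b xy by linarith+
    ultimately show ?thesis using has_min_iff[OF cont dm, of j] by blast
  qed
  ultimately show ?thesis using l by (intro exI[of _ l] conjI allI)
qed

text \<open>For almost every \<open>x\<close> the minimum between \<open>x\<close> and \<open>t\<close> is the strict local minimum that
\<open>signed_less\<close> asks for.\<close>

lemma psi_eq_rank_of:
  assumes f: "continuous_on {0..1} f" "distinct_minima f" "rough f" and t: "generic_time f t"
    and \<tau>: "\<And>j. has_min f j \<Longrightarrow> \<tau> j = s (min_at f j)"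
  shows "psi f s t = rank_of (restrict f {0..1}) \<tau> t"
proof -
  let ?f = "restrict f {0..1}"
  have "AE x in lborel. x \<noteq> t" by (rule AE_lborel_singleton)
  with AE_generic_time[OF f(1,3)]
  have "AE x in lborel. x \<in> {x\<in>{0..1}. signed_less f s x t} \<longleftrightarrow>
     x \<in> {x\<in>{0..1}. (x < t \<and> sign_between ?f \<tau> x t 1) \<or> (t < x \<and> sign_between ?f \<tau> t x (- 1))}"
  proof eventually_elim
    fix x assume x: "x \<in> {0..1} \<longrightarrow> generic_time f x" and "x \<noteq> t"
    have usm: "(\<exists>l. unique_strict_min f u v l \<and> s l = i) \<longleftrightarrow> s l = i"
      if l: "sole_interior_min f u v l" and uv: "generic_time f u" "generic_time f v" for u v l i
    proof -
      have "unique_strict_min f u v l"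
        using l sole_interior_min_local(1)[OF l] uv by (auto simp: unique_strict_min_def sole_interior_min_def generic_time_def)
      moreover have "l' = l" if "unique_strict_min f u v l'" for l'
      proof (rule ccontr)
        assume "l' \<noteq> l"
        moreover have "l' \<in> {u..v}" "l \<in> {u..v}" "\<forall>r\<in>{u..v} - {l'}. f l' < f r" "\<forall>r\<in>{u..v} - {l}. f l < f r"
          using l that by (auto simp: unique_strict_min_def sole_interior_min_def)
        ultimately have "f l' < f l" "f l < f l'" by simp_all
        then show False by simp
      qed
      ultimately show ?thesis by blast
    qed
    show "x \<in> {x\<in>{0..1}. signed_less f s x t} \<longleftrightarrow>
     x \<in> {x\<in>{0..1}. (x < t \<and> sign_between ?f \<tau> x t 1) \<or> (t < x \<and> sign_between ?f \<tau> t x (- 1))}"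
    proof (cases "x \<in> {0..1}")
      case True
      then have x: "generic_time f x" using x by simp
      show ?thesis
      proof (cases "x < t")
        case True
        obtain l where l: "sole_interior_min f x t l \<and> (\<forall>v. sign_between ?f \<tau> x t v \<longleftrightarrow> s l = v) \<and> (\<exists>j. has_min f j \<and> min_at f j = l)"
          using sign_at_sole_interior_min[where \<tau>=\<tau> and s=s, OF f(1,2) x t True \<tau>] ..
        then show ?thesis using True usm[of x t l] x t l by (simp add: signed_less_def)
      next
        case False
        with \<open>x \<noteq> t\<close> have "t < x" by simp
        obtain l where l: "sole_interior_min f t x l \<and> (\<forall>v. sign_between ?f \<tau> t x v \<longleftrightarrow> s l = v) \<and> (\<exists>j. has_min f j \<and> min_at f j = l)"
          using sign_at_sole_interior_min[where \<tau>=\<tau> and s=s, OF f(1,2) t x \<open>t < x\<close> \<tau>] ..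
        then show ?thesis using \<open>t < x\<close> usm[of t x l] x t l by (simp add: signed_less_def)
      qed
    next
      case False
      then show ?thesis by (simp only: mem_Collect_eq simp_thms)
    qed
  qed
  from AE_eq_lebesgue(3)[OF rank_set_borel this] show ?thesis
    by (simp add: psi_def rank_of_def space_PiM)
qed

text \<open>The running minimum is attained only at \<open>l\<close>, so \<open>l\<close> is also the last time at which it is attained.\<close>

lemma skew_process_eq:
  assumes l: "sole_interior_min f u v l"
  shows "skew_process f s u v = (f v - f l) * of_int (s l)" "f l < f v"
proof -
  have uv: "u < l" "l < v" "\<And>r. r \<in> {u..v} - {l} \<Longrightarrow> f l < f r" using l by (auto simp: sole_interior_min_def)
  have m: "running_min f u v = f l"
    unfolding running_min_def
  proof (rule cInf_eq_minimum)
    show "f l \<in> f ` {u..v}" using uv by auto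
    show "f l \<le> y" if "y \<in> f ` {u..v}" for y
    proof -
      from that obtain r where r: "r \<in> {u..v}" "y = f r" by blast
      show ?thesis using uv(3)[of r] r by (cases "r = l") auto
    qed
  qed
  have "{r\<in>{u..v}. f r = f l} = {l}"
  proof
    show "{r\<in>{u..v}. f r = f l} \<subseteq> {l}" using uv(3) by fastforce
  qed (use uv in auto)
  then show "skew_process f s u v = (f v - f l) * of_int (s l)"
    using uv by (simp add: skew_process_def m)
  show "f l < f v" using uv by auto
qed

text \<open>Between generic times the skew process is a positive multiple of the sign at the minimum, so its sign
condition is a condition on that sign. The roles of the two signs are exchanged in comparison with
\<open>psi\<close>, whence \<open>\<tau>\<close> carries the opposite signs.\<close>

lemma phi_eq_rank_of:
  assumes f: "continuous_on {0..1} f" "distinct_minima f" "rough f" and t: "generic_time f t"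
    and \<tau>: "\<And>j. has_min f j \<Longrightarrow> \<tau> j = - s (min_at f j) \<and> \<tau> j \<in> {-1, 1}"
  shows "phi f s t = rank_of (restrict f {0..1}) \<tau> t"
proof -
  let ?f = "restrict f {0..1}"
  have \<tau>': "\<tau> j = (\<lambda>r. - s r) (min_at f j)" if "has_min f j" for j using \<tau>[OF that] by simp
  have t01: "0 < t" "t < 1" using t by (auto simp: generic_time_def)
  have "AE x in lborel. x \<noteq> t" by (rule AE_lborel_singleton)
  with AE_generic_time[OF f(1,3)]
  have "AE x in lborel. x \<in> {x\<in>{0..<t}. skew_process f s x t < 0} \<union> {x\<in>{t..1}. 0 \<le> skew_process f s t x} \<longleftrightarrow>
     x \<in> {x\<in>{0..1}. (x < t \<and> sign_between ?f \<tau> x t 1) \<or> (t < x \<and> sign_between ?f \<tau> t x (- 1))}"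
  proof eventually_elim
    fix x assume x: "x \<in> {0..1} \<longrightarrow> generic_time f x" and "x \<noteq> t"
    have pm: "s l = 1 \<or> s l = -1" if ex: "\<exists>j. has_min f j \<and> min_at f j = l" for l
    proof -
      obtain j where "has_min f j" "min_at f j = l" using ex by blast
      then show ?thesis using \<tau>[of j] by auto
    qed
    show "x \<in> {x\<in>{0..<t}. skew_process f s x t < 0} \<union> {x\<in>{t..1}. 0 \<le> skew_process f s t x} \<longleftrightarrow>
     x \<in> {x\<in>{0..1}. (x < t \<and> sign_between ?f \<tau> x t 1) \<or> (t < x \<and> sign_between ?f \<tau> t x (- 1))}"
    proof (cases "x \<in> {0..1}")
      case True
      then have x: "generic_time f x" and x01: "0 \<le> x" "x \<le> 1" using x by auto
      show ?thesis
      proof (cases "x < t")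
        case True
        obtain l where l: "sole_interior_min f x t l \<and> (\<forall>v. sign_between ?f \<tau> x t v \<longleftrightarrow> - s l = v) \<and> (\<exists>j. has_min f j \<and> min_at f j = l)"
          using sign_at_sole_interior_min[where \<tau>=\<tau> and s="\<lambda>r. - s r", OF f(1,2) x t True \<tau>'] ..
        note l = l[THEN conjunct1] l[THEN conjunct2, THEN conjunct1, rule_format] l[THEN conjunct2, THEN conjunct2]
        have "skew_process f s x t < 0 \<longleftrightarrow> s l = - 1"
          using skew_process_eq(1)[OF l(1), of s] skew_process_eq(2)[OF l(1)] pm[OF l(3)] by auto
        then show ?thesis using True x01 l(2)[of 1] by auto
      next
        case False
        with \<open>x \<noteq> t\<close> have "t < x" by simp
        obtain l where l: "sole_interior_min f t x l \<and> (\<forall>v. sign_between ?f \<tau> t x v \<longleftrightarrow> - s l = v) \<and> (\<exists>j. has_min f j \<and> min_at f j = l)"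
          using sign_at_sole_interior_min[where \<tau>=\<tau> and s="\<lambda>r. - s r", OF f(1,2) t x \<open>t < x\<close> \<tau>'] ..
        note l = l[THEN conjunct1] l[THEN conjunct2, THEN conjunct1, rule_format] l[THEN conjunct2, THEN conjunct2]
        have "0 \<le> skew_process f s t x \<longleftrightarrow> s l = 1"
          using skew_process_eq(1)[OF l(1), of s] skew_process_eq(2)[OF l(1)] pm[OF l(3)] by auto
        then show ?thesis using \<open>t < x\<close> x01 l(2)[of "- 1"] by auto
      qed
    next
      case False
      then show ?thesis using t01 by auto
    qed
  qed
  from AE_eq_lebesgue(3)[OF rank_set_borel this] show ?thesis
    by (simp add: phi_def rank_of_def space_PiM)
qed

lemma measure_lebesgue_unit_interval:
  assumes "A \<subseteq> {0..1::real}" shows "measure lebesgue A \<in> {0..1}"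
proof (cases "A \<in> sets lebesgue")
  case True
  have "measure lebesgue A \<le> measure lebesgue {0..1::real}"
    using True assms by (intro measure_mono_fmeasurable) auto
  then show ?thesis by simp
qed (simp add: measure_notin_sets)

lemma separable_permuton_eq:
  assumes f: "continuous_on {0..1} f" "distinct_minima f" "rough f"
    and \<tau>: "\<And>j. has_min f j \<Longrightarrow> \<tau> j = s (min_at f j)"
  shows "separable_permuton f s = permuton_of (restrict f {0..1}) \<tau>"
  unfolding separable_permuton_def
proof (rule distr_lebesgue_eq_permuton_of)
  show "psi f s t \<in> {0..1}" for t unfolding psi_def by (rule measure_lebesgue_unit_interval) auto
  show "AE t in lborel. t \<in> {0..1} \<longrightarrow> psi f s t = rank_of (restrict f {0..1}) \<tau> t"
    using AE_generic_time[OF f(1,3)]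
  proof eventually_elim
    fix t assume "t \<in> {0..1} \<longrightarrow> generic_time f t"
    then show "t \<in> {0..1} \<longrightarrow> psi f s t = rank_of (restrict f {0..1}) \<tau> t"
      using psi_eq_rank_of[where f=f and \<tau>=\<tau> and s=s and t=t, OF f _ \<tau>] by blast
  qed
qed (simp add: space_PiM)

lemma skew_permuton_eq:
  assumes f: "continuous_on {0..1} f" "distinct_minima f" "rough f"
    and \<tau>: "\<And>j. has_min f j \<Longrightarrow> \<tau> j = - s (min_at f j) \<and> \<tau> j \<in> {-1, 1}"
  shows "skew_permuton f s = permuton_of (restrict f {0..1}) \<tau>"
  unfolding skew_permuton_def
proof (rule distr_lebesgue_eq_permuton_of)
  show "phi f s t \<in> {0..1}" if "t \<in> {0..1}" for t
    unfolding phi_def by (rule measure_lebesgue_unit_interval) (use that in auto)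
  show "AE t in lborel. t \<in> {0..1} \<longrightarrow> phi f s t = rank_of (restrict f {0..1}) \<tau> t"
    using AE_generic_time[OF f(1,3)]
  proof eventually_elim
    fix t assume "t \<in> {0..1} \<longrightarrow> generic_time f t"
    then show "t \<in> {0..1} \<longrightarrow> phi f s t = rank_of (restrict f {0..1}) \<tau> t"
      using phi_eq_rank_of[where f=f and \<tau>=\<tau> and s=s and t=t, OF f _ \<tau>] by blast
  qed
qed (simp add: space_PiM)

lemma law_of_permuton_of:
  assumes exc: "brownian_excursion M e" and \<tau>: "\<tau> \<in> M \<rightarrow>\<^sub>M sign_space"
  shows "(\<lambda>\<omega>. permuton_of (sample_path e \<omega>) (\<tau> \<omega>)) \<in> M \<rightarrow>\<^sub>M prob_algebra unit_square"
    and "distr M (prob_algebra unit_square) (\<lambda>\<omega>. permuton_of (sample_path e \<omega>) (\<tau> \<omega>)) =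
      distr (distr M (path_space \<Otimes>\<^sub>M sign_space) (\<lambda>\<omega>. (sample_path e \<omega>, \<tau> \<omega>))) (prob_algebra unit_square) (\<lambda>(f, \<tau>). permuton_of f \<tau>)"
proof -
  have pair: "(\<lambda>\<omega>. (sample_path e \<omega>, \<tau> \<omega>)) \<in> M \<rightarrow>\<^sub>M path_space \<Otimes>\<^sub>M sign_space"
    by (intro measurable_Pair measurable_sample_path[OF exc] \<tau>)
  show "(\<lambda>\<omega>. permuton_of (sample_path e \<omega>) (\<tau> \<omega>)) \<in> M \<rightarrow>\<^sub>M prob_algebra unit_square"
    using measurable_compose[OF pair measurable_permuton_of] by simp
  show "distr M (prob_algebra unit_square) (\<lambda>\<omega>. permuton_of (sample_path e \<omega>) (\<tau> \<omega>)) =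
      distr (distr M (path_space \<Otimes>\<^sub>M sign_space) (\<lambda>\<omega>. (sample_path e \<omega>, \<tau> \<omega>))) (prob_algebra unit_square) (\<lambda>(f, \<tau>). permuton_of f \<tau>)"
    by (subst distr_distr[OF measurable_permuton_of pair]) (simp add: comp_def)
qed

theorem theorem1p12:
  fixes p :: real
    and M :: "'a measure" and e :: "real \<Rightarrow> 'a \<Rightarrow> real" and s :: "real \<Rightarrow> 'a \<Rightarrow> int"
    and M' :: "'b measure" and e' :: "real \<Rightarrow> 'b \<Rightarrow> real" and s' :: "real \<Rightarrow> 'b \<Rightarrow> int"
  assumes "0 \<le> p" and "p \<le> 1"
    and "brownian_excursion M e" and "iid_signs_on_local_minima M e p s"
    and "brownian_excursion M' e'" and "iid_signs_on_local_minima M' e' (1 - p) s'"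
  shows "equal_in_distribution (prob_algebra unit_square)
           M (\<lambda>\<omega>. separable_permuton (\<lambda>t. e t \<omega>) (\<lambda>r. s r \<omega>))
           M' (\<lambda>\<omega>. skew_permuton (\<lambda>t. e' t \<omega>) (\<lambda>r. s' r \<omega>))"
proof -
  note exc = assms(3) and exc' = assms(5)
  \<comment> \<open>the opposite signs on \<open>e'\<close> have parameter \<open>p\<close>, and for them the skew permuton is a separable one\<close>
  have neg: "iid_signs_on_local_minima M' e' p (\<lambda>r \<omega>. - s' r \<omega>)"
    by (rule iid_signs_on_local_minima_uminus[OF exc' assms(6,1,2)])
  obtain \<tau> where \<tau>: "\<tau> \<in> M \<rightarrow>\<^sub>M sign_space"
    and \<tau>_sign: "AE \<omega> in M. \<forall>j. has_min (\<lambda>t. e t \<omega>) j \<longrightarrow> \<tau> \<omega> j = s (min_at (\<lambda>t. e t \<omega>) j) \<omega> \<and> \<tau> \<omega> j \<in> {-1, 1}"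
    and \<tau>_law: "distr M (path_space \<Otimes>\<^sub>M sign_space) (\<lambda>\<omega>. (sample_path e \<omega>, \<tau> \<omega>)) =
      distr (distr M path_space (sample_path e) \<Otimes>\<^sub>M iid_signs p) (path_space \<Otimes>\<^sub>M sign_space)
        (\<lambda>(f, \<xi>). (f, signs_via first_interval f \<xi>))"
    by (rule joint_law_of_path_and_signs[OF exc assms(4)])
  obtain \<tau>' where \<tau>': "\<tau>' \<in> M' \<rightarrow>\<^sub>M sign_space"
    and \<tau>'_sign: "AE \<omega> in M'. \<forall>j. has_min (\<lambda>t. e' t \<omega>) j \<longrightarrow> \<tau>' \<omega> j = - s' (min_at (\<lambda>t. e' t \<omega>) j) \<omega> \<and> \<tau>' \<omega> j \<in> {-1, 1}"
    and \<tau>'_law: "distr M' (path_space \<Otimes>\<^sub>M sign_space) (\<lambda>\<omega>. (sample_path e' \<omega>, \<tau>' \<omega>)) =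
      distr (distr M' path_space (sample_path e') \<Otimes>\<^sub>M iid_signs p) (path_space \<Otimes>\<^sub>M sign_space)
        (\<lambda>(f, \<xi>). (f, signs_via first_interval f \<xi>))"
    by (rule joint_law_of_path_and_signs[OF exc' neg])
  show ?thesis unfolding equal_in_distribution_def
  proof (intro exI conjI)
    show "(\<lambda>\<omega>. permuton_of (sample_path e \<omega>) (\<tau> \<omega>)) \<in> M \<rightarrow>\<^sub>M prob_algebra unit_square"
      by (rule law_of_permuton_of(1)[OF exc \<tau>])
    show "(\<lambda>\<omega>. permuton_of (sample_path e' \<omega>) (\<tau>' \<omega>)) \<in> M' \<rightarrow>\<^sub>M prob_algebra unit_square"
      by (rule law_of_permuton_of(1)[OF exc' \<tau>'])
    show "AE \<omega> in M. separable_permuton (\<lambda>t. e t \<omega>) (\<lambda>r. s r \<omega>) = permuton_of (sample_path e \<omega>) (\<tau> \<omega>)"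
      using AE_excursion[OF exc] AE_distinct_minima[OF exc] AE_rough[OF exc] \<tau>_sign
      by eventually_elim (intro separable_permuton_eq; blast)
    show "AE \<omega> in M'. skew_permuton (\<lambda>t. e' t \<omega>) (\<lambda>r. s' r \<omega>) = permuton_of (sample_path e' \<omega>) (\<tau>' \<omega>)"
      using AE_excursion[OF exc'] AE_distinct_minima[OF exc'] AE_rough[OF exc'] \<tau>'_sign
      by eventually_elim (intro skew_permuton_eq; blast)
    show "distr M (prob_algebra unit_square) (\<lambda>\<omega>. permuton_of (sample_path e \<omega>) (\<tau> \<omega>)) =
      distr M' (prob_algebra unit_square) (\<lambda>\<omega>. permuton_of (sample_path e' \<omega>) (\<tau>' \<omega>))"
      unfolding law_of_permuton_of(2)[OF exc \<tau>] law_of_permuton_of(2)[OF exc' \<tau>'] \<tau>_law \<tau>'_law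
        distr_sample_path_eq[OF exc exc'] ..
  qed
qed

end
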